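(* Let $k$ be a fixed positive integer. There exists a randomized algorithm running in $\tilde{O}(mn + n^{k/2 + 1})$ time that, when given an integer $R$ and an unweighted, undirected graph $G$ with $n$ vertices and $m$ edges, with high probability correctly determines one of the following: (1) $R_k(G) > R$, or (2) $R_k(G) \leq 2R - \lfloor\frac{R}{2k-1}\rfloor$.
   Context: $G=(V,E)$ is an undirected unweighted graph with $n$ vertices and $m\ge n-1$ edges, $d$ its shortest-path distance. $R_k(G)=\min_{C\subseteq V,|C|=k}\max_{v\in V} d(v,C)$ with $d(v,C)=\min_{c\in C}d(v,c)$ (the $k$-radius). The algorithm outputs one of the two assertions, and the output assertion holds (at least one of them is always true). $\tilde O$ hides polylogarithmic factors; "with high probability" means with probability at least $1-1/n^{c}$ for a constant $c>0$. *)

theory Defs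
  imports "HOL-Probability.Probability_Mass_Function" "HOL-Library.Extended_Real"
begin

subsection \<open>Graphs and the \<open>k\<close>-radius\<close>

text \<open>A finite simple undirected graph on the vertices \<open>0, \<dots>, n - 1\<close> is given by its set of
  edges, each edge being a two-element set of vertices.\<close>

definition graph :: "nat \<Rightarrow> nat set set \<Rightarrow> bool" where
  "graph n E \<longleftrightarrow> E \<subseteq> {{u, v} | u v. u < n \<and> v < n \<and> u \<noteq> v}"

definition adj :: "nat set set \<Rightarrow> (nat \<times> nat) set" where
  "adj E = {(u, v). {u, v} \<in> E}"

text \<open>\<open>(u, v) \<in> adj E ^^ l\<close> says that there is a walk with \<open>l\<close> edges from \<open>u\<close> to \<open>v\<close>;
  the distance between different components is \<open>\<infinity>\<close>.\<close>

definition gdist :: "nat set set \<Rightarrow> nat \<Rightarrow> nat \<Rightarrow> enat" where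
  "gdist E u v = (INF l \<in> {l. (u, v) \<in> adj E ^^ l}. enat l)"

definition gdist_set :: "nat set set \<Rightarrow> nat \<Rightarrow> nat set \<Rightarrow> enat" where
  "gdist_set E v C = (INF c\<in>C. gdist E v c)"

definition k_radius :: "nat \<Rightarrow> nat \<Rightarrow> nat set set \<Rightarrow> enat" where
  "k_radius k n E = (INF C \<in> {C. C \<subseteq> {..<n} \<and> card C = k}. SUP v\<in>{..<n}. gdist_set E v C)"

subsection \<open>A randomized word RAM\<close>

text \<open>Programs use finitely many registers and finitely many random access arrays, all of
  whose cells hold machine words. Words are two's complement integers with \<open>w\<close> bits and a sign,
  i.e. integers in \<open>{- (2 ^ w)..<2 ^ w}\<close>, and arithmetic wraps around.\<close>

record state =
  reg :: "nat \<Rightarrow> int"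
  arr :: "nat \<Rightarrow> int \<Rightarrow> int"

datatype bop = Add | Sub | Mul | Div | Mod | Less

fun bop_val :: "bop \<Rightarrow> int \<Rightarrow> int \<Rightarrow> int" where
  "bop_val Add x y = x + y"
| "bop_val Sub x y = x - y"
| "bop_val Mul x y = x * y"
| "bop_val Div x y = x div y"
| "bop_val Mod x y = x mod y"
| "bop_val Less x y = of_bool (x < y)"

text \<open>Operands are register names, except for the literal of \<open>Const\<close>, the first argument of
  \<open>Store\<close> and the second argument of \<open>Load\<close>, the latter two being array names.\<close>

datatype com =
    Skip
  | Const nat int
  | Op bop nat nat nat
  | Load nat nat nat
  | Store nat nat nat
  | Flip nat
  | Seq com com
  | If nat com com
  | While nat com

text \<open>One step takes unit time. A program that has terminated stays in \<open>Skip\<close>.\<close>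

primrec step :: "nat \<Rightarrow> com \<Rightarrow> state \<Rightarrow> (com \<times> state) pmf" where
  "step w Skip s = return_pmf (Skip, s)"
| "step w (Const x i) s = return_pmf (Skip, s\<lparr>reg := (reg s)(x := signed_take_bit w i)\<rparr>)"
| "step w (Op f x y z) s =
     return_pmf (Skip, s\<lparr>reg := (reg s)(x := signed_take_bit w (bop_val f (reg s y) (reg s z)))\<rparr>)"
| "step w (Load x a y) s = return_pmf (Skip, s\<lparr>reg := (reg s)(x := arr s a (reg s y))\<rparr>)"
| "step w (Store a x y) s =
     return_pmf (Skip, s\<lparr>arr := (arr s)(a := (arr s a)(reg s x := reg s y))\<rparr>)"
| "step w (Flip x) s =
     map_pmf (\<lambda>b. (Skip, s\<lparr>reg := (reg s)(x := signed_take_bit w (of_bool b))\<rparr>))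
       (bernoulli_pmf (1 / 2))"
| "step w (Seq c1 c2) s =
     (if c1 = Skip then return_pmf (c2, s)
      else map_pmf (\<lambda>(c1', s'). (Seq c1' c2, s')) (step w c1 s))"
| "step w (If x c1 c2) s = return_pmf (if reg s x \<noteq> 0 then c1 else c2, s)"
| "step w (While x c) s = return_pmf (if reg s x \<noteq> 0 then Seq c (While x c) else Skip, s)"

primrec run :: "nat \<Rightarrow> nat \<Rightarrow> com \<times> state \<Rightarrow> (com \<times> state) pmf" where
  "run w 0 cs = return_pmf cs"
| "run w (Suc t) cs = bind_pmf (step w (fst cs) (snd cs)) (run w t)"

definition halts_within :: "nat \<Rightarrow> nat \<Rightarrow> com \<Rightarrow> state \<Rightarrow> bool" where
  "halts_within w t P s \<longleftrightarrow> (\<forall>cs \<in> set_pmf (run w t (P, s)). fst cs = Skip)"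

text \<open>The output of a terminated run is the content of register 0.\<close>

definition output_prob :: "nat \<Rightarrow> nat \<Rightarrow> com \<Rightarrow> state \<Rightarrow> (int \<Rightarrow> bool) \<Rightarrow> real" where
  "output_prob w t P s Q =
     measure_pmf.prob (run w t (P, s)) {cs. fst cs = Skip \<and> Q (reg (snd cs) 0)}"

subsection \<open>Input format and asymptotic notation\<close>

text \<open>The list contains each edge exactly once, with its endpoints in arbitrary order.\<close>

definition edge_list :: "(nat \<times> nat) list \<Rightarrow> nat set set \<Rightarrow> bool" where
  "edge_list es E \<longleftrightarrow>
     distinct (map (\<lambda>(u, v). {u, v}) es) \<and> set (map (\<lambda>(u, v). {u, v}) es) = E"

text \<open>The numbers \<open>n\<close>, \<open>m\<close>, \<open>R\<close> are in registers 0, 1, 2, the endpoints of the \<open>i\<close>-th edge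
  in cell \<open>i\<close> of the arrays 0 and 1; everything else is zero.\<close>

definition input_state :: "nat \<Rightarrow> (nat \<times> nat) list \<Rightarrow> int \<Rightarrow> state" where
  "input_state n es R =
     \<lparr>reg = (\<lambda>_. 0)(0 := int n, 1 := int (length es), 2 := R),
      arr = (\<lambda>_ _. 0)
        (0 := (\<lambda>i. if 0 \<le> i \<and> i < int (length es) then int (fst (es ! nat i)) else 0),
         1 := (\<lambda>i. if 0 \<le> i \<and> i < int (length es) then int (snd (es ! nat i)) else 0))\<rparr>"

text \<open>\<open>f\<close> is soft-O of \<open>g\<close>. As \<open>m \<le> n\<^sup>2\<close> for simple graphs, polylogarithmic means
  polylogarithmic in \<open>n\<close>.\<close>

definition soft_O :: "(nat \<Rightarrow> nat \<Rightarrow> real) \<Rightarrow> (nat \<Rightarrow> nat \<Rightarrow> real) \<Rightarrow> bool" where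
  "soft_O f g \<longleftrightarrow>
     (\<exists>(C::real) (d::nat). \<forall>n\<ge>1. \<forall>m. f n m \<le> C * g n m * (1 + ln (real n)) ^ d)"

end

theory Submission
  imports Defs
begin

text \<open>
  Let \<open>al = \<lfloor>R / (2k - 1)\<rfloor>\<close> and \<open>\<rho> = R - al\<close>, so that the target radius is \<open>R + \<rho>\<close>. Suppose that the
  centers \<open>c\<^sub>1, \<dots>, c\<^sub>k\<close> cover with radius \<open>R\<close>. A vertex within distance \<open>\<rho>\<close> of \<open>c\<^sub>i\<close> may replace it.
  Call a ball small if it has fewer than \<open>\<surd>n\<close> vertices, and let \<open>S\<close> be a set of \<open>\<surd>n polylog n\<close> vertices
  that meets every ball of radius \<open>\<rho>\<close> or \<open>al\<close> that is not small. If the ball \<open>B(c\<^sub>i, \<rho>)\<close> is not small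
  then \<open>S\<close> contains a replacement of \<open>c\<^sub>i\<close>.

  Suppose that \<open>x\<^sub>1, \<dots>, x\<^sub>j\<close> are within \<open>(2j - 1) al\<close> of \<open>j\<close> of the centers, and that \<open>v\<close> is not covered by them
  and belongs to a center \<open>c\<close> with a small ball \<open>B(c, \<rho>)\<close>. The vertex at distance \<open>2j al\<close> from \<open>c\<close> on a path to
  \<open>v\<close> is farther than \<open>\<rho> + 2j al\<close> from all \<open>x\<^sub>i\<close> and has a small ball of radius \<open>\<rho> - 2j al\<close>. Every vertex \<open>w\<close>
  with these two properties belongs to a new center, and some \<open>x \<in> B(w, \<rho> - 2j al)\<close> is within \<open>(2j + 1) al\<close> of it.
  Hence \<open>\<surd>n polylog n\<close> candidates suffice for each of the first \<open>k - 1\<close> centers.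

  The last center \<open>c\<close> covers the set \<open>U\<close> of the uncovered vertices with radius \<open>R\<close>. If some \<open>v \<in> U\<close> has a small
  ball of radius \<open>al\<close>, this ball contains a replacement of \<open>c\<close>. Otherwise each \<open>v \<in> U\<close> is within \<open>al\<close> of some \<open>s \<in> S\<close>,
  and it is enough to find a vertex within \<open>R + al\<close> of all these \<open>s\<close>, because \<open>3 al \<le> R\<close> if \<open>k \<ge> 2\<close>. This takes
  \<open>n \<bar>S\<bar>\<close> instead of \<open>n\<^sup>2\<close> comparisons. For \<open>k = 1\<close> all vertices are tried. The set \<open>S\<close> is found greedily,
  so the algorithm is deterministic.
\<close>

section \<open>A program logic for the word RAM\<close>

text \<open>The running time dictates the shape. Each of the first \<open>k - 1\<close> levels may
  branch over about sqrt n candidates, and a leaf may cost about n sqrt n, which multiplies to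
  n^(k/2 + 1). Work of order n^2, such as the ball sizes and the leaf for \<open>k = 1\<close>, is
  absorbed by m n, because m \<ge> n - 1.

  The obstacle is that a small ball around an unknown center cannot be listed: there are n possible
  centers, hence too many balls. Candidates have to come from one ball around a vertex that is
  recognizable from the distances alone, and the replacement is then only close to some center. This
  imprecision grows by \<open>2 * al\<close> per level. Replacements from \<open>S\<close> do not
  suffer from it, so the completeness proof carries two alternative invariants.

  Soundness does not rest on these invariants. A success is reported only after the coverage has
  been established at a leaf, so a badly chosen candidate wastes time but never causes a wrong
  answer.\<close>

definition exec :: "nat \<Rightarrow> com \<Rightarrow> state \<Rightarrow> nat \<Rightarrow> state \<Rightarrow> bool" where
  "exec w c s t s' \<longleftrightarrow> run w t (c, s) = return_pmf (Skip, s')"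

lemma run_Skip: "run w t (Skip, s) = return_pmf (Skip, s)"
  by (induction t) (auto simp: bind_return_pmf)

lemma run_add: "run w (t + u) cs = bind_pmf (run w t cs) (run w u)"
proof (induction t arbitrary: cs)
  case 0
  then show ?case by (simp add: bind_return_pmf)
next
  case (Suc t)
  have "run w (Suc t + u) cs = bind_pmf (step w (fst cs) (snd cs)) (\<lambda>x. run w (t + u) x)"
    by simp
  also have "\<dots> = bind_pmf (step w (fst cs) (snd cs)) (\<lambda>x. bind_pmf (run w t x) (run w u))"
    using Suc by simp
  finally show ?case by (simp add: bind_assoc_pmf)
qed

lemma exec_mono: "exec w c s t s' \<Longrightarrow> t \<le> u \<Longrightarrow> exec w c s u s'"
  unfolding exec_def using run_add[of w t "u - t" "(c, s)"]
  by (simp add: bind_return_pmf run_Skip)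

text \<open>The support of a mixture is the union of the supports of its components, so no component
  can leave the point. This lets \<open>exec_Seq\<close> split off a first step without knowing that
  the step itself is deterministic.\<close>

lemma bind_pmf_eq_return:
  assumes "bind_pmf p f = return_pmf x" "y \<in> set_pmf p"
  shows "f y = return_pmf x"
proof -
  have "set_pmf (bind_pmf p f) = {x}" using assms(1) by simp
  hence "set_pmf (f y) \<subseteq> {x}" using assms(2) by auto
  thus ?thesis by (simp add: set_pmf_subset_singleton)
qed

text \<open>The additional step is the transition from \<open>Seq Skip c2\<close> to
  \<open>c2\<close>. If \<open>c1\<close> stops before its budget \<open>t\<close> is used up,
  \<open>exec_mono\<close> passes the rest on to \<open>c2\<close>.\<close>

lemma exec_Seq:
  assumes "exec w c1 s t s1" "exec w c2 s1 u s2"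
  shows "exec w (Seq c1 c2) s (t + u + 1) s2"
  using assms
proof (induction t arbitrary: c1 s)
  case 0
  then show ?case by (simp add: exec_def bind_return_pmf)
next
  case (Suc t)
  show ?case
  proof (cases "c1 = Skip")
    case True
    with Suc.prems have "s1 = s" by (simp add: exec_def run_Skip bind_return_pmf)
    then show ?thesis using True exec_mono[OF Suc.prems(2), of "Suc t + u"]
      by (simp add: exec_def bind_return_pmf)
  next
    case False
    have *: "run w (t + u + 1) (Seq (fst x) c2, snd x) = return_pmf (Skip, s2)"
      if "x \<in> set_pmf (step w c1 s)" for x
    proof -
      have "run w t x = return_pmf (Skip, s1)"
        using Suc.prems(1) that by (auto simp: exec_def dest: bind_pmf_eq_return)
      then show ?thesis using Suc.IH[of "fst x" "snd x"] Suc.prems(2) by (simp add: exec_def)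
    qed
    have "run w (Suc t + u + 1) (Seq c1 c2, s) =
        bind_pmf (step w c1 s) (\<lambda>x. run w (t + u + 1) (Seq (fst x) c2, snd x))"
      using False by (simp add: bind_map_pmf case_prod_beta del: run.simps)
        (simp add: bind_map_pmf case_prod_beta)
    also have "\<dots> = bind_pmf (step w c1 s) (\<lambda>x. return_pmf (Skip, s2))"
      using * by (intro bind_pmf_cong) auto
    finally show ?thesis by (simp add: exec_def)
  qed
qed

lemma exec_If:
  assumes "exec w (if reg s x \<noteq> 0 then c1 else c2) s t s'"
  shows "exec w (If x c1 c2) s (t + 1) s'"
  using assms by (simp add: exec_def bind_return_pmf)

lemma exec_While_False: "reg s x = 0 \<Longrightarrow> exec w (While x c) s 1 s"
  by (simp add: exec_def bind_return_pmf)

text \<open>Of the two additional steps, one unfolds the loop and one discards the finished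
  body.\<close>

lemma exec_While_True:
  assumes "reg s x \<noteq> 0" "exec w c s t s1" "exec w (While x c) s1 u s2"
  shows "exec w (While x c) s (t + u + 2) s2"
  using exec_Seq[OF assms(2,3)] assms(1) by (simp add: exec_def bind_return_pmf)

section \<open>Word range, expressions and their evaluation on a register stack\<close>

definition in_range :: "nat \<Rightarrow> int \<Rightarrow> bool" where
  "in_range w v \<longleftrightarrow> - (2 ^ w) \<le> v \<and> v < 2 ^ w"

lemma in_range_signed_take_bit: "in_range w v \<Longrightarrow> signed_take_bit w v = v"
  by (simp add: in_range_def signed_take_bit_int_eq_self)

definition setr :: "nat \<Rightarrow> int \<Rightarrow> state \<Rightarrow> state" where
  "setr x v s = s\<lparr>reg := (reg s)(x := v)\<rparr>"

definition seta :: "nat \<Rightarrow> int \<Rightarrow> int \<Rightarrow> state \<Rightarrow> state" where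
  "seta a i v s = s\<lparr>arr := (arr s)(a := (arr s a)(i := v))\<rparr>"

lemma setr_simps [simp]:
  "reg (setr x v s) = (reg s)(x := v)" "arr (setr x v s) = arr s"
  "reg (seta a i v s) = reg s" "arr (seta a i v s) = (arr s)(a := (arr s a)(i := v))"
  by (auto simp: setr_def seta_def)

datatype exp = Lit int | Var nat | Get nat exp | Bin bop exp exp

primrec ev :: "state \<Rightarrow> exp \<Rightarrow> int" where
  "ev s (Lit i) = i"
| "ev s (Var x) = reg s x"
| "ev s (Get a e) = arr s a (ev s e)"
| "ev s (Bin f e1 e2) = bop_val f (ev s e1) (ev s e2)"

primrec safe :: "nat \<Rightarrow> state \<Rightarrow> exp \<Rightarrow> bool" where
  "safe w s (Lit i) = in_range w i"
| "safe w s (Var x) = in_range w (reg s x)"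
| "safe w s (Get a e) = (safe w s e \<and> in_range w (arr s a (ev s e)))"
| "safe w s (Bin f e1 e2) = (safe w s e1 \<and> safe w s e2 \<and> in_range w (bop_val f (ev s e1) (ev s e2)))"

lemma safe_in_range: "safe w s e \<Longrightarrow> in_range w (ev s e)"
  by (cases e) auto

primrec vars_below :: "nat \<Rightarrow> exp \<Rightarrow> bool" where
  "vars_below d (Lit i) = True"
| "vars_below d (Var x) = (x < d)"
| "vars_below d (Get a e) = vars_below d e"
| "vars_below d (Bin f e1 e2) = (vars_below d e1 \<and> vars_below d e2)"

text \<open>Register \<open>d\<close> is the top of an evaluation stack: a value is left in
  \<open>d\<close>, and the second operand is evaluated from \<open>Suc d\<close> on so that the
  first one survives. A register is copied by adding 0.\<close>

primrec comp_exp :: "exp \<Rightarrow> nat \<Rightarrow> com" where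
  "comp_exp (Lit i) d = Const d i"
| "comp_exp (Var x) d = Seq (Const (Suc d) 0) (Op Add d x (Suc d))"
| "comp_exp (Get a e) d = Seq (comp_exp e d) (Load d a d)"
| "comp_exp (Bin f e1 e2) d = Seq (comp_exp e1 d) (Seq (comp_exp e2 (Suc d)) (Op f d d (Suc d)))"

primrec exp_time :: "exp \<Rightarrow> nat" where
  "exp_time (Lit i) = 1"
| "exp_time (Var x) = 3"
| "exp_time (Get a e) = exp_time e + 2"
| "exp_time (Bin f e1 e2) = exp_time e1 + exp_time e2 + 3"

definition sim :: "nat \<Rightarrow> state \<Rightarrow> state \<Rightarrow> bool" where
  "sim d s s' \<longleftrightarrow> (\<forall>x<d. reg s x = reg s' x) \<and> arr s = arr s'"

lemma sim_refl: "sim d s s" by (simp add: sim_def)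

lemma sim_trans: "sim d s s' \<Longrightarrow> sim d s' s'' \<Longrightarrow> sim d s s''" by (simp add: sim_def)

lemma sim_ev: "sim d s s' \<Longrightarrow> vars_below d e \<Longrightarrow> ev s e = ev s' e"
  by (induction e) (auto simp: sim_def)

lemma sim_safe: "sim d s s' \<Longrightarrow> vars_below d e \<Longrightarrow> safe w s e = safe w s' e"
  by (induction e) (auto simp: sim_def sim_ev[unfolded sim_def])

lemma vars_below_mono: "vars_below d e \<Longrightarrow> d \<le> d' \<Longrightarrow> vars_below d' e"
  by (induction e) auto

lemma exec_Const: "in_range w i \<Longrightarrow> exec w (Const x i) s 1 (setr x i s)"
  by (simp add: exec_def bind_return_pmf in_range_signed_take_bit setr_def)

lemma exec_Op: "in_range w (bop_val f (reg s y) (reg s z)) \<Longrightarrow>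
    exec w (Op f x y z) s 1 (setr x (bop_val f (reg s y) (reg s z)) s)"
  by (simp add: exec_def bind_return_pmf in_range_signed_take_bit setr_def)

lemma exec_Load: "exec w (Load x a y) s 1 (setr x (arr s a (reg s y)) s)"
  by (simp add: exec_def bind_return_pmf setr_def)

lemma exec_Store: "exec w (Store a x y) s 1 (seta a (reg s x) (reg s y) s)"
  by (simp add: exec_def bind_return_pmf seta_def)

lemma in_range_0: "in_range w 0" by (simp add: in_range_def)

text \<open>In the \<open>Bin\<close> case the code for the second operand respects all registers
  below \<open>Suc d\<close>. These include \<open>d\<close>, which holds the first value, and all
  variables of the expression.\<close>

lemma exec_comp_exp:
  assumes "vars_below d e" "safe w s e"
  shows "\<exists>s'. exec w (comp_exp e d) s (exp_time e) s' \<and> sim d s s' \<and> reg s' d = ev s e"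
  using assms
proof (induction e arbitrary: d s)
  case (Lit i)
  then show ?case by (intro exI[of _ "setr d i s"]) (auto simp: sim_def intro!: exec_Const[simplified])
next
  case (Var x)
  have 1: "exec w (Const (Suc d) 0) s 1 (setr (Suc d) 0 s)" by (intro exec_Const in_range_0)
  have "exec w (Op Add d x (Suc d)) (setr (Suc d) 0 s) 1
     (setr d (bop_val Add (reg (setr (Suc d) 0 s) x) (reg (setr (Suc d) 0 s) (Suc d))) (setr (Suc d) 0 s))"
    using Var by (intro exec_Op) auto
  from exec_Seq[OF 1 this] Var show ?case
    by (intro exI, intro conjI, simp add: numeral_3_eq_3) (auto simp: sim_def)
next
  case (Get a e)
  then obtain s' where s': "exec w (comp_exp e d) s (exp_time e) s'" "sim d s s'" "reg s' d = ev s e"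
    by auto
  from exec_Seq[OF s'(1) exec_Load] s' show ?case
    by (intro exI, intro conjI, simp) (auto simp: sim_def)
next
  case (Bin f e1 e2)
  from Bin.prems Bin.IH(1)[of d s] obtain s1 where
    s1: "exec w (comp_exp e1 d) s (exp_time e1) s1" "sim d s s1" "reg s1 d = ev s e1"
    by auto
  have "safe w s1 e2" "ev s1 e2 = ev s e2" "vars_below (Suc d) e2"
    using Bin.prems s1(2) sim_safe sim_ev vars_below_mono[of d e2 "Suc d"] by auto
  with Bin.IH(2)[of "Suc d" s1] obtain s2 where
    s2: "exec w (comp_exp e2 (Suc d)) s1 (exp_time e2) s2" "sim (Suc d) s1 s2" "reg s2 (Suc d) = ev s e2"
    by auto
  have "reg s2 d = ev s e1" using s1 s2 by (simp add: sim_def)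
  then have "exec w (Op f d d (Suc d)) s2 1 (setr d (ev s (Bin f e1 e2)) s2)"
    using Bin.prems s2 exec_Op[of w f s2 d "Suc d" d] by simp
  from exec_Seq[OF s1(1) exec_Seq[OF s2(1) this]]
  have "exec w (comp_exp (Bin f e1 e2) d) s (exp_time e1 + (exp_time e2 + 1 + 1) + 1)
      (setr d (ev s (Bin f e1 e2)) s2)"
    by simp
  then show ?case using s1 s2 by (intro exI, intro conjI, simp add: numeral_3_eq_3) (auto simp: sim_def)
qed

section \<open>Structured commands and their simulation by machine code\<close>

datatype cmd = NOP | Asg nat exp | Wr nat exp exp | Sq cmd cmd | IfC exp cmd cmd | Wh exp cmd

text \<open>The \<open>safe\<close> premises block every expression with an intermediate value
  outside the word range, so arithmetic can be read over the integers and wrap-around does not have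
  to be modelled. A tick is charged per basic command and per test, whatever the size of the
  expressions; that size enters through \<open>overhead\<close>.\<close>

inductive big :: "nat \<Rightarrow> cmd \<Rightarrow> state \<Rightarrow> nat \<Rightarrow> state \<Rightarrow> bool" for w where
  big_NOP: "big w NOP s 1 s"
| big_Asg: "safe w s e \<Longrightarrow> big w (Asg x e) s 1 (setr x (ev s e) s)"
| big_Wr: "safe w s e \<Longrightarrow> safe w s e' \<Longrightarrow> big w (Wr a e e') s 1 (seta a (ev s e) (ev s e') s)"
| big_Sq: "big w c1 s t s1 \<Longrightarrow> big w c2 s1 u s2 \<Longrightarrow> big w (Sq c1 c2) s (t + u) s2"
| big_If: "safe w s e \<Longrightarrow> big w (if ev s e \<noteq> 0 then c1 else c2) s t s' \<Longrightarrow>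
    big w (IfC e c1 c2) s (Suc t) s'"
| big_WhF: "safe w s e \<Longrightarrow> ev s e = 0 \<Longrightarrow> big w (Wh e c) s 1 s"
| big_WhT: "safe w s e \<Longrightarrow> ev s e \<noteq> 0 \<Longrightarrow> big w c s t s1 \<Longrightarrow> big w (Wh e c) s1 u s2 \<Longrightarrow>
    big w (Wh e c) s (Suc (t + u)) s2"

inductive_cases big_NOP_E: "big w NOP s t s'"
inductive_cases big_Asg_E: "big w (Asg x e) s t s'"
inductive_cases big_Wr_E: "big w (Wr a e e') s t s'"
inductive_cases big_Sq_E: "big w (Sq c1 c2) s t s'"
inductive_cases big_If_E: "big w (IfC e c1 c2) s t s'"

text \<open>The registers from \<open>d\<close> on are scratch space for the evaluation of expressions. A tick of the
  big-step semantics takes at most \<open>overhead c\<close> machine steps.\<close>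

primrec compile :: "nat \<Rightarrow> cmd \<Rightarrow> com" where
  "compile d NOP = Skip"
| "compile d (Asg x e) = Seq (comp_exp e d) (Seq (Const (Suc d) 0) (Op Add x d (Suc d)))"
| "compile d (Wr a e e') = Seq (comp_exp e d) (Seq (comp_exp e' (Suc d)) (Store a d (Suc d)))"
| "compile d (Sq c1 c2) = Seq (compile d c1) (compile d c2)"
| "compile d (IfC e c1 c2) = Seq (comp_exp e d) (If d (compile d c1) (compile d c2))"
| "compile d (Wh e c) = Seq (comp_exp e d) (While d (Seq (compile d c) (comp_exp e d)))"

primrec regs_below :: "nat \<Rightarrow> cmd \<Rightarrow> bool" where
  "regs_below d NOP = True"
| "regs_below d (Asg x e) = (x < d \<and> vars_below d e)"
| "regs_below d (Wr a e e') = (vars_below d e \<and> vars_below d e')"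
| "regs_below d (Sq c1 c2) = (regs_below d c1 \<and> regs_below d c2)"
| "regs_below d (IfC e c1 c2) = (vars_below d e \<and> regs_below d c1 \<and> regs_below d c2)"
| "regs_below d (Wh e c) = (vars_below d e \<and> regs_below d c)"

primrec overhead :: "cmd \<Rightarrow> nat" where
  "overhead NOP = 1"
| "overhead (Asg x e) = exp_time e + 5"
| "overhead (Wr a e e') = exp_time e + exp_time e' + 5"
| "overhead (Sq c1 c2) = overhead c1 + overhead c2"
| "overhead (IfC e c1 c2) = exp_time e + 5 + overhead c1 + overhead c2"
| "overhead (Wh e c) = exp_time e + 5 + overhead c"

lemma exec_comp_exp_sim:
  assumes "vars_below d e" "safe w s e" "sim d s \<sigma>"
  obtains \<tau> where "exec w (comp_exp e d) \<sigma> (exp_time e) \<tau>" "sim d s \<tau>" "reg \<tau> d = ev s e"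
proof -
  have "safe w \<sigma> e" using sim_safe[OF assms(3,1)] assms(2) by simp
  from exec_comp_exp[OF assms(1) this] show ?thesis
    using that sim_trans[OF assms(3)] sim_ev[OF assms(3,1)] by auto
qed

text \<open>The machine loop tests a register in which the guard has been evaluated beforehand, so
  the induction needs the second conjunct, about a loop entered with the guard already in
  \<open>d\<close>. The slack in \<open>n + 1\<close> pays for sequencing, and the slack
  \<open>2 + exp_time e\<close> for the first evaluation of the guard. A single \<open>M\<close>
  serves all subcommands.\<close>

lemma compile_simulation:
  assumes "big w c s t s'" "regs_below d c" "overhead c \<le> M" "sim d s \<sigma>"
  shows "(\<exists>\<sigma>' n. exec w (compile d c) \<sigma> n \<sigma>' \<and> n + 1 \<le> M * t \<and> sim d s' \<sigma>') \<and>
    (\<forall>e b. c = Wh e b \<longrightarrow> reg \<sigma> d = ev s e \<longrightarrow>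
      (\<exists>\<sigma>' n. exec w (While d (Seq (compile d b) (comp_exp e d))) \<sigma> n \<sigma>' \<and>
        n + 2 + exp_time e \<le> M * t \<and> sim d s' \<sigma>'))"
  using assms
proof (induction arbitrary: \<sigma> rule: big.induct)
  case (big_NOP s)
  have "exec w Skip \<sigma> 0 \<sigma>" by (simp add: exec_def)
  then show ?case using big_NOP by auto
next
  case (big_Asg s e x)
  obtain \<tau> where t: "exec w (comp_exp e d) \<sigma> (exp_time e) \<tau>" "sim d s \<tau>" "reg \<tau> d = ev s e"
    using exec_comp_exp_sim[of d e w s \<sigma>] big_Asg by auto
  have i: "in_range w (ev s e)" using big_Asg safe_in_range by blast
  have 1: "exec w (Const (Suc d) 0) \<tau> 1 (setr (Suc d) 0 \<tau>)" by (intro exec_Const in_range_0)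
  have "exec w (Op Add x d (Suc d)) (setr (Suc d) 0 \<tau>) 1
     (setr x (bop_val Add (reg (setr (Suc d) 0 \<tau>) d) (reg (setr (Suc d) 0 \<tau>) (Suc d))) (setr (Suc d) 0 \<tau>))"
    using t i by (intro exec_Op) auto
  from exec_Seq[OF t(1) exec_Seq[OF 1 this]]
  have "exec w (compile d (Asg x e)) \<sigma> (exp_time e + 4) (setr x (ev s e) (setr (Suc d) 0 \<tau>))"
    using t by (simp add: eval_nat_numeral)
  moreover have "sim d (setr x (ev s e) s) (setr x (ev s e) (setr (Suc d) 0 \<tau>))"
    using big_Asg.prems t by (auto simp: sim_def)
  ultimately show ?case using big_Asg.prems
    by (intro conjI exI[of _ "exp_time e + 4"] exI) auto
next
  case (big_Wr s e e' a)
  obtain \<tau> where t: "exec w (comp_exp e d) \<sigma> (exp_time e) \<tau>" and st: "sim d s \<tau>" and r: "reg \<tau> d = ev s e"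
    using exec_comp_exp_sim[of d e w s \<sigma>] big_Wr by auto
  have e': "safe w \<tau> e'" "ev \<tau> e' = ev s e'" "vars_below (Suc d) e'"
    using big_Wr sim_safe[OF st] sim_ev[OF st] vars_below_mono[of d e' "Suc d"] by auto
  with exec_comp_exp[of "Suc d" e' w \<tau>] obtain \<rho> where
    r': "exec w (comp_exp e' (Suc d)) \<tau> (exp_time e') \<rho>" "sim (Suc d) \<tau> \<rho>" "reg \<rho> (Suc d) = ev s e'" by auto
  have "reg \<rho> d = ev s e" using r r' by (simp add: sim_def)
  with exec_Seq[OF t exec_Seq[OF r'(1) exec_Store[of w a d "Suc d" \<rho>]]] r'
  have "exec w (compile d (Wr a e e')) \<sigma> (exp_time e + (exp_time e' + 1 + 1) + 1) (seta a (ev s e) (ev s e') \<rho>)"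
    by simp
  moreover have "sim d (seta a (ev s e) (ev s e') s) (seta a (ev s e) (ev s e') \<rho>)"
    using st r' by (auto simp: sim_def)
  ultimately show ?case using big_Wr.prems
    by (intro conjI exI[of _ "exp_time e + (exp_time e' + 1 + 1) + 1"] exI) auto
next
  case (big_Sq c1 s t s1 c2 u s2)
  then obtain \<sigma>1 n1 where 1: "exec w (compile d c1) \<sigma> n1 \<sigma>1" "n1 + 1 \<le> M * t" "sim d s1 \<sigma>1"
    by fastforce
  with big_Sq obtain \<sigma>2 n2 where 2: "exec w (compile d c2) \<sigma>1 n2 \<sigma>2" "n2 + 1 \<le> M * u" "sim d s2 \<sigma>2"
    by fastforce
  have "exec w (compile d (Sq c1 c2)) \<sigma> (n1 + n2 + 1) \<sigma>2"
    using exec_Seq[OF 1(1) 2(1)] by simp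
  moreover have "n1 + n2 + 1 + 1 \<le> M * (t + u)" using 1 2 by (simp add: algebra_simps)
  ultimately show ?case using 2 by blast
next
  case (big_If s e c1 c2 t s')
  obtain \<tau> where t: "exec w (comp_exp e d) \<sigma> (exp_time e) \<tau>" and st: "sim d s \<tau>" and r: "reg \<tau> d = ev s e"
    using exec_comp_exp_sim[of d e w s \<sigma>] big_If by auto
  let ?c = "if ev s e \<noteq> 0 then c1 else c2"
  have "regs_below d ?c" "overhead ?c \<le> M" using big_If.prems by auto
  with big_If.IH[OF this st] obtain \<sigma>1 n1 where
    1: "exec w (compile d ?c) \<tau> n1 \<sigma>1" "n1 + 1 \<le> M * t" "sim d s' \<sigma>1" by blast
  have "exec w (If d (compile d c1) (compile d c2)) \<tau> (n1 + 1) \<sigma>1"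
    using 1 r by (intro exec_If) (auto split: if_splits)
  from exec_Seq[OF t this]
  have "exec w (compile d (IfC e c1 c2)) \<sigma> (exp_time e + (n1 + 1) + 1) \<sigma>1" by simp
  moreover have "exp_time e + (n1 + 1) + 1 + 1 \<le> M * Suc t" using 1 big_If.prems by auto
  ultimately show ?case using 1 by blast
next
  case (big_WhF s e c)
  obtain \<tau> where t: "exec w (comp_exp e d) \<sigma> (exp_time e) \<tau>" and st: "sim d s \<tau>" and r: "reg \<tau> d = ev s e"
    using exec_comp_exp_sim[of d e w s \<sigma>] big_WhF by auto
  have "exec w (compile d (Wh e c)) \<sigma> (exp_time e + 1 + 1) \<tau>"
    using exec_Seq[OF t exec_While_False] r big_WhF by simp
  moreover have "exp_time e + 1 + 1 + 1 \<le> M * 1" "1 + 2 + exp_time e \<le> M * 1"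
    using big_WhF.prems by auto
  ultimately show ?case using st exec_While_False[of \<sigma> d w "Seq (compile d c) (comp_exp e d)"] big_WhF
    by (intro conjI) (blast, metis cmd.inject(5))
next
  case (big_WhT s e c t s1 u s2)
  have W: "\<exists>\<sigma>' n. exec w (While d (Seq (compile d c) (comp_exp e d))) \<tau> n \<sigma>' \<and>
        n + 2 + exp_time e \<le> M * Suc (t + u) \<and> sim d s2 \<sigma>'" if st: "sim d s \<tau>" and r: "reg \<tau> d = ev s e" for \<tau>
  proof -
    have "regs_below d c" "overhead c \<le> M" using big_WhT.prems by auto
    with big_WhT.IH(1)[OF this st] obtain \<sigma>1 n1 where
      1: "exec w (compile d c) \<tau> n1 \<sigma>1" "n1 + 1 \<le> M * t" "sim d s1 \<sigma>1" by blast
    have "safe w s1 e" using big_WhT.hyps(4) by (cases rule: big.cases) auto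
    hence e: "safe w \<sigma>1 e" "ev \<sigma>1 e = ev s1 e" "vars_below d e"
      using big_WhT.prems sim_safe[OF 1(3)] sim_ev[OF 1(3)] by auto
    with exec_comp_exp[of d e w \<sigma>1] obtain \<rho> where
      r2: "exec w (comp_exp e d) \<sigma>1 (exp_time e) \<rho>" "sim d \<sigma>1 \<rho>" "reg \<rho> d = ev s1 e" by auto
    have "sim d s1 \<rho>" using 1 r2 sim_trans by blast
    with big_WhT.IH(2)[OF big_WhT.prems(1,2) this] r2 obtain \<sigma>2 n2 where
      2: "exec w (While d (Seq (compile d c) (comp_exp e d))) \<rho> n2 \<sigma>2"
         "n2 + 2 + exp_time e \<le> M * u" "sim d s2 \<sigma>2" by blast
    have "exec w (While d (Seq (compile d c) (comp_exp e d))) \<tau> (n1 + exp_time e + 1 + n2 + 2) \<sigma>2"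
      using exec_While_True[OF _ exec_Seq[OF 1(1) r2(1)] 2(1)] r big_WhT.hyps by simp
    moreover have "n1 + exp_time e + 1 + n2 + 2 + 2 + exp_time e \<le> M * Suc (t + u)"
      using 1 2 big_WhT.prems by (simp add: algebra_simps)
    ultimately show ?thesis using 2 by blast
  qed
  obtain \<tau> where t: "exec w (comp_exp e d) \<sigma> (exp_time e) \<tau>" and st: "sim d s \<tau>" and r: "reg \<tau> d = ev s e"
    using exec_comp_exp_sim[of d e w s \<sigma>] big_WhT by auto
  from W[OF st r] obtain \<sigma>' n where
    n: "exec w (While d (Seq (compile d c) (comp_exp e d))) \<tau> n \<sigma>'"
      "n + 2 + exp_time e \<le> M * Suc (t + u)" "sim d s2 \<sigma>'" by blast
  have "exec w (compile d (Wh e c)) \<sigma> (exp_time e + n + 1) \<sigma>'"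
    using exec_Seq[OF t n(1)] by simp
  moreover have "exp_time e + n + 1 + 1 \<le> M * Suc (t + u)" using n by simp
  ultimately show ?case using n W big_WhT.prems by (intro conjI) (blast, blast)
qed

lemma compile_correct:
  assumes "big w c s t s'" "regs_below d c"
  shows "\<exists>\<sigma>'. exec w (compile d c) s (overhead c * t) \<sigma>' \<and> sim d s' \<sigma>'"
  using compile_simulation[OF assms order_refl sim_refl] exec_mono
  by (meson add_leD1)

section \<open>Weakest preconditions with tick counts\<close>

text \<open>The first argument of the postcondition is the number of ticks.\<close>

definition wp :: "nat \<Rightarrow> cmd \<Rightarrow> (nat \<Rightarrow> state \<Rightarrow> bool) \<Rightarrow> state \<Rightarrow> bool" where
  "wp w c Q s \<longleftrightarrow> (\<exists>t s'. big w c s t s' \<and> Q t s')"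

lemma wp_simps [simp]:
  "wp w NOP Q s \<longleftrightarrow> Q 1 s"
  "wp w (Asg x e) Q s \<longleftrightarrow> safe w s e \<and> Q 1 (setr x (ev s e) s)"
  "wp w (Wr a e e') Q s \<longleftrightarrow> safe w s e \<and> safe w s e' \<and> Q 1 (seta a (ev s e) (ev s e') s)"
  "wp w (Sq c1 c2) Q s \<longleftrightarrow> wp w c1 (\<lambda>t s1. wp w c2 (\<lambda>u s2. Q (t + u) s2) s1) s"
  "wp w (IfC e c1 c2) Q s \<longleftrightarrow> safe w s e \<and>
     (ev s e \<noteq> 0 \<longrightarrow> wp w c1 (\<lambda>t. Q (Suc t)) s) \<and> (ev s e = 0 \<longrightarrow> wp w c2 (\<lambda>t. Q (Suc t)) s)"
  unfolding wp_def
  subgoal by (metis big_NOP big_NOP_E)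
  subgoal by (metis big_Asg big_Asg_E)
  subgoal by (metis big_Wr big_Wr_E)
  subgoal by (blast elim: big_Sq_E intro: big_Sq)
  subgoal by (cases "ev s e = 0") (fastforce elim!: big_If_E intro: big_If)+
  done

primrec mod_regs :: "cmd \<Rightarrow> nat set" where
  "mod_regs NOP = {}"
| "mod_regs (Asg x e) = {x}"
| "mod_regs (Wr a e e') = {}"
| "mod_regs (Sq c1 c2) = mod_regs c1 \<union> mod_regs c2"
| "mod_regs (IfC e c1 c2) = mod_regs c1 \<union> mod_regs c2"
| "mod_regs (Wh e c) = mod_regs c"

primrec mod_arrs :: "cmd \<Rightarrow> nat set" where
  "mod_arrs NOP = {}"
| "mod_arrs (Asg x e) = {}"
| "mod_arrs (Wr a e e') = {a}"
| "mod_arrs (Sq c1 c2) = mod_arrs c1 \<union> mod_arrs c2"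
| "mod_arrs (IfC e c1 c2) = mod_arrs c1 \<union> mod_arrs c2"
| "mod_arrs (Wh e c) = mod_arrs c"

definition agree :: "nat set \<Rightarrow> nat set \<Rightarrow> state \<Rightarrow> state \<Rightarrow> bool" where
  "agree X A s s' \<longleftrightarrow> (\<forall>x. x \<notin> X \<longrightarrow> reg s' x = reg s x) \<and> (\<forall>a. a \<notin> A \<longrightarrow> arr s' a = arr s a)"

lemma agree_reg: "agree X A s s' \<Longrightarrow> x \<notin> X \<Longrightarrow> reg s' x = reg s x"
  and agree_arr: "agree X A s s' \<Longrightarrow> a \<notin> A \<Longrightarrow> arr s' a = arr s a"
  by (auto simp: agree_def)

lemma big_agree: "big w c s t s' \<Longrightarrow> agree (mod_regs c) (mod_arrs c) s s'"
  by (induction rule: big.induct) (auto simp: agree_def split: if_splits)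

lemma wp_conseq:
  assumes "wp w c Q s" "\<And>t s'. Q t s' \<Longrightarrow> agree (mod_regs c) (mod_arrs c) s s' \<Longrightarrow> Q' t s'"
  shows "wp w c Q' s"
  using assms big_agree unfolding wp_def by blast

text \<open>The potential \<open>\<Phi>\<close> bounds the remaining ticks, so one decreasing
  quantity proves both termination and running time, also when iterations differ in cost. The
  \<open>agree\<close> premises provide the frame: what the body does not modify still has its value
  from the entry of the loop.\<close>

lemma wp_Wh:
  fixes \<Phi> :: "state \<Rightarrow> nat"
  assumes "I s"
    and "\<And>\<sigma>. I \<sigma> \<Longrightarrow> agree (mod_regs c) (mod_arrs c) s \<sigma> \<Longrightarrow> safe w \<sigma> e"
    and "\<And>\<sigma>. I \<sigma> \<Longrightarrow> agree (mod_regs c) (mod_arrs c) s \<sigma> \<Longrightarrow> ev \<sigma> e \<noteq> 0 \<Longrightarrow>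
      wp w c (\<lambda>t \<sigma>'. I \<sigma>' \<and> t + 1 + \<Phi> \<sigma>' \<le> \<Phi> \<sigma>) \<sigma>"
    and "\<And>t \<sigma>. I \<sigma> \<Longrightarrow> agree (mod_regs c) (mod_arrs c) s \<sigma> \<Longrightarrow> ev \<sigma> e = 0 \<Longrightarrow> t + \<Phi> \<sigma> \<le> \<Phi> s + 1 \<Longrightarrow> Q t \<sigma>"
  shows "wp w (Wh e c) Q s"
proof -
  have "\<exists>t \<sigma>'. big w (Wh e c) \<sigma> t \<sigma>' \<and> I \<sigma>' \<and> agree (mod_regs c) (mod_arrs c) s \<sigma>' \<and> ev \<sigma>' e = 0 \<and> t + \<Phi> \<sigma>' \<le> \<Phi> \<sigma> + 1"
    if "I \<sigma>" "agree (mod_regs c) (mod_arrs c) s \<sigma>" for \<sigma>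
    using that
  proof (induction "\<Phi> \<sigma>" arbitrary: \<sigma> rule: less_induct)
    case less
    show ?case
    proof (cases "ev \<sigma> e = 0")
      case True
      then show ?thesis using big_WhF[OF assms(2)] less.prems by force
    next
      case False
      from assms(3)[OF less.prems this] obtain t \<sigma>1 where
        1: "big w c \<sigma> t \<sigma>1" "I \<sigma>1" "t + 1 + \<Phi> \<sigma>1 \<le> \<Phi> \<sigma>" unfolding wp_def by blast
      have f: "agree (mod_regs c) (mod_arrs c) s \<sigma>1" using big_agree[OF 1(1)] less.prems(2) by (auto simp: agree_def)
      from less.hyps[OF _ 1(2) f] 1(3) obtain u \<sigma>2 where
        2: "big w (Wh e c) \<sigma>1 u \<sigma>2" "I \<sigma>2" "agree (mod_regs c) (mod_arrs c) s \<sigma>2" "ev \<sigma>2 e = 0" "u + \<Phi> \<sigma>2 \<le> \<Phi> \<sigma>1 + 1"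
        by auto
      from big_WhT[OF assms(2)[OF less.prems] False 1(1) 2(1)] 2 1(3) show ?thesis
        by (intro exI[of _ "Suc (t + u)"] exI[of _ \<sigma>2]) auto
    qed
  qed
  from this[OF assms(1)] assms(4) show ?thesis unfolding wp_def by (metis agree_def)
qed

section \<open>Counting loops\<close>

definition For :: "nat \<Rightarrow> nat \<Rightarrow> cmd \<Rightarrow> cmd" where
  "For x y c = Sq (Asg x (Lit 0))
     (Wh (Bin Less (Var x) (Var y)) (Sq c (Asg x (Bin Add (Var x) (Lit 1)))))"

lemma For_simps [simp]:
  "mod_regs (For x y c) = insert x (mod_regs c)" "mod_arrs (For x y c) = mod_arrs c"
  "regs_below d (For x y c) \<longleftrightarrow> x < d \<and> y < d \<and> regs_below d c"
  by (auto simp: For_def)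

text \<open>The cost \<open>\<tau> i\<close> depends on the index because in the search only the
  candidate vertices are expensive. An iteration adds one tick for the test and one for the
  increment, and the constant 2 pays for the initialization and the last test. The
  \<open>setr\<close> in the premise \<open>step\<close> anticipates the increment.\<close>

lemma wp_For:
  assumes "x \<notin> mod_regs c" "y \<notin> mod_regs c" "x \<noteq> y" "reg s y = int m" "int m < 2 ^ w" "w > 0"
    and init: "I 0 (setr x 0 s)"
    and step: "\<And>i \<sigma>. i < m \<Longrightarrow> reg \<sigma> x = int i \<Longrightarrow> reg \<sigma> y = int m \<Longrightarrow> I i \<sigma> \<Longrightarrow>
      agree (insert x (mod_regs c)) (mod_arrs c) s \<sigma> \<Longrightarrow>
      wp w c (\<lambda>t \<sigma>'. t \<le> \<tau> i \<and> I (Suc i) (setr x (int (Suc i)) \<sigma>')) \<sigma>"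
    and fin: "\<And>t \<sigma>. I m \<sigma> \<Longrightarrow> reg \<sigma> x = int m \<Longrightarrow> agree (insert x (mod_regs c)) (mod_arrs c) s \<sigma> \<Longrightarrow>
      t \<le> 2 + (\<Sum>i<m. \<tau> i + 2) \<Longrightarrow> Q t \<sigma>"
  shows "wp w (For x y c) Q s"
proof -
  let ?s = "setr x 0 s" and ?b = "Sq c (Asg x (Bin Add (Var x) (Lit 1)))"
  let ?J = "\<lambda>\<sigma>. \<exists>i\<le>m. reg \<sigma> x = int i \<and> reg \<sigma> y = int m \<and> I i \<sigma>"
  let ?P = "\<lambda>\<sigma>. \<Sum>i=nat (reg \<sigma> x)..<m. \<tau> i + 2"
  have p2: "(2::int) ^ w \<ge> 2" using \<open>w > 0\<close> by (cases w) auto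
  have fr: "agree (insert x (mod_regs c)) (mod_arrs c) s \<sigma>"
    if "agree (mod_regs ?b) (mod_arrs ?b) ?s \<sigma>" for \<sigma>
    using that by (auto simp: agree_def)
  have "wp w (Wh (Bin Less (Var x) (Var y)) ?b) (\<lambda>t. Q (1 + t)) ?s"
  proof (rule wp_Wh[where I = ?J and \<Phi> = ?P])
    show "?J ?s" using assms by (intro exI[of _ 0]) auto
  next
    fix \<sigma> assume "?J \<sigma>"
    then show "safe w \<sigma> (Bin Less (Var x) (Var y))" using assms(5) p2 by (auto simp: in_range_def)
  next
    fix \<sigma> assume J: "?J \<sigma>" and e: "ev \<sigma> (Bin Less (Var x) (Var y)) \<noteq> 0"
      and f: "agree (mod_regs ?b) (mod_arrs ?b) ?s \<sigma>"
    then obtain i where i: "i < m" "reg \<sigma> x = int i" "reg \<sigma> y = int m" "I i \<sigma>" by auto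
    show "wp w ?b (\<lambda>t \<sigma>'. ?J \<sigma>' \<and> t + 1 + ?P \<sigma>' \<le> ?P \<sigma>) \<sigma>"
      unfolding wp_simps
    proof (rule wp_conseq[OF step[OF i fr[OF f]]])
      fix t \<sigma>' assume A: "t \<le> \<tau> i \<and> I (Suc i) (setr x (int (Suc i)) \<sigma>')" and g: "agree (mod_regs c) (mod_arrs c) \<sigma> \<sigma>'"
      have r: "reg \<sigma>' x = int i" "reg \<sigma>' y = int m"
        using g i assms(1,2) by (auto simp: agree_def)
      have "int i + 1 < 2 ^ w" "int i < 2 ^ w" using i assms(5) by linarith+
      moreover have "(\<Sum>i=i..<m. \<tau> i + 2) = \<tau> i + 2 + (\<Sum>i=Suc i..<m. \<tau> i + 2)"
        using i by (simp add: sum.atLeast_Suc_lessThan)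
      moreover have "nat (int i + 1) = Suc i" by simp
      ultimately show "safe w \<sigma>' (Bin Add (Var x) (Lit 1)) \<and>
        (?J (setr x (ev \<sigma>' (Bin Add (Var x) (Lit 1))) \<sigma>') \<and>
         t + 1 + 1 + ?P (setr x (ev \<sigma>' (Bin Add (Var x) (Lit 1))) \<sigma>') \<le> ?P \<sigma>)"
        using A r i p2 assms(3) by (auto simp del: of_nat_less_numeral_power_cancel_iff simp: in_range_def add.commute intro!: exI[of _ "Suc i"])
    qed
  next
    fix t \<sigma> assume J: "?J \<sigma>" and e: "ev \<sigma> (Bin Less (Var x) (Var y)) = 0"
      and f: "agree (mod_regs ?b) (mod_arrs ?b) ?s \<sigma>"
      and t: "t + ?P \<sigma> \<le> ?P ?s + 1"
    then have i: "reg \<sigma> x = int m" "I m \<sigma>" by auto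
    have "1 + t \<le> 2 + (\<Sum>i<m. \<tau> i + 2)" using t i by (simp add: lessThan_atLeast0)
    with fin[OF i(2,1) fr[OF f]] show "Q (1 + t) \<sigma>" by blast
  qed
  then show ?thesis using p2 by (simp add: For_def in_range_def)
qed

section \<open>Combinatorics of the search\<close>

text \<open>\<open>split\<close> is the interpolation property of graph distances: a path can be cut
  at any place, which yields all replacements of centers. Its bound \<open>2 * n\<close> separates
  genuine distances from the large value that will stand for infinity.\<close>

locale finite_dist =
  fixes n :: nat and d :: "nat \<Rightarrow> nat \<Rightarrow> nat"
  assumes self: "u < n \<Longrightarrow> d u u = 0"
    and sym: "u < n \<Longrightarrow> v < n \<Longrightarrow> d u v = d v u"
    and tri: "u < n \<Longrightarrow> v < n \<Longrightarrow> w < n \<Longrightarrow> d u w \<le> d u v + d v w"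
    and split: "u < n \<Longrightarrow> w < n \<Longrightarrow> d u w \<le> r + s \<Longrightarrow> r + s \<le> 2 * n \<Longrightarrow> \<exists>y<n. d u y \<le> r \<and> d y w \<le> s"
begin

definition ball :: "nat \<Rightarrow> nat \<Rightarrow> nat set" where
  "ball r v = {u. u < n \<and> d v u \<le> r}"

lemma finite_ball [simp]: "finite (ball r v)" by (simp add: ball_def)

definition far :: "nat list \<Rightarrow> nat \<Rightarrow> nat \<Rightarrow> bool" where
  "far xs r v \<longleftrightarrow> (\<forall>x\<in>set xs. r < d x v)"

lemma ball_mono:
  assumes "u < n" "v < n" "d u v + r \<le> r'"
  shows "card (ball r u) \<le> card (ball r' v)"
proof (rule card_mono)
  show "ball r u \<subseteq> ball r' v"
    using assms tri[of v u] sym[of u v] by (fastforce simp: ball_def)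
qed simp

end

text \<open>The threshold \<open>t\<close> is arbitrary here. Correctness needs only that
  \<open>S\<close> meets the balls with at least \<open>t\<close> vertices; the choice near sqrt n
  concerns the running time alone.\<close>

locale search = finite_dist +
  fixes k R al \<rho> t :: nat and S :: "nat set"
  assumes al: "(2 * k - 1) * al \<le> R" and R: "R = \<rho> + al" "R \<le> n" and k: "k > 0"
    and S: "S \<subseteq> {..<n}" "0 \<in> S"
    and hit: "v < n \<Longrightarrow> t \<le> card (ball \<rho> v) \<Longrightarrow> \<exists>s\<in>S. d v s \<le> \<rho>"
    and hit_al: "v < n \<Longrightarrow> t \<le> card (ball al v) \<Longrightarrow> \<exists>s\<in>S. d v s \<le> al"
begin

text \<open>In both invariants of the search \<open>Suc i\<close> centers are still to be chosen after \<open>xs\<close>. In \<open>covS\<close> all of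
  them can be replaced by elements of \<open>S\<close>. In \<open>covR\<close> the elements of \<open>xs\<close> are so close to the original
  centers that they cover their parts with radius \<open>\<rho> + 2 * length xs * al\<close>.\<close>

definition covS :: "nat \<Rightarrow> nat list \<Rightarrow> bool" where
  "covS i xs \<longleftrightarrow> (\<exists>D\<subseteq>{..<n}. card D \<le> Suc i \<and>
     (\<forall>v<n. far xs (R + \<rho>) v \<longrightarrow> (\<exists>c\<in>D. d c v \<le> R)) \<and> (\<forall>c\<in>D. \<exists>s\<in>S. d c s \<le> \<rho>))"

definition covR :: "nat \<Rightarrow> nat list \<Rightarrow> bool" where
  "covR i xs \<longleftrightarrow> (\<exists>D\<subseteq>{..<n}. card D \<le> Suc i \<and>
     (\<forall>v<n. far xs (\<rho> + 2 * length xs * al) v \<longrightarrow> (\<exists>c\<in>D. d c v \<le> R)))"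

definition good :: "nat \<Rightarrow> nat list \<Rightarrow> bool" where
  "good i xs \<longleftrightarrow> covS i xs \<or> covR i xs"

text \<open>Both conditions can be tested without any knowledge of the original centers.\<close>

definition pivot :: "nat list \<Rightarrow> nat \<Rightarrow> bool" where
  "pivot xs w \<longleftrightarrow> far xs (\<rho> + 2 * length xs * al) w \<and> card (ball (\<rho> - 2 * length xs * al) w) < t"

lemma n_pos: "n > 0" using S by auto

text \<open>The denominator \<open>2 * k - 1\<close> enters here: up to \<open>2 * (k - 1)\<close>
  multiples of \<open>al\<close> have to fit into \<open>\<rho>\<close>, and one more separates
  \<open>\<rho>\<close> from \<open>R\<close>.\<close>

lemma al_j: assumes "j < k" shows "2 * j * al \<le> \<rho>"
proof -
  have "(2 * j + 1) * al \<le> (2 * k - 1) * al" using assms by (intro mult_right_mono) auto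
  with al R show ?thesis by simp
qed

lemma far_mono: "far xs r v \<Longrightarrow> r' \<le> r \<Longrightarrow> far xs r' v"
  unfolding far_def by fastforce

lemma card_le_1_obtain:
  assumes "card D \<le> Suc 0" "D \<subseteq> {..<n}"
  obtains c where "c < n" "D \<subseteq> {c}"
proof (cases "D = {}")
  case True
  then show ?thesis using that n_pos by auto
next
  case False
  have "finite D" using assms finite_subset by blast
  then have "card D = 1" using False assms(1) by (simp add: card_gt_0_iff le_antisym Suc_le_eq)
  then show ?thesis using that assms(2) by (auto simp: card_1_singleton_iff)
qed

text \<open>At a leaf both invariants give the same: by \<open>al_j\<close> the radius in
  \<open>covR\<close> is at most \<open>R + \<rho>\<close>, and at most one center is left. If none
  is left, nothing is uncovered and any vertex serves as \<open>c\<close>.\<close>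

lemma good_0:
  assumes "good 0 xs" "Suc (length xs) = k"
  shows "\<exists>c<n. \<forall>v<n. far xs (R + \<rho>) v \<longrightarrow> d c v \<le> R"
proof -
  have "\<rho> + 2 * length xs * al \<le> R + \<rho>" using al_j[of "length xs"] assms(2) R by auto
  then obtain D where D: "D \<subseteq> {..<n}" "card D \<le> Suc 0"
    "\<And>v. v < n \<Longrightarrow> far xs (R + \<rho>) v \<Longrightarrow> \<exists>c\<in>D. d c v \<le> R"
    using assms(1) far_mono unfolding good_def covS_def covR_def by meson
  obtain c where c: "c < n" "D \<subseteq> {c}" using card_le_1_obtain D by metis
  have "\<forall>v<n. far xs (R + \<rho>) v \<longrightarrow> d c v \<le> R" using D(3) c(2) by blast
  then show ?thesis using c(1) by blast
qed

lemma covS_step: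
  assumes "covS (Suc i) xs"
  shows "\<exists>x\<in>S. covS i (xs @ [x])"
proof -
  from assms obtain D where D: "D \<subseteq> {..<n}" "card D \<le> Suc (Suc i)"
    "\<And>v. v < n \<Longrightarrow> far xs (R + \<rho>) v \<Longrightarrow> \<exists>c\<in>D. d c v \<le> R" "\<And>c. c \<in> D \<Longrightarrow> \<exists>s\<in>S. d c s \<le> \<rho>"
    unfolding covS_def by blast
  have fin: "finite D" using D finite_subset by blast
  show ?thesis
  proof (cases "D = {}")
    \<comment> \<open>Everything is covered already, and vertex 0 only fills the position.\<close>
    case True
    have "covS i (xs @ [0])" unfolding covS_def
      by (rule exI[of _ "{}"]) (use D True in \<open>auto simp: far_def\<close>)
    then show ?thesis using S by blast
  next
    case False
    then obtain c where c: "c \<in> D" by blast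
    obtain s where s: "s \<in> S" "d c s \<le> \<rho>" using D(4) c by blast
    have sn: "s < n" "c < n" using s S c D by auto
    have "covS i (xs @ [s])" unfolding covS_def
    proof (intro exI[of _ "D - {c}"] conjI allI impI ballI)
      show "card (D - {c}) \<le> Suc i" using D(2) c fin by simp
      fix v assume v: "v < n" "far (xs @ [s]) (R + \<rho>) v"
      then obtain c' where c': "c' \<in> D" "d c' v \<le> R" using D(3)[of v] by (auto simp: far_def)
      have "c' \<noteq> c"
        using v c' s sn tri[of s c v] sym[of s c] by (auto simp: far_def)
      then show "\<exists>c'\<in>D - {c}. d c' v \<le> R" using c' by blast
    qed (use D in auto)
    then show ?thesis using s by blast
  qed
qed

text \<open>The failure of \<open>covS\<close> supplies a center whose ball is small, and with it a
  pivot. The second conclusion no longer refers to that center: every pivot is far from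
  \<open>xs\<close>, hence it is served by some remaining center, perhaps another one.\<close>

lemma covR_step:
  assumes "covR (Suc i) xs" "length xs + i + 2 = k" "set xs \<subseteq> {..<n}" "\<not> covS (Suc i) xs"
  shows "\<exists>w<n. pivot xs w"
    and "w < n \<Longrightarrow> pivot xs w \<Longrightarrow> \<exists>x\<in>ball (\<rho> - 2 * length xs * al) w. covR i (xs @ [x])"
proof -
  define j where "j = length xs"
  have j: "2 * j * al \<le> \<rho>" using al_j[of j] assms(2) j_def by simp
  from assms obtain D where D: "D \<subseteq> {..<n}" "card D \<le> Suc (Suc i)"
    "\<And>v. v < n \<Longrightarrow> far xs (\<rho> + 2 * j * al) v \<Longrightarrow> \<exists>c\<in>D. d c v \<le> R"
    unfolding covR_def j_def by blast
  have fin: "finite D" using D finite_subset by blast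
  have jR: "\<rho> + 2 * j * al \<le> R + \<rho>" using j R by simp
  \<comment> \<open>Only centers that still serve a vertex uncovered at the target radius are kept,
    since the path towards such a vertex \<open>v\<close> is needed below. If all of them had an
    element of \<open>S\<close> nearby, \<open>D'\<close> would be a witness for
    \<open>covS\<close>.\<close>
  define D' where "D' = {c\<in>D. \<exists>v<n. far xs (R + \<rho>) v \<and> d c v \<le> R}"
  have "\<exists>c\<in>D'. \<forall>s\<in>S. \<not> d c s \<le> \<rho>"
  proof (rule ccontr)
    assume "\<not> ?thesis"
    moreover have "card D' \<le> Suc (Suc i)" using D(2) card_mono[OF fin, of D'] D'_def by fastforce
    moreover have "\<forall>v<n. far xs (R + \<rho>) v \<longrightarrow> (\<exists>c\<in>D'. d c v \<le> R)"
      using D(3) far_mono[OF _ jR] unfolding D'_def by blast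
    ultimately have "covS (Suc i) xs" unfolding covS_def
      using D(1) by (intro exI[of _ D']) (auto simp: D'_def)
    with assms show False by blast
  qed
  then obtain c v where c: "c \<in> D" "\<forall>s\<in>S. \<not> d c s \<le> \<rho>" and v: "v < n" "far xs (R + \<rho>) v" "d c v \<le> R"
    by (auto simp: D'_def)
  have cn: "c < n" using c D by auto
  have "card (ball \<rho> c) < t" using hit[of c] c cn by force
  obtain y where y: "y < n" "d c y \<le> 2 * j * al" "d y v \<le> R - 2 * j * al"
    using split[of c v "2 * j * al" "R - 2 * j * al"] cn v R j by auto
  have "far xs (\<rho> + 2 * j * al) y" unfolding far_def
  proof
    fix x assume x: "x \<in> set xs"
    then have "R + \<rho> < d x v" "x < n" using v assms by (auto simp: far_def)
    with tri[of x y v] y v j R show "\<rho> + 2 * j * al < d x y" by auto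
  qed
  moreover have "card (ball (\<rho> - 2 * j * al) y) < t"
  proof -
    have "d y c + (\<rho> - 2 * j * al) \<le> \<rho>" using y cn sym[of y c] j by linarith
    then show ?thesis using ball_mono[of y c] y(1) cn \<open>card (ball \<rho> c) < t\<close> le_less_trans by blast
  qed
  ultimately show "\<exists>w<n. pivot xs w" using y unfolding pivot_def j_def by blast
  assume w: "w < n" "pivot xs w"
  then obtain c' where c': "c' \<in> D" "d c' w \<le> R" using D(3)[of w] unfolding pivot_def j_def by blast
  have c'n: "c' < n" using c' D by auto
  \<comment> \<open>The two parts add up to \<open>R\<close>. The second one is the error of the
    replacement, and \<open>R\<close> plus this error is exactly the radius
    \<open>\<rho> + 2 * (j + 1) * al\<close> of \<open>covR\<close> for the longer list.\<close>
  obtain x where x: "x < n" "d w x \<le> \<rho> - 2 * j * al" "d x c' \<le> al + 2 * j * al"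
    using split[of w c' "\<rho> - 2 * j * al" "al + 2 * j * al"] w c' c'n sym[of c' w] R j by auto
  have "covR i (xs @ [x])" unfolding covR_def
  proof (intro exI[of _ "D - {c'}"] conjI allI impI)
    show "D - {c'} \<subseteq> {..<n}" using D by auto
    show "card (D - {c'}) \<le> Suc i" using D(2) c' fin by simp
    fix u assume u: "u < n" "far (xs @ [x]) (\<rho> + 2 * length (xs @ [x]) * al) u"
    then have *: "\<rho> + 2 * j * al + 2 * al < d x u" "far xs (\<rho> + 2 * j * al) u"
      by (auto simp: far_def j_def algebra_simps intro: le_less_trans[rotated])
    obtain c2 where c2: "c2 \<in> D" "d c2 u \<le> R" using D(3)[OF u(1) *(2)] by blast
    have "c2 \<noteq> c'" using tri[of x c' u] x c'n u * c2 R by auto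
    then show "\<exists>c\<in>D - {c'}. d c u \<le> R" using c2 by blast
  qed
  then show "\<exists>x\<in>ball (\<rho> - 2 * length xs * al) w. covR i (xs @ [x])"
    using x by (auto simp: ball_def j_def)
qed

text \<open>Which invariant holds cannot be observed, so \<open>S\<close> and the ball of a pivot
  are both offered. As every pivot works, a single one is enough.\<close>

lemma good_step:
  assumes "good (Suc i) xs" "length xs + i + 2 = k" "set xs \<subseteq> {..<n}"
  shows "(\<exists>x\<in>S. good i (xs @ [x])) \<or> ((\<exists>w<n. pivot xs w) \<and>
    (\<forall>w<n. pivot xs w \<longrightarrow> (\<exists>x\<in>ball (\<rho> - 2 * length xs * al) w. good i (xs @ [x]))))"
proof (cases "covS (Suc i) xs")
  case True
  then show ?thesis using covS_step good_def by blast
next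
  case False
  then have "covR (Suc i) xs" using assms good_def by blast
  then show ?thesis using covR_step[OF _ assms(2,3) False] good_def by blast
qed

lemma good_init:
  assumes "C \<subseteq> {..<n}" "card C = k" "\<forall>v<n. \<exists>c\<in>C. d c v \<le> R"
  shows "good (k - 1) []"
  unfolding good_def covR_def using assms k by (intro disjI2 exI[of _ C]) auto

lemma last_small:
  assumes "c < n" "\<forall>u<n. far xs (R + \<rho>) u \<longrightarrow> d c u \<le> R" "v < n" "far xs (R + \<rho>) v"
  shows "\<exists>x\<in>ball al v. \<forall>u<n. far xs (R + \<rho>) u \<longrightarrow> d x u \<le> R + \<rho>"
proof -
  obtain x where x: "x < n" "d v x \<le> al" "d x c \<le> \<rho>"
    using split[of v c al \<rho>] assms(2)[rule_format, OF assms(3,4)] assms(1,3) R sym[of c v]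
    by (auto simp: add.commute)
  have "d x u \<le> R + \<rho>" if "u < n" "far xs (R + \<rho>) u" for u
    using tri[of x c u] assms x that by fastforce
  then show ?thesis using x by (auto simp: ball_def)
qed

lemma last_large_complete:
  assumes "c < n" "\<forall>u<n. far xs (R + \<rho>) u \<longrightarrow> d c u \<le> R"
    and "s \<in> S" "v < n" "far xs (R + \<rho>) v" "d s v \<le> al"
  shows "d c s \<le> R + al"
proof -
  have "s < n" using assms S by auto
  then show ?thesis using assms tri[of c v s] sym[of s v] by fastforce
qed

text \<open>The detour over \<open>s\<close> costs \<open>al\<close> twice, once in the check and
  once between \<open>s\<close> and \<open>v\<close>. It fits into \<open>\<rho>\<close> because
  \<open>k \<ge> 2\<close>.\<close>

lemma last_large_sound:
  assumes "k \<ge> 2" "c < n" "\<forall>s\<in>S. (\<exists>v<n. far xs (R + \<rho>) v \<and> d s v \<le> al) \<longrightarrow> d c s \<le> R + al"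
    and "\<forall>v<n. far xs (R + \<rho>) v \<longrightarrow> t \<le> card (ball al v)"
    and "v < n" "far xs (R + \<rho>) v"
  shows "d c v \<le> R + \<rho>"
proof -
  obtain s where s: "s \<in> S" "d v s \<le> al" using hit_al[of v] assms by blast
  have sn: "s < n" using s S by auto
  have "d c s \<le> R + al" using assms s sn sym[of v s] by auto
  moreover have "2 * al \<le> \<rho>" using al_j[of 1] assms(1) by simp
  ultimately show ?thesis using tri[of c s v] sn assms s sym[of v s] R by auto
qed

end

section \<open>Double counting for greedy hitting sets\<close>

context finite_dist begin

definition cnt :: "nat \<Rightarrow> nat set \<Rightarrow> nat \<Rightarrow> nat" where
  "cnt r U u = card {v\<in>U. d u v \<le> r}"

lemma cnt_mono: "finite U' \<Longrightarrow> U \<subseteq> U' \<Longrightarrow> cnt r U u \<le> cnt r U' u"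
  unfolding cnt_def by (rule card_mono) auto

text \<open>Double counting of the pairs of a vertex \<open>u\<close> and some \<open>v\<close> in
  \<open>U\<close> with \<open>d u v \<le> r\<close>.\<close>

lemma sum_cnt:
  assumes "U \<subseteq> {..<n}" "\<forall>v\<in>U. t \<le> card (ball r v)"
  shows "t * card U \<le> (\<Sum>u<n. cnt r U u)"
proof -
  have fin: "finite U" using assms finite_subset by blast
  have "t * card U \<le> (\<Sum>v\<in>U. card (ball r v))"
    using assms sum_bounded_below[of U t "\<lambda>v. card (ball r v)"] by (simp add: mult.commute)
  also have "\<dots> = (\<Sum>v\<in>U. \<Sum>u<n. if d u v \<le> r then 1 else 0)"
  proof (rule sum.cong)
    fix v assume v: "v \<in> U"
    have "ball r v = {..<n} \<inter> {u. d u v \<le> r}" using v assms sym[of v] by (auto simp: ball_def)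
    then show "card (ball r v) = (\<Sum>u<n. if d u v \<le> r then 1 else 0)"
      by (simp add: sum.If_cases)
  qed simp
  also have "\<dots> = (\<Sum>u<n. \<Sum>v\<in>U. if d u v \<le> r then 1 else 0)" by (rule sum.swap)
  also have "\<dots> = (\<Sum>u<n. cnt r U u)"
    unfolding cnt_def using fin by (simp add: sum.If_cases Int_def)
  finally show ?thesis .
qed

text \<open>Here \<open>p\<close> is the number of vertices taken in a pass, each of which settles
  at least \<open>th\<close> elements of \<open>U\<close>. The threshold cancels, so the bound is
  the same for all passes.\<close>

lemma pass_bound:
  assumes "U \<subseteq> {..<n}" "\<forall>v\<in>U. t \<le> card (ball r v)" "\<forall>u<n. cnt r U u \<le> 2 * th"
    and "th * p \<le> card U" "th > 0"
  shows "t * p \<le> 2 * n"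
proof -
  have "t * card U \<le> (\<Sum>u<n. cnt r U u)" using sum_cnt assms by blast
  also have "\<dots> \<le> (\<Sum>u<n. 2 * th)" using assms by (intro sum_mono) auto
  finally have "t * card U \<le> n * (2 * th)" by simp
  moreover have "t * (th * p) \<le> t * card U" using assms(4) by simp
  ultimately have "t * (th * p) \<le> n * (2 * th)" by linarith
  then have "th * (t * p) \<le> th * (2 * n)" by (simp add: ac_simps)
  then show ?thesis using assms(5) by simp
qed

end

section \<open>Graph distances and the \<open>k\<close>-radius\<close>

text \<open>The value \<open>4 * n\<close> for different components exceeds all radii that occur, and it preserves the
  triangle inequality.\<close>

definition gdist_nat :: "nat \<Rightarrow> nat set set \<Rightarrow> nat \<Rightarrow> nat \<Rightarrow> nat" where
  "gdist_nat n E u v = (if \<exists>l. (u, v) \<in> adj E ^^ l then LEAST l. (u, v) \<in> adj E ^^ l else 4 * n)"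

lemma adj_sym: "(u, v) \<in> adj E \<longleftrightarrow> (v, u) \<in> adj E"
  by (simp add: adj_def insert_commute)

lemma walk_sym: "(u, v) \<in> adj E ^^ l \<longleftrightarrow> (v, u) \<in> adj E ^^ l"
proof -
  have *: "(u, v) \<in> adj E ^^ l \<Longrightarrow> (v, u) \<in> adj E ^^ l" for u v
  proof (induction l arbitrary: v)
    case (Suc l)
    from Suc.prems obtain y where "(u, y) \<in> adj E ^^ l" "(y, v) \<in> adj E" by auto
    then show ?case using Suc.IH adj_sym relpow_Suc_I2 by metis
  qed simp
  then show ?thesis by blast
qed

lemma graph_adj: "graph n E \<Longrightarrow> (u, v) \<in> adj E \<Longrightarrow> u < n \<and> v < n"
  by (auto simp: graph_def adj_def doubleton_eq_iff)

lemma walk_less: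
  assumes "graph n E" "(u, v) \<in> adj E ^^ l" "u < n" shows "v < n"
  using assms by (cases l) (auto dest: graph_adj)

text \<open>For a finite bound, \<open>a \<le> enat r\<close> is the strict inequality
  \<open>a < enat (Suc r)\<close>, and an infimum lies strictly below a bound iff some member
  does.\<close>

lemma Inf_le_enat: "(INF x\<in>A. f x) \<le> enat r \<longleftrightarrow> (\<exists>x\<in>A. f x \<le> enat r)"
proof -
  have "(a \<le> enat r) = (a < enat (Suc r))" for a by (cases a) auto
  then show ?thesis by (simp add: INF_less_iff)
qed

lemma gdist_le: "gdist E u v \<le> enat r \<longleftrightarrow> (\<exists>l\<le>r. (u, v) \<in> adj E ^^ l)"
  unfolding gdist_def Inf_le_enat by auto

text \<open>The vertices of a shortest walk are at the distances \<open>0, ..., m\<close> from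
  \<open>u\<close>. These are all different, so there are at least \<open>m + 1\<close>
  vertices.\<close>

lemma gdist_nat_less:
  assumes "graph n E" "u < n" "(u, v) \<in> adj E ^^ l"
  shows "gdist_nat n E u v < n"
proof -
  let ?f = "\<lambda>y. LEAST l. (u, y) \<in> adj E ^^ l"
  define m where "m = ?f v"
  have m: "(u, v) \<in> adj E ^^ m" unfolding m_def using assms(3) by (rule LeastI)
  have "{..m} \<subseteq> ?f ` {..<n}"
  proof
    fix i assume "i \<in> {..m}"
    then have "(u, v) \<in> adj E ^^ i O adj E ^^ (m - i)" using m by (simp flip: relpow_add)
    then obtain y where y: "(u, y) \<in> adj E ^^ i" "(y, v) \<in> adj E ^^ (m - i)" by blast
    have "?f y = i"
    proof (rule Least_equality)
      fix l assume "(u, y) \<in> adj E ^^ l"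
      then have "(u, v) \<in> adj E ^^ (l + (m - i))" using y by (auto simp: relpow_add)
      then have "m \<le> l + (m - i)" unfolding m_def by (rule Least_le)
      then show "i \<le> l" using \<open>i \<in> {..m}\<close> by auto
    qed (rule y)
    moreover have "y < n" using walk_less assms y by blast
    ultimately show "i \<in> ?f ` {..<n}" by force
  qed
  then have "card {..m} \<le> card {..<n}" by (meson finite_imageI finite_lessThan surj_card_le)
  then show ?thesis using assms(3) by (auto simp: gdist_nat_def m_def)
qed

lemma gdist_nat_le_iff:
  assumes "r < 4 * n" shows "gdist_nat n E u v \<le> r \<longleftrightarrow> (\<exists>l\<le>r. (u, v) \<in> adj E ^^ l)"
proof (cases "\<exists>l. (u, v) \<in> adj E ^^ l")
  case True
  then have "(u, v) \<in> adj E ^^ gdist_nat n E u v" by (auto simp: gdist_nat_def intro: LeastI)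
  moreover have "gdist_nat n E u v \<le> l" if "(u, v) \<in> adj E ^^ l" for l
    using that True by (auto simp: gdist_nat_def intro: Least_le)
  ultimately show ?thesis by (meson order_trans)
next
  case False
  then show ?thesis using assms by (auto simp: gdist_nat_def)
qed

lemma gdist_nat_le_4n: assumes "graph n E" "u < n" shows "gdist_nat n E u v \<le> 4 * n"
  using gdist_nat_less[OF assms] by (cases "\<exists>l. (u, v) \<in> adj E ^^ l") (force, simp add: gdist_nat_def)

lemma gdist_nat_finite_dist: assumes "graph n E" shows "finite_dist n (gdist_nat n E)"
proof
  fix u assume "u < n"
  then show "gdist_nat n E u u = 0" using gdist_nat_le_iff[of 0 n E u u] by simp
next
  fix u v show "gdist_nat n E u v = gdist_nat n E v u" by (simp add: gdist_nat_def walk_sym[of u])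
next
  fix u v w assume u: "u < n" "v < n" "w < n"
  show "gdist_nat n E u w \<le> gdist_nat n E u v + gdist_nat n E v w"
  proof (cases "(\<exists>l. (u, v) \<in> adj E ^^ l) \<and> (\<exists>l. (v, w) \<in> adj E ^^ l)")
    case True
    then have "gdist_nat n E u v < n" "gdist_nat n E v w < n" using gdist_nat_less assms u by blast+
    moreover have "(u, v) \<in> adj E ^^ gdist_nat n E u v" "(v, w) \<in> adj E ^^ gdist_nat n E v w"
      using True by (auto simp: gdist_nat_def intro: LeastI)
    then have "(u, w) \<in> adj E ^^ (gdist_nat n E u v + gdist_nat n E v w)" by (auto simp: relpow_add)
    ultimately show ?thesis using gdist_nat_le_iff[of "gdist_nat n E u v + gdist_nat n E v w" n] by auto
  next
    \<comment> \<open>One of the two distances on the right is the value \<open>4 * n\<close>, which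
      bounds every distance.\<close>
    case False
    then show ?thesis using gdist_nat_le_4n[OF assms u(1), of w]
      by (metis gdist_nat_def trans_le_add1 trans_le_add2)
  qed
next
  fix u w r s assume u: "u < n" "w < n" "gdist_nat n E u w \<le> r + s" "r + s \<le> 2 * n"
  then obtain l where l: "l \<le> r + s" "(u, w) \<in> adj E ^^ l" using gdist_nat_le_iff[of "r + s" n] by auto
  \<comment> \<open>The walk may be shorter than \<open>r\<close>; then the cut is at its
    end.\<close>
  define i where "i = min l r"
  have "(u, w) \<in> adj E ^^ i O adj E ^^ (l - i)" using l by (simp add: i_def flip: relpow_add)
  then obtain y where y: "(u, y) \<in> adj E ^^ i" "(y, w) \<in> adj E ^^ (l - i)" by blast
  have "gdist_nat n E u y \<le> r" "gdist_nat n E y w \<le> s"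
    using gdist_nat_le_iff[of r n E u y] gdist_nat_le_iff[of s n E y w] u y l
    by (auto simp: i_def min_def split: if_splits)
  then show "\<exists>y<n. gdist_nat n E u y \<le> r \<and> gdist_nat n E y w \<le> s" using walk_less assms y u by blast
qed

lemma k_radius_le:
  "k_radius k n E \<le> enat r \<longleftrightarrow>
    (\<exists>C\<subseteq>{..<n}. card C = k \<and> (\<forall>v<n. \<exists>c\<in>C. \<exists>l\<le>r. (c, v) \<in> adj E ^^ l))"
  unfolding k_radius_def gdist_set_def Inf_le_enat SUP_le_iff gdist_le
  by (simp add: Ball_def Bex_def conj_assoc walk_sym)

section \<open>Ball sizes and hitting sets\<close>

text \<open>
  Registers: 0 to 5 hold \<open>n\<close>, \<open>m\<close>, \<open>R\<close>, \<open>al\<close>, \<open>\<rho>\<close>, \<open>t = \<lceil>\<surd>n\<rceil>\<close>; 6 is set when a cover has been found; 16 holds \<open>2 m\<close>;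
  \<open>30 + 2 j\<close> and \<open>31 + 2 j\<close> hold the \<open>j\<close>-th chosen center and the vertex \<open>w\<close> used for its choice; the others up to
  23 are local.

  Arrays: 0 and 1 are the input; 2 is the distance matrix (row by row); 3 and 4 are degrees and adjacency lists
  (with stride \<open>2 m\<close>); 5 is the queue; 6 flags the elements of \<open>S\<close>; 7 flags the balls that are not hit yet; 8 flags \<open>U\<close>;
  9 is the list that candidates for the last center are checked against; 10 and \<open>11 + j\<close> hold the sizes of the
  balls of radius \<open>al\<close> and \<open>\<rho> - 2 j al\<close>.
\<close>

abbreviation dist_at :: "nat \<Rightarrow> nat \<Rightarrow> exp" where
  "dist_at x y \<equiv> Get 2 (Bin Add (Bin Mul (Var x) (Var 0)) (Var y))"

abbreviation inc :: "nat \<Rightarrow> cmd" where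
  "inc x \<equiv> Asg x (Bin Add (Var x) (Lit 1))"

definition ball_sizes :: "nat \<Rightarrow> cmd" where
  "ball_sizes a = For 7 0 (Sq (Asg 9 (Lit 0)) (Sq
     (For 8 0 (IfC (Bin Less (Var 11) (dist_at 7 8)) NOP (inc 9)))
     (Wr a (Var 7) (Var 9))))"

definition count :: cmd where
  "count = Sq (Asg 9 (Lit 0)) (For 8 0 (IfC (Bin Less (Var 11) (dist_at 7 8)) NOP
     (Asg 9 (Bin Add (Var 9) (Get 7 (Var 8))))))"

definition remove :: cmd where
  "remove = For 8 0 (IfC (Bin Less (Var 11) (dist_at 7 8)) NOP (Wr 7 (Var 8) (Lit 0)))"

text \<open>A pass takes every vertex that lies in at least \<open>th\<close> balls not hit yet, where \<open>th\<close> is in register 10 and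
  is halved after each pass. At the start of a pass no vertex lies in more than \<open>2 * th\<close> of them, which bounds
  the number of vertices taken by \<open>2 * n / t\<close>.\<close>

definition pass :: cmd where
  "pass = For 7 0 (Sq count (IfC (Bin Less (Var 9) (Var 10)) NOP (Sq (Wr 6 (Var 7) (Lit 1)) remove)))"

definition greedy :: "nat \<Rightarrow> cmd" where
  "greedy a = Sq (For 8 0 (IfC (Bin Less (Get a (Var 8)) (Var 5)) (Wr 7 (Var 8) (Lit 0)) (Wr 7 (Var 8) (Lit 1))))
     (Sq (Asg 10 (Var 0)) (Wh (Var 10) (Sq pass (Asg 10 (Bin Div (Var 10) (Lit 2))))))"

lemma frag_simps [simp]:
  "mod_regs (ball_sizes a) = {7, 8, 9}" "mod_arrs (ball_sizes a) = {a}"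
  "mod_regs count = {8, 9}" "mod_arrs count = {}"
  "mod_regs remove = {8}" "mod_arrs remove = {7}"
  "mod_regs pass = {7, 8, 9}" "mod_arrs pass = {6, 7}"
  "mod_regs (greedy a) = {7, 8, 9, 10}" "mod_arrs (greedy a) = {6, 7}"
  by (auto simp: ball_sizes_def count_def remove_def pass_def greedy_def)

lemma card_less_Suc:
  "card {v. v < Suc i \<and> P v} = card {v. v < i \<and> P v} + of_bool (P i)"
proof -
  have "{v. v < Suc i \<and> P v} = (if P i then insert i {v. v < i \<and> P v} else {v. v < i \<and> P v})"
    by (auto simp: less_Suc_eq)
  then show ?thesis by simp
qed

lemma wp_conseq_agree:
  assumes "wp w c Q s" "\<And>t s'. Q t s' \<Longrightarrow> agree X A s s' \<Longrightarrow> Q' t s'" "mod_regs c \<subseteq> X" "mod_arrs c \<subseteq> A"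
  shows "wp w c Q' s"
proof (rule wp_conseq[OF assms(1)])
  fix t s' assume "Q t s'" "agree (mod_regs c) (mod_arrs c) s s'"
  moreover from this have "agree X A s s'" using assms(3,4) by (auto simp: agree_def)
  ultimately show "Q' t s'" using assms(2) by blast
qed

text \<open>This is the binary length of \<open>n\<close>; its recursion follows the threshold of
  \<open>greedy\<close>, so it counts the passes.\<close>

fun halvings :: "nat \<Rightarrow> nat" where
  "halvings n = (if n = 0 then 0 else Suc (halvings (n div 2)))"

declare halvings.simps [simp del]

text \<open>The largest numbers are positions in the adjacency lists, with a stride of up to
  \<open>2 * n * n\<close>, hence cubic in \<open>n\<close>. The fourth power and the factor 64
  leave room for coarse estimates.\<close>

locale machine =
  fixes w n :: nat
  assumes lim: "64 * (int n + 1) ^ 4 \<le> 2 ^ w" and n_gt_0: "n > 0"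
begin

lemma lim2: "64 * (int n + 1) * (int n + 1) * (int n + 1) < 2 ^ w"
proof -
  have "64 * (int n + 1) * (int n + 1) * (int n + 1) * 1 < 64 * (int n + 1) * (int n + 1) * (int n + 1) * (int n + 1)"
    using n_gt_0 by (intro mult_strict_left_mono) auto
  also have "\<dots> = 64 * (int n + 1) ^ 4" by (simp add: eval_nat_numeral)
  finally show ?thesis using lim by simp
qed

lemma in_range_cube: assumes "0 \<le> v" "v \<le> 64 * (int n + 1) * (int n + 1) * (int n + 1)" shows "in_range w v"
  using assms lim2 by (auto simp: in_range_def intro: order_trans[of _ 0])

lemma mult_Suc_n_ge: "0 \<le> b \<Longrightarrow> b \<le> b * (int n + 1)"
  by (simp add: distrib_left)

lemma in_range_sq: assumes "0 \<le> v" "v \<le> 64 * (int n + 1) * (int n + 1)" shows "in_range w v"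
  using assms mult_Suc_n_ge[of "64 * (int n + 1) * (int n + 1)"]
  by (intro in_range_cube) linarith+

lemma in_range_lin: assumes "0 \<le> v" "v \<le> 64 * (int n + 1)" shows "in_range w v"
  using assms mult_Suc_n_ge[of "64 * (int n + 1)"]
  by (intro in_range_sq) linarith+

lemma in_range_of_bool [simp]: "in_range w (of_bool b)"
  by (rule in_range_lin) (auto simp: n_gt_0)

lemma in_range_lits [simp]: "in_range w 0" "in_range w 1" "in_range w 2" "in_range w 4"
  by (rule in_range_lin; simp)+

lemma in_range_le [simp]: "u \<le> 8 * n \<Longrightarrow> in_range w (int u)" "u \<le> 8 * n \<Longrightarrow> in_range w (int u + 1)" "u \<le> 8 * n \<Longrightarrow> in_range w (1 + int u)"
  by (rule in_range_lin; simp)+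

lemma mul_le: "u \<le> n \<Longrightarrow> int u * int n \<le> (int n + 1) * (int n + 1)"
  by (intro mult_mono) auto

lemma in_range_idx [simp]: "u \<le> n \<Longrightarrow> in_range w (int u * int n)"
  "u \<le> n \<Longrightarrow> v \<le> n \<Longrightarrow> in_range w (int u * int n + int v)"
  subgoal using order_trans[OF mul_le[of u], of "64 * ((int n + 1) * (int n + 1))"]
    by (intro in_range_sq) (auto simp: algebra_simps)
  subgoal
  proof (rule in_range_sq)
    assume "u \<le> n" "v \<le> n"
    moreover have "int n + 1 \<le> (int n + 1) * (int n + 1)" by (simp add: algebra_simps)
    ultimately show "int u * int n + int v \<le> 64 * (int n + 1) * (int n + 1)"
      using mul_le[of u] unfolding mult.assoc by linarith
  qed simp
  done

lemma w_gt_0: "w > 0"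
proof (rule ccontr)
  assume "\<not> 0 < w"
  then have "64 * (int n + 1) ^ 4 \<le> 1" using lim by simp
  moreover have "1 \<le> (int n + 1) ^ 4" by (simp add: one_le_power)
  ultimately show False by simp
qed

text \<open>The frame is given by explicit supersets \<open>X\<close> and \<open>A\<close>, and the
  range condition becomes a quadratic bound that also admits loops over the edges.\<close>

lemma wp_For_le:
  assumes step: "\<And>i \<sigma>. i < m \<Longrightarrow> reg \<sigma> x = int i \<Longrightarrow> reg \<sigma> y = int m \<Longrightarrow> I i \<sigma> \<Longrightarrow>
      agree X A s \<sigma> \<Longrightarrow>
      wp w c (\<lambda>t \<sigma>'. t \<le> \<tau> i \<and> I (Suc i) (setr x (int (Suc i)) \<sigma>')) \<sigma>"
    and fin: "\<And>t \<sigma>. I m \<sigma> \<Longrightarrow> reg \<sigma> x = int m \<Longrightarrow> agree X A s \<sigma> \<Longrightarrow>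
      t \<le> 2 + (\<Sum>i<m. \<tau> i + 2) \<Longrightarrow> Q t \<sigma>"
    and init: "I 0 (setr x 0 s)"
    and mod: "x \<notin> mod_regs c" "y \<notin> insert x (mod_regs c)" "insert x (mod_regs c) \<subseteq> X" "mod_arrs c \<subseteq> A"
    and bnd: "reg s y = int m" "m \<le> 8 * (n + 1) * (n + 1)"
  shows "wp w (For x y c) Q s"
proof -
  have "int m \<le> int (8 * (n + 1) * (n + 1))" using bnd by (simp only: of_nat_le_iff)
  also have "\<dots> = 8 * ((int n + 1) * (int n + 1))" by (simp add: algebra_simps)
  also have "\<dots> \<le> 64 * ((int n + 1) * (int n + 1))" by (rule mult_right_mono) auto
  finally have "in_range w (int m)" by (intro in_range_sq) (simp_all only: mult.assoc of_nat_0_le_iff)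
  then have m: "int m < 2 ^ w" by (simp add: in_range_def)
  have f: "agree X A s \<sigma>" if "agree (insert x (mod_regs c)) (mod_arrs c) s \<sigma>" for \<sigma>
    using that mod by (auto simp: agree_def)
  show ?thesis
  proof (rule wp_For[where I = I and \<tau> = \<tau> and m = m], goal_cases)
    case 8
    then show ?case using step f by blast
  next
    case 9
    then show ?case using fin f by blast
  qed (use mod bnd m w_gt_0 init in auto)
qed

lemma n_le: "n \<le> 8 * (n + 1) * (n + 1)" by simp

end

section \<open>Correctness and cost of ball sizes and greedy hitting sets\<close>

locale dist_machine = machine w n + finite_dist n d for w n d +
  assumes d_le: "u < n \<Longrightarrow> v < n \<Longrightarrow> d u v \<le> 4 * n"
begin

definition dmat :: "state \<Rightarrow> bool" where
  "dmat s \<longleftrightarrow> reg s 0 = int n \<and> (\<forall>u<n. \<forall>v<n. arr s 2 (int u * int n + int v) = int (d u v))"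

definition flags :: "state \<Rightarrow> nat \<Rightarrow> nat set \<Rightarrow> bool" where
  "flags s a A \<longleftrightarrow> (\<forall>v<n. arr s a (int v) = of_bool (v \<in> A))"

lemma flags_setr [simp]: "flags (setr x v s) a F \<longleftrightarrow> flags s a F"
  by (simp add: flags_def)

lemma dmat_setr [simp]: "x \<noteq> 0 \<Longrightarrow> dmat (setr x v s) \<longleftrightarrow> dmat s"
  by (simp add: dmat_def)

lemma in_range_d: "u < n \<Longrightarrow> v < n \<Longrightarrow> in_range w (int (d u v))"
  using d_le[of u v] by simp

lemma dmat_agree: "dmat s \<Longrightarrow> agree X A s s' \<Longrightarrow> 0 \<notin> X \<Longrightarrow> 2 \<notin> A \<Longrightarrow> dmat s'"
  by (simp add: dmat_def agree_def)

lemma flags_agree: "flags s a F \<Longrightarrow> agree X A s s' \<Longrightarrow> a \<notin> A \<Longrightarrow> flags s' a F"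
  by (simp add: flags_def agree_def)

lemma card_ball_le: "card (ball r v) \<le> n"
  using card_mono[of "{..<n}" "ball r v"] by (auto simp: ball_def)

lemma card_less_le: "i \<le> n \<Longrightarrow> card {u. u < i \<and> P u} \<le> n"
  using card_mono[of "{..<i}" "{u. u < i \<and> P u}"] by (force intro: order_trans)

lemma wp_ball_sizes:
  assumes s: "dmat s" "reg s 11 = int r" "r \<le> n" "a \<noteq> 2"
  shows "wp w (ball_sizes a) (\<lambda>t s'. t \<le> 2 + n * (6 + 4 * n) \<and>
    (\<forall>v<n. arr s' a (int v) = int (card (ball r v)))) s"
  unfolding ball_sizes_def
proof (rule wp_For_le[where I = "\<lambda>i \<sigma>. \<forall>v<i. arr \<sigma> a (int v) = int (card (ball r v))"
      and \<tau> = "\<lambda>_. 4 + 4 * n" and m = n and X = "{7,8,9}" and A = "{a}"], goal_cases)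
  case (1 i \<sigma>)
  note i = 1(1-4) and f = 1(5)
  have ds: "dmat \<sigma>" "reg \<sigma> 11 = int r" using dmat_agree[OF s(1) f] s agree_reg[OF f] by auto
  let ?s = "setr 9 0 \<sigma>"
  have *: "wp w (For 8 0 (IfC (Bin Less (Var 11) (dist_at 7 8)) NOP (inc 9)))
    (\<lambda>t \<sigma>'. t \<le> 2 + 4 * n \<and> reg \<sigma>' 9 = int (card (ball r i))) ?s"
  proof (rule wp_For_le[where I = "\<lambda>j \<sigma>. reg \<sigma> 9 = int (card {v. v < j \<and> d i v \<le> r})"
        and \<tau> = "\<lambda>_. 2" and m = n and X = "{8,9}" and A = "{}"], goal_cases)
    case (1 j \<sigma>')
    note g = 1(5)
    have "dmat \<sigma>'" using dmat_agree[OF _ g] ds by (auto simp: dmat_def)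
    moreover have "reg \<sigma>' 7 = int i" "reg \<sigma>' 11 = int r" using agree_reg[OF g] i ds by auto
    moreover have "card {v. v < j \<and> d i v \<le> r} \<le> n" using card_less_le 1 by simp
    ultimately show ?case
      using 1 i s(3) in_range_d[of i j] by (simp add: dmat_def card_less_Suc)
  qed (use i n_le in \<open>auto simp: ball_def\<close>)
  show ?case
    unfolding wp_simps(4) wp_simps(2)
  proof (intro conjI, simp, simp only: ev.simps, rule wp_conseq_agree[OF *, where X = "{8,9}" and A = "{}"], goal_cases)
    case (1 t \<sigma>')
    note g = 1(2)
    have "reg \<sigma>' 7 = int i" "arr \<sigma>' a = arr \<sigma> a" using agree_reg[OF g] agree_arr[OF g] i by auto
    then show ?case
      using 1 i card_ball_le[of r i] by (simp add: less_Suc_eq)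
  qed auto
qed (use s n_le in \<open>auto simp: dmat_def algebra_simps\<close>)

lemma wp_count:
  assumes s: "dmat s" "reg s 11 = int r" "r \<le> n" "flags s 7 U" "U \<subseteq> {..<n}" "reg s 7 = int u" "u < n"
  shows "wp w count (\<lambda>t s'. t \<le> 3 + 4 * n \<and> reg s' 9 = int (cnt r U u)) s"
  unfolding count_def wp_simps(4) wp_simps(2)
proof (intro conjI, simp, simp only: ev.simps, rule wp_For_le[where I = "\<lambda>j \<sigma>. reg \<sigma> 9 = int (card {v. v < j \<and> (v \<in> U \<and> d u v \<le> r)})"
        and \<tau> = "\<lambda>_. 2" and m = n and X = "{8,9}" and A = "{}"], goal_cases)
  case (1 j \<sigma>)
  note g = 1(5)
  have "dmat \<sigma>" using dmat_agree[OF _ g] s by (auto simp: dmat_def)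
  moreover have "reg \<sigma> 7 = int u" "reg \<sigma> 11 = int r" "arr \<sigma> 7 (int j) = of_bool (j \<in> U)"
    using agree_reg[OF g] agree_arr[OF g] s 1(1) by (auto simp: flags_def)
  moreover have "card {v. v < j \<and> (v \<in> U \<and> d u v \<le> r)} \<le> n" using card_less_le 1 by simp
  ultimately show ?case
    using 1 s(3,7) in_range_d[of u j] by (auto simp: dmat_def card_less_Suc)
next
  case (2 t \<sigma>)
  have "{v. v < n \<and> v \<in> U \<and> d u v \<le> r} = {v \<in> U. d u v \<le> r}" using s(5) by auto
  then show ?case using 2 by (simp add: cnt_def)
qed (use s n_le in \<open>auto simp: dmat_def\<close>)

lemma wp_remove:
  assumes s: "dmat s" "reg s 11 = int r" "r \<le> n" "flags s 7 U" "reg s 7 = int u" "u < n"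
  shows "wp w remove (\<lambda>t s'. t \<le> 2 + 4 * n \<and> flags s' 7 {v\<in>U. r < d u v}) s"
  unfolding remove_def
proof (rule wp_For_le[where I = "\<lambda>j \<sigma>. flags \<sigma> 7 {v\<in>U. v < j \<longrightarrow> r < d u v}"
        and \<tau> = "\<lambda>_. 2" and m = n and X = "{8}" and A = "{7}"], goal_cases)
  case (1 j \<sigma>)
  note g = 1(5)
  have "dmat \<sigma>" using dmat_agree[OF _ g] s by (auto simp: dmat_def)
  moreover have "reg \<sigma> 7 = int u" "reg \<sigma> 11 = int r"
    using agree_reg[OF g] s by auto
  ultimately show ?case
    using 1 s(3,6) in_range_d[of u j] by (auto simp: dmat_def flags_def less_Suc_eq)
next
  case (2 t \<sigma>)
  have "flags \<sigma> 7 {v\<in>U. r < d u v}" using 2(1) by (auto simp: flags_def)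
  then show ?case using 2 by simp
qed (use s n_le in \<open>auto simp: dmat_def flags_def\<close>)

definition hits :: "nat \<Rightarrow> nat \<Rightarrow> nat set \<Rightarrow> nat set \<Rightarrow> bool" where
  "hits r t S U \<longleftrightarrow> S \<subseteq> {..<n} \<and> U \<subseteq> {..<n} \<and> (\<forall>v\<in>U. t \<le> card (ball r v)) \<and>
    (\<forall>v<n. t \<le> card (ball r v) \<longrightarrow> v \<in> U \<or> (\<exists>s\<in>S. d s v \<le> r))"

text \<open>The quantity \<open>th * card S + card U\<close> does not increase, since a new element
  of \<open>S\<close> removes at least \<open>th\<close> elements of \<open>U\<close>. Counts only
  drop while \<open>U\<close> shrinks, so a vertex passed over stays below the threshold and one
  sweep suffices.\<close>

lemma wp_pass:
  assumes s: "dmat s" "reg s 11 = int r" "r \<le> n" "flags s 7 U" "flags s 6 S" "hits r t S U"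
    "reg s 10 = int th" "th > 0" "th \<le> n"
  shows "wp w pass (\<lambda>T s'. T \<le> 2 + n * (9 + 8 * n) \<and> (\<exists>U' S'. flags s' 7 U' \<and> flags s' 6 S' \<and>
     hits r t S' U' \<and> S \<subseteq> S' \<and> th * card S' + card U' \<le> th * card S + card U \<and> (\<forall>u<n. cnt r U' u < th))) s"
proof -
  let ?I = "\<lambda>j \<sigma>. \<exists>U' S'. flags \<sigma> 7 U' \<and> flags \<sigma> 6 S' \<and> hits r t S' U' \<and> S \<subseteq> S' \<and>
    th * card S' + card U' \<le> th * card S + card U \<and> (\<forall>u<j. cnt r U' u < th)"
  show ?thesis unfolding pass_def
  proof (rule wp_For_le[where I = ?I
          and \<tau> = "\<lambda>_. 7 + 8 * n" and m = n and X = "{7,8,9}" and A = "{6,7}"], goal_cases)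
    case (1 u \<sigma>)
    note f = 1(5)
    from 1 obtain U' S' where U: "flags \<sigma> 7 U'" "flags \<sigma> 6 S'"
       "hits r t S' U'" "S \<subseteq> S'" "th * card S' + card U' \<le> th * card S + card U" "\<forall>u'<u. cnt r U' u' < th" by blast
    have fin: "finite U'" "finite S'" using U(3) finite_subset by (auto simp: hits_def)
    have d\<sigma>: "dmat \<sigma>" using dmat_agree[OF s(1) f] by simp
    have r\<sigma>: "reg \<sigma> 11 = int r" "reg \<sigma> 10 = int th" using agree_reg[OF f] s by auto
    have U'n: "U' \<subseteq> {..<n}" using U(3) hits_def by blast
    have cn: "cnt r U' u \<le> n" using card_mono[OF _ U'n] card_mono[OF fin(1), of "{v\<in>U'. d u v \<le> r}"]
      unfolding cnt_def by fastforce
    show ?case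
      unfolding wp_simps(4)
    proof (rule wp_conseq_agree[OF wp_count[OF d\<sigma> r\<sigma>(1) s(3) U(1) U'n 1(2,1)], where X = "{8,9}" and A = "{}"], goal_cases)
      case c: (1 t1 \<sigma>1)
      note g = c(2)
      have d1: "dmat \<sigma>1" using dmat_agree[OF d\<sigma> g] by simp
      have r1: "reg \<sigma>1 9 = int (cnt r U' u)" "reg \<sigma>1 10 = int th" "reg \<sigma>1 7 = int u" "reg \<sigma>1 11 = int r"
        using c agree_reg[OF g] 1 r\<sigma> by auto
      have a1: "flags \<sigma>1 7 U'" "flags \<sigma>1 6 S'" using flags_agree[OF _ g] U by auto
      show ?case
      proof (cases "cnt r U' u < th")
        case True
        then have "\<forall>u'<Suc u. cnt r U' u' < th" using U by (auto simp: less_Suc_eq)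
        then have "?I (Suc u) \<sigma>1"
          using a1 U by blast
        then show ?thesis using True c(1) r1 s(9) cn by simp
      next
        case False
        let ?U = "{v\<in>U'. r < d u v}" and ?s = "seta 6 (int u) 1 \<sigma>1"
        have "wp w remove (\<lambda>t s'. t \<le> 2 + 4 * n \<and> flags s' 7 ?U) ?s"
          by (rule wp_remove) (use d1 r1 a1 s(3) 1(1) in \<open>auto simp: dmat_def flags_def\<close>)
        then have *: "wp w remove (\<lambda>t2 \<sigma>2. t1 + Suc (1 + t2) \<le> 7 + 8 * n \<and> ?I (Suc u) \<sigma>2) ?s"
        proof (rule wp_conseq_agree[where X = "{8}" and A = "{7}"], goal_cases)
          case e: (1 t2 \<sigma>2)
          note h = e(2)
          have "flags \<sigma>2 6 (insert u S')" using agree_arr[OF h, of 6] a1 by (auto simp: flags_def)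
          moreover have "hits r t (insert u S') ?U" using U(3) 1(1) by (auto simp: hits_def not_less)
          moreover have "card U' = card ?U + cnt r U' u"
          proof -
            have "U' = ?U \<union> {v\<in>U'. d u v \<le> r}" by auto
            then have "card U' = card (?U \<union> {v\<in>U'. d u v \<le> r})" by simp
            also have "\<dots> = card ?U + cnt r U' u" unfolding cnt_def using fin by (intro card_Un_disjoint) auto
            finally show ?thesis .
          qed
          then have "th * card (insert u S') + card ?U \<le> th * card S + card U"
            using U(5) False fin mult_le_mono2[of "card (insert u S')" "Suc (card S')" th] card_insert_le_m1
            by (simp add: card_insert_if split: if_splits)
          \<comment> \<open>Earlier counts can only have dropped, and the count of \<open>u\<close>
            itself is now 0.\<close>
          moreover have "\<forall>u'<Suc u. cnt r ?U u' < th"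
          proof (intro allI impI)
            fix u' assume "u' < Suc u"
            moreover have "cnt r ?U u' \<le> cnt r U' u'" using fin by (intro cnt_mono) auto
            moreover have "cnt r ?U u = 0" unfolding cnt_def by (auto simp: card_eq_0_iff)
            ultimately show "cnt r ?U u' < th" using U(6) s(8) by (cases "u' = u") (auto simp: less_Suc_eq intro: le_less_trans)
          qed
          moreover have "flags \<sigma>2 7 ?U" "t2 \<le> 2 + 4 * n" using e by auto
          ultimately show ?case using U(4) c(1) by (intro conjI exI[of _ ?U] exI[of _ "insert u S'"]) auto
        qed auto
        show ?thesis using False r1 s(9) cn 1(1) * by simp
      qed
    qed auto
  qed (use s n_le in \<open>auto simp: dmat_def flags_def algebra_simps\<close>)
qed

text \<open>The term \<open>2 * n * halvings th\<close> in the invariant is the budget of the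
  remaining passes for \<open>t * card S'\<close>. At threshold 0 the set \<open>U\<close> is empty,
  because each of its elements would be counted by itself.\<close>

lemma wp_greedy:
  assumes s: "dmat s" "reg s 11 = int r" "r \<le> n" "flags s 6 S" "S \<subseteq> {..<n}" "reg s 5 = int t" "t \<le> 8 * n"
    "\<forall>v<n. arr s a (int v) = int (card (ball r v))" "a \<noteq> 7"
  shows "wp w (greedy a) (\<lambda>T s'. T \<le> 4 + 4 * n + halvings n * (4 + n * (9 + 8 * n)) \<and> (\<exists>S'. flags s' 6 S' \<and>
     S \<subseteq> S' \<and> S' \<subseteq> {..<n} \<and> t * card S' \<le> t * card S + 2 * n * halvings n \<and>
     (\<forall>v<n. t \<le> card (ball r v) \<longrightarrow> (\<exists>s\<in>S'. d v s \<le> r)))) s"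
proof -
  let ?L = "{v. v < n \<and> t \<le> card (ball r v)}"
  have 1: "wp w (For 8 0 (IfC (Bin Less (Get a (Var 8)) (Var 5)) (Wr 7 (Var 8) (Lit 0)) (Wr 7 (Var 8) (Lit 1))))
     (\<lambda>T s'. T \<le> 2 + 4 * n \<and> flags s' 7 ?L) s"
  proof (rule wp_For_le[where I = "\<lambda>j \<sigma>. \<forall>v<j. arr \<sigma> 7 (int v) = of_bool (v \<in> ?L)"
        and \<tau> = "\<lambda>_. 2" and m = n and X = "{8}" and A = "{7}"], goal_cases)
    case (1 j \<sigma>)
    note g = 1(5)
    have "arr \<sigma> a = arr s a" "reg \<sigma> 5 = int t"
      using agree_reg[OF g] agree_arr[OF g] s by auto
    then show ?case
      using 1 s card_ball_le[of r j] by (auto simp: less_Suc_eq)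
  qed (use s n_le in \<open>auto simp: dmat_def flags_def\<close>)
  let ?c = "2 + n * (9 + 8 * n)"
  let ?I = "\<lambda>\<sigma>. \<exists>th U S'. reg \<sigma> 10 = int th \<and> th \<le> n \<and> flags \<sigma> 7 U \<and> flags \<sigma> 6 S' \<and> hits r t S' U \<and> S \<subseteq> S' \<and>
      t * card S' + 2 * n * halvings th \<le> t * card S + 2 * n * halvings n \<and> (\<forall>u<n. cnt r U u \<le> 2 * th)"
  let ?P = "\<lambda>\<sigma>. halvings (nat (reg \<sigma> 10)) * (4 + n * (9 + 8 * n))"
  show ?thesis
    unfolding greedy_def wp_simps(4) wp_simps(2)
  proof (rule wp_conseq_agree[OF 1, where X = "{8}" and A = "{7}"], goal_cases)
    case (1 t1 \<sigma>)
    note f = 1(2)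
    have d\<sigma>: "dmat \<sigma>" using dmat_agree[OF s(1) f] by simp
    have r\<sigma>: "reg \<sigma> 0 = int n" "reg \<sigma> 5 = int t" "reg \<sigma> 11 = int r" using agree_reg[OF f] s by (auto simp: dmat_def)
    have S\<sigma>: "flags \<sigma> 6 S" using flags_agree[OF s(4) f] by simp
    have "wp w (Wh (Var 10) (Sq pass (Asg 10 (Bin Div (Var 10) (Lit 2)))))
       (\<lambda>u s2. t1 + (1 + u) \<le> 4 + 4 * n + halvings n * (4 + n * (9 + 8 * n)) \<and>
          (\<exists>S'. flags s2 6 S' \<and> S \<subseteq> S' \<and> S' \<subseteq> {..<n} \<and> t * card S' \<le> t * card S + 2 * n * halvings n \<and>
          (\<forall>v<n. t \<le> card (ball r v) \<longrightarrow> (\<exists>s\<in>S'. d v s \<le> r))))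
       (setr 10 (int n) \<sigma>)"
    proof (rule wp_Wh[where I = ?I and \<Phi> = ?P], goal_cases)
      case 1
      have "hits r t S ?L" using s by (auto simp: hits_def)
      moreover have "cnt r ?L u \<le> 2 * n" for u
        using card_mono[of "{..<n}" "{v\<in>?L. d u v \<le> r}"] unfolding cnt_def by fastforce
      ultimately show ?case
        using \<open>t1 \<le> 2 + 4 * n \<and> flags \<sigma> 7 ?L\<close> S\<sigma> by (intro exI[of _ n] exI[of _ ?L] exI[of _ S]) auto
    next
      case (2 \<sigma>')
      then show ?case by auto
    next
      case (3 \<sigma>')
      then obtain th U S' where I: "reg \<sigma>' 10 = int th" "th \<le> n" "flags \<sigma>' 7 U" "flags \<sigma>' 6 S'" "hits r t S' U" "S \<subseteq> S'"
        "t * card S' + 2 * n * halvings th \<le> t * card S + 2 * n * halvings n" "\<forall>u<n. cnt r U u \<le> 2 * th" by blast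
      have th: "th > 0" using 3(3) I(1) by simp
      have g: "agree {7,8,9,10} {6,7} (setr 10 (int n) \<sigma>) \<sigma>'" using 3(2) by (auto simp: agree_def)
      have d': "dmat \<sigma>'" using dmat_agree[OF _ g] d\<sigma> by simp
      have r': "reg \<sigma>' 11 = int r" using agree_reg[OF g] r\<sigma> by simp
      show ?case unfolding wp_simps(4)
      proof (rule wp_conseq_agree[OF wp_pass[OF d' r' s(3) I(3,4,5,1) th I(2)], where X = "{7,8,9}" and A = "{6,7}"], goal_cases)
        case (1 t2 \<sigma>2)
        then obtain U2 S2 where J: "flags \<sigma>2 7 U2" "flags \<sigma>2 6 S2"
          "hits r t S2 U2" "S' \<subseteq> S2" "th * card S2 + card U2 \<le> th * card S' + card U" "\<forall>u<n. cnt r U2 u < th"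
          and t2: "t2 \<le> ?c" by blast
        have r10: "reg \<sigma>2 10 = int th" using agree_reg[OF 1(2)] I by simp
        have cS: "card S' \<le> card S2" using J(3,4) finite_subset card_mono by (metis finite_lessThan hits_def)
        have "th * (card S2 - card S') \<le> card U" using J(5) cS by (simp add: diff_mult_distrib2)
        then have "t * (card S2 - card S') \<le> 2 * n"
          using pass_bound[of U t r th] I(5,8) th by (auto simp: hits_def)
        then have "t * card S2 \<le> t * card S' + 2 * n" using cS by (simp add: diff_mult_distrib2)
        moreover have lgth: "halvings th = Suc (halvings (th div 2))" using th by (simp add: halvings.simps[of th])
        ultimately have "t * card S2 + 2 * n * halvings (th div 2) \<le> t * card S + 2 * n * halvings n"
          using I(7) by simp
        \<comment> \<open>Counts are at most \<open>th - 1\<close>, which does not exceed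
          \<open>2 * (th div 2)\<close> even for odd \<open>th\<close>.\<close>
        moreover have "\<forall>u<n. cnt r U2 u \<le> 2 * (th div 2)" using J(6) by fastforce
        moreover have "int th div 2 = int (th div 2)" by simp
        ultimately have "?I (setr 10 (int th div 2) \<sigma>2)"
          using J I(2,6) by (intro exI[of _ "th div 2"] exI[of _ U2] exI[of _ S2]) auto
        moreover have "nat (int th div 2) = th div 2" by (simp add: nat_div_distrib)
        moreover have "in_range w (int th div 2)" using I(2) \<open>int th div 2 = int (th div 2)\<close> by simp
        ultimately show ?case using r10 I(1,2) t2 lgth by (simp add: algebra_simps)
      qed auto
    next
      case (4 t2 \<sigma>2)
      then obtain U S' where I: "flags \<sigma>2 6 S'" "hits r t S' U" "S \<subseteq> S'"
        "t * card S' \<le> t * card S + 2 * n * halvings n" "\<forall>u<n. cnt r U u \<le> 0"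
        by (auto simp: halvings.simps[of 0])
      have "U = {}"
      proof (rule ccontr)
        assume "U \<noteq> {}"
        then obtain v where v: "v \<in> U" by blast
        then have "v < n" "finite U" using I(2) finite_subset by (auto simp: hits_def)
        with I(5) v self[of v] show False by (force simp: cnt_def)
      qed
      then have "\<forall>v<n. t \<le> card (ball r v) \<longrightarrow> (\<exists>s\<in>S'. d v s \<le> r)" "S' \<subseteq> {..<n}"
        using I(2) sym unfolding hits_def by (auto, metis lessThan_iff subsetD)
      moreover have "t1 + (1 + t2) \<le> 4 + 4 * n + halvings n * (4 + n * (9 + 8 * n))"
        using 4(4) \<open>t1 \<le> 2 + 4 * n \<and> flags \<sigma> 7 ?L\<close> by simp
      ultimately show ?case using I by blast
    qed
    then show ?case using r\<sigma> by simp
  qed auto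
qed

end

section \<open>Branching over centers\<close>

text \<open>A product of truth values acts as a conjunction. There is one factor per chosen center,
  so for fixed \<open>k\<close> the expression has constant size.\<close>

primrec farE :: "nat \<Rightarrow> exp" where
  "farE 0 = Lit 1"
| "farE (Suc j) = Bin Mul (farE j) (Bin Less (Var 21) (dist_at (30 + 2 * j) 8))"

definition build_step :: "nat \<Rightarrow> cmd" where
  "build_step j = IfC (farE j)
       (Sq (Wr 8 (Var 8) (Lit 1)) (Sq (Wr 9 (Var 20) (Var 8)) (Sq (inc 20)
         (IfC (Bin Less (Get 10 (Var 8)) (Var 5)) (Asg 19 (Var 8)) NOP))))
       (Wr 8 (Var 8) (Lit 0))"

text \<open>Register 19 ends as a vertex of \<open>U\<close> with a small ball of radius
  \<open>al\<close>, or as \<open>n\<close> if there is none. The later commands branch on this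
  value.\<close>

definition build :: "nat \<Rightarrow> cmd" where
  "build j = Sq (Asg 21 (Bin Add (Var 2) (Var 4))) (Sq (Asg 19 (Var 0)) (Sq (Asg 20 (Lit 0))
     (For 8 0 (build_step j))))"

definition near_U :: cmd where
  "near_U = Sq (Asg 23 (Lit 0)) (For 8 0 (IfC (Get 8 (Var 8))
     (IfC (Bin Less (Var 3) (dist_at 7 8)) NOP (Asg 23 (Lit 1))) NOP))"

text \<open>If no vertex of \<open>U\<close> has a small ball, the list in array 9 is replaced by
  the elements of \<open>S\<close> near \<open>U\<close>, and the radius of the check in register 21
  becomes \<open>R + al\<close>. Otherwise both remain as \<open>build\<close> left them.\<close>

definition branch :: cmd where
  "branch = IfC (Bin Less (Var 19) (Var 0)) NOP
     (Sq (Asg 21 (Bin Add (Var 2) (Var 3))) (Sq (Asg 20 (Lit 0))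
       (For 7 0 (IfC (Get 6 (Var 7))
         (Sq near_U (IfC (Var 23) (Sq (Wr 9 (Var 20) (Var 7)) (inc 20)) NOP)) NOP))))"

definition check_list :: cmd where
  "check_list = For 12 20 (Sq (Asg 18 (Get 9 (Var 12)))
     (IfC (Bin Less (Var 21) (dist_at 7 18)) (Asg 22 (Lit 0)) NOP))"

definition final :: cmd where
  "final = For 7 0 (Sq (Asg 22 (Lit 1)) (Sq
     (IfC (Bin Less (Var 19) (Var 0)) (IfC (Bin Less (Var 3) (dist_at 19 7)) (Asg 22 (Lit 0)) NOP) NOP)
     (IfC (Var 22) (Sq check_list (IfC (Var 22) (Asg 6 (Lit 1)) NOP)) NOP)))"

text \<open>For \<open>k = 1\<close> the value \<open>n\<close> in register 19 makes
  \<open>final\<close> compare all vertices with \<open>U\<close> itself. The check via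
  \<open>S\<close> would be too weak there, since \<open>al = R\<close> and
  \<open>\<rho> = 0\<close>.\<close>

definition leaf :: "nat \<Rightarrow> nat \<Rightarrow> cmd" where
  "leaf k j = Sq (build j) (Sq (if k = 1 then Asg 19 (Var 0) else branch) final)"

abbreviation radE :: "nat \<Rightarrow> bop \<Rightarrow> exp" where
  "radE j f \<equiv> Bin f (Var 4) (Bin Mul (Lit (2 * int j)) (Var 3))"

definition find_pivot :: "nat \<Rightarrow> cmd" where
  "find_pivot j = Sq (Asg 21 (radE j Add)) (Sq (Asg (31 + 2 * j) (Var 0))
     (For 8 0 (IfC (Bin Mul (farE j) (Bin Less (Get (11 + j) (Var 8)) (Var 5))) (Asg (31 + 2 * j) (Var 8)) NOP)))"

text \<open>The radius is computed anew for each vertex, as deeper levels overwrite register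
  21.\<close>

definition candidate :: "nat \<Rightarrow> cmd" where
  "candidate j = Sq (Asg 23 (Get 6 (Var (30 + 2 * j))))
     (IfC (Bin Less (Var (31 + 2 * j)) (Var 0))
       (IfC (Bin Less (radE j Sub) (dist_at (31 + 2 * j) (30 + 2 * j))) NOP (Asg 23 (Lit 1))) NOP)"

primrec level :: "nat \<Rightarrow> nat \<Rightarrow> nat \<Rightarrow> cmd" where
  "level k 0 j = leaf k j"
| "level k (Suc i) j = Sq (find_pivot j)
     (For (30 + 2 * j) 0 (Sq (candidate j) (IfC (Var 23) (level k i (Suc j)) NOP)))"

fun level_time :: "nat \<Rightarrow> nat \<Rightarrow> nat \<Rightarrow> nat" where
  "level_time n K 0 = 12 + 60 * n + 30 * (n + 1) * K"
| "level_time n K (Suc i) = 6 + 20 * n + K * level_time n K i"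

lemma search_frag_simps [simp]:
  "mod_regs (build_step j) = {19, 20}" "mod_arrs (build_step j) = {8, 9}"
  "mod_regs (build j) = {8, 19, 20, 21}" "mod_arrs (build j) = {8, 9}"
  "mod_regs near_U = {8, 23}" "mod_arrs near_U = {}"
  "mod_regs branch = {7, 8, 20, 21, 23}" "mod_arrs branch = {9}"
  "mod_regs check_list = {12, 18, 22}" "mod_arrs check_list = {}"
  "mod_regs final = {6, 7, 12, 18, 22}" "mod_arrs final = {}"
  by (auto simp: build_step_def build_def near_U_def branch_def check_list_def final_def)

text \<open>The cost of a loop whose body is expensive only where \<open>P\<close> holds: the
  recursion is multiplied by the number of candidates instead of \<open>n\<close>.\<close>

lemma sum_if_card:
  fixes a b :: nat
  shows "(\<Sum>i<n. a + (if P i then b else 0) + 2) = n * (a + 2) + card {i. i < n \<and> P i} * b"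
proof -
  have "{..<n} \<inter> {i. P i} = {i. i < n \<and> P i}" by auto
  then show ?thesis by (simp only: sum.distrib sum.If_cases finite_lessThan sum_constant card_lessThan) (simp add: algebra_simps)
qed

lemma pivot_frag_simps [simp]:
  "mod_regs (find_pivot j) = {8, 21, 31 + 2 * j}" "mod_arrs (find_pivot j) = {}"
  "mod_regs (candidate j) = {23}" "mod_arrs (candidate j) = {}"
  by (auto simp: find_pivot_def candidate_def)

lemma mod_regs_level: "mod_regs (level k i j) \<subseteq> {6, 7, 8, 12, 18, 19, 20, 21, 22, 23} \<union> {30 + 2 * j..}"
  and mod_arrs_level: "mod_arrs (level k i j) \<subseteq> {8, 9}"
proof -
  have "mod_regs (level k i j) \<subseteq> {6, 7, 8, 12, 18, 19, 20, 21, 22, 23} \<union> {30 + 2 * j..} \<and> mod_arrs (level k i j) \<subseteq> {8, 9}"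
  proof (induction i arbitrary: j)
    case 0
    then show ?case by (auto simp: leaf_def)
  next
    case (Suc i)
    have "{30 + 2 * Suc j..} \<subseteq> {30 + 2 * j..}" by auto
    with Suc[of "Suc j"] show ?case by fastforce
  qed
  then show "mod_regs (level k i j) \<subseteq> {6, 7, 8, 12, 18, 19, 20, 21, 22, 23} \<union> {30 + 2 * j..}" "mod_arrs (level k i j) \<subseteq> {8, 9}"
    by auto
qed

section \<open>Correctness and cost of the branching\<close>

locale search_machine = dist_machine w n d + search n d k R al \<rho> t S
  for w n d k R al \<rho> t S +
  assumes t_le: "t \<le> 8 * n" and k_lim: "2 * int k \<le> 2 ^ w"
begin

definition env :: "state \<Rightarrow> bool" where
  "env s \<longleftrightarrow> dmat s \<and> reg s 2 = int R \<and> reg s 3 = int al \<and> reg s 4 = int \<rho> \<and> reg s 5 = int t \<and>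
    flags s 6 S \<and> (\<forall>v<n. arr s 10 (int v) = int (card (ball al v))) \<and>
    (\<forall>j<k - 1. \<forall>v<n. arr s (11 + j) (int v) = int (card (ball (\<rho> - 2 * j * al) v)))"

definition xs_regs :: "state \<Rightarrow> nat list \<Rightarrow> bool" where
  "xs_regs s xs \<longleftrightarrow> set xs \<subseteq> {..<n} \<and> (\<forall>l<length xs. reg s (30 + 2 * l) = int (xs ! l))"

definition stores_list :: "state \<Rightarrow> nat list \<Rightarrow> bool" where
  "stores_list s ys \<longleftrightarrow> reg s 20 = int (length ys) \<and> (\<forall>i<length ys. arr s 9 (int i) = int (ys ! i))"

lemma env_agree: "env s \<Longrightarrow> agree X A s s' \<Longrightarrow> {0,2,3,4,5} \<inter> X = {} \<Longrightarrow> A \<subseteq> {8,9} \<Longrightarrow> env s'"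
proof -
  assume e: "env s" and f: "agree X A s s'" and X: "{0,2,3,4,5} \<inter> X = {}" and A: "A \<subseteq> {8,9}"
  have r: "reg s' x = reg s x" if "x \<in> {0,2,3,4,5}" for x using agree_reg[OF f] X that by blast
  have a: "arr s' a = arr s a" if "a \<noteq> 8" "a \<noteq> 9" for a using agree_arr[OF f] A that by blast
  show "env s'" using e r a by (simp add: env_def dmat_def flags_def)
qed

lemma env_dmat: "env s \<Longrightarrow> dmat s" by (simp add: env_def)

lemma env_setr [simp]: "x > 5 \<Longrightarrow> env (setr x v s) \<longleftrightarrow> env s"
  by (simp add: env_def)

lemma xs_regs_setr [simp]: "x < 30 \<Longrightarrow> xs_regs (setr x v s) xs \<longleftrightarrow> xs_regs s xs"
  by (simp add: xs_regs_def)

lemma stores_list_setr [simp]: "x \<noteq> 20 \<Longrightarrow> stores_list (setr x v s) ys \<longleftrightarrow> stores_list s ys"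
  by (simp add: stores_list_def)

lemma xs_regs_agree: "xs_regs s xs \<Longrightarrow> agree X A s s' \<Longrightarrow> X \<subseteq> {..<30} \<union> {30 + 2 * length xs..} \<Longrightarrow> xs_regs s' xs"
proof -
  assume x: "xs_regs s xs" and f: "agree X A s s'" and X: "X \<subseteq> {..<30} \<union> {30 + 2 * length xs..}"
  have "reg s' (30 + 2 * l) = reg s (30 + 2 * l)" if "l < length xs" for l
    by (rule agree_reg[OF f]) (use X that in auto)
  then show "xs_regs s' xs" using x by (simp add: xs_regs_def)
qed

lemma al_le: "al \<le> n" "\<rho> \<le> n" using R by auto

lemma farE_ev:
  assumes "dmat s" "xs_regs s xs" "reg s 8 = int v" "v < n" "reg s 21 = int r" "r \<le> 8 * n"
  shows "ev s (farE (length xs)) = of_bool (far xs r v)" "safe w s (farE (length xs))"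
proof -
  have "ev s (farE j) = of_bool (far (take j xs) r v) \<and> safe w s (farE j)" if "j \<le> length xs" for j
    using that
  proof (induction j)
    case 0
    then show ?case by (simp add: far_def)
  next
    case (Suc j)
    then have "xs ! j \<in> set xs" by simp
    then have x: "xs ! j < n" using assms(2) by (auto simp: xs_regs_def)
    then show ?case using Suc assms in_range_d[of "xs ! j" v]
      by (simp add: far_def take_Suc_conv_app_nth xs_regs_def dmat_def flip: of_bool_conj)
        (auto simp: of_bool_def)
  qed
  from this[of "length xs"] show "ev s (farE (length xs)) = of_bool (far xs r v)" "safe w s (farE (length xs))"
    by auto
qed

lemma length_filter_upt: "length (filter P [0..<i]) \<le> i"
  using length_filter_le[of P "[0..<i]"] by simp

lemma stores_list_append:
  assumes "stores_list s ys"
  shows "stores_list (setr 20 (reg s 20 + 1) (seta 9 (reg s 20) (int x) s)) (ys @ [x])"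
  using assms by (auto simp: stores_list_def nth_append less_Suc_eq)

lemma wp_build:
  assumes s: "env s" "xs_regs s xs"
  shows "wp w (build (length xs)) (\<lambda>T s'. T \<le> 5 + 8 * n \<and> flags s' 8 {v. v < n \<and> far xs (R + \<rho>) v} \<and>
     stores_list s' (filter (far xs (R + \<rho>)) [0..<n]) \<and> reg s' 21 = int (R + \<rho>) \<and>
     ((reg s' 19 = int n \<and> (\<forall>v<n. far xs (R + \<rho>) v \<longrightarrow> t \<le> card (ball al v))) \<or>
      (\<exists>v<n. reg s' 19 = int v \<and> far xs (R + \<rho>) v \<and> card (ball al v) < t))) s"
proof -
  let ?f = "far xs (R + \<rho>)"
  let ?s = "setr 20 0 (setr 19 (int n) (setr 21 (int R + int \<rho>) s))"
  let ?I = "\<lambda>i \<sigma>. (\<forall>v<i. arr \<sigma> 8 (int v) = of_bool (?f v)) \<and> stores_list \<sigma> (filter ?f [0..<i]) \<and>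
     ((reg \<sigma> 19 = int n \<and> (\<forall>v<i. far xs (R + \<rho>) v \<longrightarrow> t \<le> card (ball al v))) \<or>
      (\<exists>v<n. reg \<sigma> 19 = int v \<and> far xs (R + \<rho>) v \<and> card (ball al v) < t))"
  have Rn: "R + \<rho> \<le> 8 * n" using R by simp
  have *: "wp w (For 8 0 (build_step (length xs)))
     (\<lambda>T s'. T \<le> 2 + 8 * n \<and> ?I n s' \<and> reg s' 21 = int (R + \<rho>)) ?s"
  proof (rule wp_For_le[where I = ?I and \<tau> = "\<lambda>_. 6" and m = n and X = "{8,19,20}" and A = "{8,9}"], goal_cases)
    case (1 i \<sigma>)
    note f = 1(5)
    have e: "env \<sigma>" using env_agree[OF _ f] s by simp
    have x: "xs_regs \<sigma> xs" using xs_regs_agree[OF _ f] s by simp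
    have 21: "reg \<sigma> 21 = int (R + \<rho>)" using agree_reg[OF f] by simp
    note F = farE_ev[OF env_dmat[OF e] x 1(2,1) 21 Rn]
    have l: "length (filter ?f [0..<i]) \<le> n" using length_filter_upt[of ?f i] 1(1) by simp
    show ?case
    proof (cases "?f i")
      case False
      then have "?I (Suc i) (setr 8 (int (Suc i)) (seta 8 (int i) 0 \<sigma>))"
        using 1 by (auto simp: less_Suc_eq stores_list_def)
      then show ?thesis using False F 1 by (simp add: build_step_def)
    next
      case True
      let ?s1 = "seta 9 (reg \<sigma> 20) (int i) (seta 8 (int i) 1 \<sigma>)"
      let ?s2 = "setr 20 (reg \<sigma> 20 + 1) ?s1"
      have "stores_list (seta 8 (int i) 1 \<sigma>) (filter ?f [0..<i])" using 1(4) by (auto simp: stores_list_def)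
      from stores_list_append[OF this, of i] True have E: "stores_list ?s2 (filter ?f [0..<Suc i])" by simp
      have F8: "\<forall>v<Suc i. arr ?s2 8 (int v) = of_bool (?f v)" using 1(4) True by (auto simp: less_Suc_eq)
      have c: "arr \<sigma> 10 (int i) = int (card (ball al i))" "reg \<sigma> 5 = int t" using e 1(1) by (auto simp: env_def)
      have r20: "reg \<sigma> 20 = int (length (filter ?f [0..<i]))" using 1(4) by (simp add: stores_list_def)
      show ?thesis
      proof (cases "card (ball al i) < t")
        case T2: True
        have "?I (Suc i) (setr 8 (int (Suc i)) (setr 19 (int i) ?s2))"
          using E F8 1(1) True T2 by auto
        then show ?thesis using True T2 F 1(1,2) c r20 l t_le card_ball_le[of al i] by (simp add: build_step_def)
      next
        case F2: False
        have "?I (Suc i) (setr 8 (int (Suc i)) ?s2)"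
          using E F8 1(4) True F2 by (auto simp: less_Suc_eq)
        then show ?thesis using True F2 F 1(1,2) c r20 l t_le card_ball_le[of al i] by (simp add: build_step_def)
      qed
    qed
  next
    case (2 T \<sigma>)
    then show ?case using agree_reg[OF 2(3)] by auto
  qed (use s n_le in \<open>auto simp: env_def dmat_def stores_list_def\<close>)
  have r: "reg s 2 = int R" "reg s 4 = int \<rho>" "reg s 0 = int n" using s by (auto simp: env_def dmat_def)
  have "int R + int \<rho> = int (R + \<rho>)" by simp
  then have iR: "in_range w (int R + int \<rho>)" using Rn in_range_le(1) by presburger
  have "wp w (For 8 0 (build_step (length xs))) (\<lambda>T s'. 1 + (1 + (1 + T)) \<le> 5 + 8 * n \<and> flags s' 8 {v. v < n \<and> far xs (R + \<rho>) v} \<and>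
     stores_list s' (filter (far xs (R + \<rho>)) [0..<n]) \<and> reg s' 21 = int (R + \<rho>) \<and>
     ((reg s' 19 = int n \<and> (\<forall>v<n. far xs (R + \<rho>) v \<longrightarrow> t \<le> card (ball al v))) \<or>
      (\<exists>v<n. reg s' 19 = int v \<and> far xs (R + \<rho>) v \<and> card (ball al v) < t))) ?s"
    by (rule wp_conseq[OF *]) (auto simp: flags_def)
  then show ?thesis unfolding build_def wp_simps(4) wp_simps(2) using r iR R(2) al_le by simp
qed

lemma wp_near_U:
  assumes s: "env s" "flags s 8 U" "U \<subseteq> {..<n}" "reg s 7 = int u" "u < n"
  shows "wp w near_U (\<lambda>T s'. T \<le> 3 + 5 * n \<and> reg s' 23 = of_bool (\<exists>v\<in>U. d u v \<le> al)) s"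
  unfolding near_U_def wp_simps(4) wp_simps(2)
proof (intro conjI, simp, simp only: ev.simps, rule wp_For_le[where I = "\<lambda>j \<sigma>. reg \<sigma> 23 = of_bool (\<exists>v\<in>U. v < j \<and> d u v \<le> al)"
        and \<tau> = "\<lambda>_. 3" and m = n and X = "{8,23}" and A = "{}"], goal_cases)
  case (1 j \<sigma>)
  note g = 1(5)
  have "env \<sigma>" using env_agree[OF _ g] s by auto
  moreover have "reg \<sigma> 7 = int u" "arr \<sigma> 8 (int j) = of_bool (j \<in> U)"
    using agree_reg[OF g] agree_arr[OF g] s 1(1) by (auto simp: flags_def)
  ultimately show ?case
    using 1 s(5) in_range_d[of u j] al_le
    by (auto simp: env_def dmat_def less_Suc_eq not_less intro!: arg_cong[of _ _ "of_bool :: bool \<Rightarrow> int"])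
next
  case (2 T \<sigma>)
  have "(\<exists>v\<in>U. v < n \<and> d u v \<le> al) = (\<exists>v\<in>U. d u v \<le> al)" using s(3) by auto
  then show ?case using 2 by simp
qed (use s n_le in \<open>auto simp: env_def dmat_def\<close>)


lemma in_range_R_plus_al: "in_range w (int R + int al)"
proof -
  have "R + al \<le> 8 * n" using R(2) al_le by simp
  from in_range_le(1)[OF this] show ?thesis by simp
qed

lemma S_fin: "finite S" using S finite_subset by blast

lemma wp_branch_loop:
  assumes s: "env s" "flags s 8 U" "U \<subseteq> {..<n}" "reg s 20 = 0"
  shows "wp w (For 7 0 (IfC (Get 6 (Var 7))
         (Sq near_U (IfC (Var 23) (Sq (Wr 9 (Var 20) (Var 7)) (inc 20)) NOP)) NOP))
    (\<lambda>T s'. T \<le> 2 + 4 * n + card S * (6 + 5 * n) \<and>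
      stores_list s' (filter (\<lambda>u. u \<in> S \<and> (\<exists>v\<in>U. d u v \<le> al)) [0..<n])) s"
proof (rule wp_For_le[where I = "\<lambda>j \<sigma>. stores_list \<sigma> (filter (\<lambda>u. u \<in> S \<and> (\<exists>v\<in>U. d u v \<le> al)) [0..<j])"
      and \<tau> = "\<lambda>j. 2 + (if j \<in> S then 6 + 5 * n else 0)" and m = n and X = "{7,8,20,23}" and A = "{9}"], goal_cases)
  case (1 u \<sigma>)
  note f = 1(5)
  let ?P = "\<lambda>u. u \<in> S \<and> (\<exists>v\<in>U. d u v \<le> al)"
  have e: "env \<sigma>" using env_agree[OF s(1) f] by simp
  have U: "flags \<sigma> 8 U" using flags_agree[OF s(2) f] by simp
  have S6: "arr \<sigma> 6 (int u) = of_bool (u \<in> S)" using e 1(1) by (simp add: env_def flags_def)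
  have l: "length (filter ?P [0..<u]) \<le> n" using length_filter_upt[of ?P u] 1(1) by simp
  show ?case
  proof (cases "u \<in> S")
    case False
    then show ?thesis using 1 S6 by simp
  next
    case True
    have "wp w near_U (\<lambda>T \<sigma>1. wp w (IfC (Var 23) (Sq (Wr 9 (Var 20) (Var 7)) (inc 20)) NOP)
        (\<lambda>T2 \<sigma>2. Suc (T + T2) \<le> 2 + (6 + 5 * n) \<and> stores_list (setr 7 (int (Suc u)) \<sigma>2) (filter ?P [0..<Suc u])) \<sigma>1) \<sigma>"
    proof (rule wp_conseq_agree[OF wp_near_U[OF e U s(3) 1(2,1)], where X = "{8,23}" and A = "{}"], goal_cases)
      case c: (1 T \<sigma>1)
      note g = c(2)
      have E: "stores_list \<sigma>1 (filter ?P [0..<u])" using 1(4) agree_reg[OF g] agree_arr[OF g] by (simp add: stores_list_def)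
      have r7: "reg \<sigma>1 7 = int u" using agree_reg[OF g] 1(2) by simp
      have r20: "reg \<sigma>1 20 = int (length (filter ?P [0..<u]))" using E by (simp add: stores_list_def)
      show ?case
      proof (cases "\<exists>v\<in>U. d u v \<le> al")
        case T2: True
        have "stores_list (setr 20 (reg \<sigma>1 20 + 1) (seta 9 (reg \<sigma>1 20) (int u) \<sigma>1)) (filter ?P [0..<Suc u])"
          using stores_list_append[OF E, of u] T2 True by simp
        then show ?thesis using c(1) T2 r7 r20 l 1(1) by simp
      next
        case F2: False
        then show ?thesis using c(1) E by simp
      qed
    qed auto
    then show ?thesis using True 1(1,2) S6 by simp
  qed
next
  case (2 T \<sigma>)
  have "{i. i < n \<and> i \<in> S} = S" using S by auto
  then have "(\<Sum>i<n. 2 + (if i \<in> S then 6 + 5 * n else 0) + 2) = n * 4 + card S * (6 + 5 * n)"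
    using sum_if_card[of 2 "\<lambda>i. i \<in> S" "6 + 5 * n" n] by (simp only: numeral_plus_numeral) simp
  then show ?case using 2 by simp
qed (use s n_le in \<open>auto simp: env_def dmat_def stores_list_def\<close>)

lemma wp_branch:
  assumes s: "env s" "flags s 8 U" "U \<subseteq> {..<n}" "stores_list s ys" "reg s 21 = int (R + \<rho>)" "reg s 19 = int vs" "vs \<le> n"
  shows "wp w branch (\<lambda>T s'. T \<le> 5 + 4 * n + card S * (6 + 5 * n) \<and>
     (if vs < n then stores_list s' ys \<and> reg s' 21 = int (R + \<rho>)
      else stores_list s' (filter (\<lambda>u. u \<in> S \<and> (\<exists>v\<in>U. d u v \<le> al)) [0..<n]) \<and> reg s' 21 = int (R + al))) s"
proof (cases "vs < n")
  case True
  then show ?thesis unfolding branch_def using s by (simp add: env_def dmat_def)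
next
  case False
  let ?s = "setr 20 0 (setr 21 (int R + int al) s)"
  have "wp w (For 7 0 (IfC (Get 6 (Var 7))
         (Sq near_U (IfC (Var 23) (Sq (Wr 9 (Var 20) (Var 7)) (inc 20)) NOP)) NOP))
    (\<lambda>T s'. Suc (1 + (1 + T)) \<le> 5 + 4 * n + card S * (6 + 5 * n) \<and>
      stores_list s' (filter (\<lambda>u. u \<in> S \<and> (\<exists>v\<in>U. d u v \<le> al)) [0..<n]) \<and> reg s' 21 = int (R + al)) ?s"
  proof (rule wp_conseq_agree[OF wp_branch_loop[of ?s U], where X = "{7,8,20,23}" and A = "{9}"], goal_cases)
    case (5 T s')
    then show ?case using agree_reg[OF 5(2), of 21] by simp
  qed (use s in auto)
  then show ?thesis unfolding branch_def using s False in_range_R_plus_al R(2) al_le by (simp add: env_def dmat_def)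
qed

lemma wp_check_list:
  assumes s: "env s" "stores_list s ys" "set ys \<subseteq> {..<n}" "length ys \<le> n" "reg s 21 = int r" "r \<le> 8 * n"
    "reg s 7 = int c" "c < n" "reg s 22 = 1"
  shows "wp w check_list (\<lambda>T s'. T \<le> 2 + 5 * length ys \<and> reg s' 22 = of_bool (\<forall>y\<in>set ys. d c y \<le> r)) s"
  unfolding check_list_def
proof (rule wp_For_le[where I = "\<lambda>j \<sigma>. reg \<sigma> 22 = of_bool (\<forall>y\<in>set (take j ys). d c y \<le> r)"
      and \<tau> = "\<lambda>_. 3" and m = "length ys" and X = "{12,18,22}" and A = "{}"], goal_cases)
  case (1 j \<sigma>)
  note g = 1(5)
  have e: "env \<sigma>" using env_agree[OF s(1) g] by simp
  have y: "ys ! j < n" using s(3) 1(1) nth_mem by blast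
  have "arr \<sigma> 9 (int j) = int (ys ! j)" "reg \<sigma> 21 = int r" "reg \<sigma> 7 = int c"
    using agree_reg[OF g] agree_arr[OF g] s 1(1) by (auto simp: stores_list_def)
  moreover have "j \<le> 8 * n" using 1(1) s(4) by simp
  ultimately show ?case
    using 1 s(6,8) in_range_d[of c "ys ! j"] y e
    by (auto simp: env_def dmat_def take_Suc_conv_app_nth)
next
  case 9
  have "n \<le> 8 * (n + 1) * (n + 1)" by simp
  then show ?case using s(4) by linarith
qed (use s in \<open>auto simp: env_def dmat_def stores_list_def\<close>)

lemma wp_final:
  assumes s: "env s" "stores_list s ys" "set ys \<subseteq> {..<n}" "length ys \<le> n" "reg s 21 = int r" "r \<le> 8 * n"
    "reg s 19 = int vs" "vs \<le> n" "reg s 6 = of_bool out"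
  defines "P \<equiv> \<lambda>c. vs < n \<longrightarrow> d vs c \<le> al"
  shows "wp w final (\<lambda>T s'. T \<le> 2 + 8 * n + card {c. c < n \<and> P c} * (4 + 5 * length ys) \<and>
     reg s' 6 = of_bool (out \<or> (\<exists>c<n. P c \<and> (\<forall>y\<in>set ys. d c y \<le> r)))) s"
  unfolding final_def
proof (rule wp_For_le[where I = "\<lambda>j \<sigma>. reg \<sigma> 6 = of_bool (out \<or> (\<exists>c<j. P c \<and> (\<forall>y\<in>set ys. d c y \<le> r)))"
      and \<tau> = "\<lambda>c. 6 + (if P c then 4 + 5 * length ys else 0)" and m = n and X = "{6,7,12,18,22}" and A = "{}"], goal_cases)
  case (1 c \<sigma>)
  note f = 1(5)
  have e: "env \<sigma>" using env_agree[OF s(1) f] by simp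
  have r: "reg \<sigma> 19 = int vs" "reg \<sigma> 21 = int r" "reg \<sigma> 3 = int al" "stores_list \<sigma> ys"
    using agree_reg[OF f] agree_arr[OF f] s e by (auto simp: stores_list_def env_def)
  show ?case
  proof (cases "P c")
    case False
    then have F: "vs < n" "\<not> d vs c \<le> al" by (auto simp: P_def)
    have "(\<exists>c'<Suc c. P c' \<and> (\<forall>y\<in>set ys. d c' y \<le> r)) = (\<exists>c'<c. P c' \<and> (\<forall>y\<in>set ys. d c' y \<le> r))"
      using False by (auto simp: less_Suc_eq)
    then show ?thesis using 1(1-4) F False r e in_range_d[of vs c] al_le
      by (simp add: env_def dmat_def)
  next
    case True
    let ?s = "setr 22 1 \<sigma>"
    have "wp w check_list (\<lambda>T s'. T \<le> 2 + 5 * length ys \<and> reg s' 22 = of_bool (\<forall>y\<in>set ys. d c y \<le> r)) ?s"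
      by (rule wp_check_list) (use e r s 1 in auto)
    then have *: "wp w check_list (\<lambda>T s'. T \<le> 2 + 5 * length ys \<and> reg s' 22 = of_bool (\<forall>y\<in>set ys. d c y \<le> r) \<and>
        reg s' 6 = reg \<sigma> 6) ?s"
    proof (rule wp_conseq, goal_cases)
      case (1 T s')
      then show ?case using agree_reg[OF 1(2), of 6] by simp
    qed
    have "wp w check_list (\<lambda>T s'. wp w (IfC (Var 22) (Asg 6 (Lit 1)) NOP) (\<lambda>T2 s2.
        1 + (3 + Suc (T + T2)) \<le> 6 + (4 + 5 * length ys) \<and>
        reg s2 6 = of_bool (out \<or> (\<exists>c'<Suc c. P c' \<and> (\<forall>y\<in>set ys. d c' y \<le> r)))) s') ?s"
      by (rule wp_conseq[OF *]) (use 1(4) True in \<open>auto simp: less_Suc_eq\<close>)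
    \<comment> \<open>The two ways to reach \<open>check_list\<close> take 3 and 2 ticks, and both
      stay within the bound for 3.\<close>
    then have **: "wp w check_list (\<lambda>T s'. wp w (IfC (Var 22) (Asg 6 (Lit 1)) NOP) (\<lambda>T2 s2.
        1 + (tt + Suc (T + T2)) \<le> 6 + (4 + 5 * length ys) \<and>
        reg s2 6 = of_bool (out \<or> (\<exists>c'<Suc c. P c' \<and> (\<forall>y\<in>set ys. d c' y \<le> r)))) s') ?s" if "tt \<le> 3" for tt
      by (rule wp_conseq) (use that in auto)
    show ?thesis
    proof (cases "vs < n")
      case v: True
      then have "d vs c \<le> al" using True P_def by simp
      then show ?thesis using 1(1,2) True v r e in_range_d[of vs c] al_le **[of 3]
        by (simp add: env_def dmat_def)
    next
      case v: False
      then have "vs = n" using s(8) by simp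
      then show ?thesis using 1(1,2) True r e **[of 2] by (simp add: env_def dmat_def)
    qed
  qed
next
  case (2 T \<sigma>)
  have "(\<Sum>i<n. 6 + (if P i then 4 + 5 * length ys else 0) + 2) = n * 8 + card {c. c < n \<and> P c} * (4 + 5 * length ys)"
    using sum_if_card[of 6 P "4 + 5 * length ys" n] by (simp only: numeral_plus_numeral) simp
  then show ?case using 2 by simp
qed (use s n_le in \<open>auto simp: env_def dmat_def\<close>)


definition covers :: "nat list \<Rightarrow> bool" where
  "covers ys \<longleftrightarrow> set ys \<subseteq> {..<n} \<and> (\<forall>v<n. \<not> far ys (R + \<rho>) v)"

lemma covers_snoc:
  "set xs \<subseteq> {..<n} \<Longrightarrow> c < n \<Longrightarrow> (\<forall>v<n. far xs (R + \<rho>) v \<longrightarrow> d c v \<le> R + \<rho>) \<Longrightarrow> covers (xs @ [c])"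
  by (auto simp: covers_def far_def)

text \<open>Success is implied by \<open>good 0 xs\<close>, but a newly set flag is always backed by
  an actual cover, whether or not \<open>xs\<close> was good.\<close>

lemma wp_leaf:
  assumes s: "env s" "xs_regs s xs" "Suc (length xs) = k" "reg s 6 = of_bool out"
    and K: "card S + t \<le> K" "k = 1 \<Longrightarrow> n \<le> K"
  shows "wp w (leaf k (length xs)) (\<lambda>T s'. T \<le> 12 + 60 * n + 30 * (n + 1) * K \<and>
    (\<exists>out'. reg s' 6 = of_bool out' \<and> (out \<longrightarrow> out') \<and> (good 0 xs \<longrightarrow> out') \<and>
      (out' \<longrightarrow> out \<or> (\<exists>ys. length ys = k \<and> covers ys)))) s"
proof -
  let ?f = "far xs (R + \<rho>)"
  let ?U = "{v. v < n \<and> ?f v}"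
  let ?Lu = "filter ?f [0..<n]"
  let ?Q = "\<lambda>T s'. T \<le> 12 + 60 * n + 30 * (n + 1) * K \<and>
    (\<exists>out'. reg s' 6 = of_bool out' \<and> (out \<longrightarrow> out') \<and> (good 0 xs \<longrightarrow> out') \<and>
      (out' \<longrightarrow> out \<or> (\<exists>ys. length ys = k \<and> covers ys)))"
  have xs: "set xs \<subseteq> {..<n}" using s by (simp add: xs_regs_def)
  have Lu: "set ?Lu = ?U" "length ?Lu \<le> n" using length_filter_upt by auto
  have Rn: "R + \<rho> \<le> 8 * n" "R + al \<le> 8 * n" using R(2) al_le by auto
  \<comment> \<open>The three cases differ in the list and the candidates, and each makes about
    \<open>n * K\<close> comparisons: all \<open>n\<close> vertices against \<open>U\<close> with
    \<open>n \<le> K\<close> if \<open>k = 1\<close>, fewer than \<open>t\<close> candidates against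
    \<open>U\<close>, or all vertices against at most \<open>card S\<close> elements.\<close>
  have fin: "wp w final (\<lambda>T3. ?Q (T1 + (T2 + T3))) \<sigma>"
    if e: "env \<sigma>" "stores_list \<sigma> ys" "set ys \<subseteq> {..<n}" "length ys \<le> n" "reg \<sigma> 21 = int r" "r \<le> 8 * n"
      "reg \<sigma> 19 = int vs" "vs \<le> n" "reg \<sigma> 6 = of_bool out"
      and g: "good 0 xs \<Longrightarrow> \<exists>c<n. (vs < n \<longrightarrow> d vs c \<le> al) \<and> (\<forall>y\<in>set ys. d c y \<le> r)"
      and snd: "\<And>c. c < n \<Longrightarrow> (\<forall>y\<in>set ys. d c y \<le> r) \<Longrightarrow> (\<forall>v<n. ?f v \<longrightarrow> d c v \<le> R + \<rho>)"
      and T: "T1 \<le> 5 + 8 * n" "T2 \<le> 5 + 4 * n + card S * (6 + 5 * n)"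
      and c: "card {c. c < n \<and> (vs < n \<longrightarrow> d vs c \<le> al)} * (4 + 5 * length ys) \<le> (4 + 5 * n) * K + 4 * n"
    for \<sigma> ys r vs T1 T2
  proof (rule wp_conseq[OF wp_final[OF e]], goal_cases)
    case (1 T3 s')
    have "card S * (6 + 5 * n) \<le> K * (6 + 5 * n)" using K(1) by (intro mult_right_mono) auto
    then have "T1 + (T2 + T3) \<le> 12 + 60 * n + 30 * (n + 1) * K"
      using 1(1) T c by (simp add: algebra_simps)
    moreover have "\<exists>ys. length ys = k \<and> covers ys"
      if c: "c < n" "\<forall>y\<in>set ys. d c y \<le> r" for c
      using covers_snoc[OF xs c(1) snd[OF c]] s(3) by (intro exI[of _ "xs @ [c]"]) auto
    ultimately show ?case using 1(1) g
      by (intro conjI exI[of _ "out \<or> (\<exists>c<n. (vs < n \<longrightarrow> d vs c \<le> al) \<and> (\<forall>y\<in>set ys. d c y \<le> r))"]) auto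
  qed
  show ?thesis
    unfolding leaf_def wp_simps(4)
  proof (rule wp_conseq_agree[OF wp_build[OF s(1,2)], where X = "{8,19,20,21}" and A = "{8,9}"], goal_cases)
    case (1 T1 \<sigma>)
    note f = 1(2)
    have e: "env \<sigma>" using env_agree[OF s(1) f] by simp
    have o: "reg \<sigma> 6 = of_bool out" using agree_reg[OF f] s(4) by simp
    from 1 have b: "T1 \<le> 5 + 8 * n" "flags \<sigma> 8 ?U" "stores_list \<sigma> ?Lu" "reg \<sigma> 21 = int (R + \<rho>)" by auto
    show ?case
    proof (cases "k = 1")
      case True
      have r0: "reg \<sigma> 0 = int n" using e by (simp add: env_def dmat_def)
      have W: "wp w final (\<lambda>T3. ?Q (T1 + (1 + T3))) (setr 19 (int n) \<sigma>)"
      proof (rule fin[of _ ?Lu "R + \<rho>" n])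
        assume "good 0 xs"
        from good_0[OF this s(3)] show "\<exists>c<n. (n < n \<longrightarrow> d n c \<le> al) \<and> (\<forall>y\<in>set ?Lu. d c y \<le> R + \<rho>)"
          using Lu by (auto intro: trans_le_add1)
      next
        show "card {c. c < n \<and> (n < n \<longrightarrow> d n c \<le> al)} * (4 + 5 * length ?Lu) \<le> (4 + 5 * n) * K + 4 * n"
        proof -
          have "n * (4 + 5 * length ?Lu) \<le> K * (4 + 5 * n)" using K(2)[OF True] Lu(2) by (intro mult_mono) auto
          then show ?thesis by (simp add: mult.commute)
        qed
      qed (use e o b Lu Rn in auto)
      show ?thesis unfolding if_P[OF True] wp_simps(2) ev.simps safe.simps r0
        by (intro conjI, simp) (rule W)
    next
      case False
      then have k2: "k \<ge> 2" using k by simp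
      from 1(1) obtain vs where vs: "vs \<le> n" "reg \<sigma> 19 = int vs"
        "vs < n \<Longrightarrow> ?f vs \<and> card (ball al vs) < t"
        "\<not> vs < n \<Longrightarrow> (\<forall>v<n. ?f v \<longrightarrow> t \<le> card (ball al v))" by force
      have "wp w branch (\<lambda>T2. wp w final (\<lambda>T3. ?Q (T1 + (T2 + T3)))) \<sigma>"
      proof (rule wp_conseq_agree[OF wp_branch[OF e b(2) _ b(3,4) vs(2,1)], where X = "{7,8,20,21,23}" and A = "{9}"], goal_cases)
        case (2 T2 \<sigma>2)
        note h = 2(2)
        have e2: "env \<sigma>2" using env_agree[OF e h] by simp
        have o2: "reg \<sigma>2 6 = of_bool out" "reg \<sigma>2 19 = int vs" using agree_reg[OF h] o vs by auto
        show ?case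
        proof (cases "vs < n")
          case True
          show ?thesis
          proof (rule fin[of _ ?Lu "R + \<rho>" vs])
            assume "good 0 xs"
            from good_0[OF this s(3)] obtain c where "c < n" "\<forall>v<n. ?f v \<longrightarrow> d c v \<le> R" by blast
            from last_small[OF this True] vs(3)[OF True] obtain x where
              "x \<in> ball al vs" "\<forall>u<n. ?f u \<longrightarrow> d x u \<le> R + \<rho>" by blast
            then show "\<exists>c<n. (vs < n \<longrightarrow> d vs c \<le> al) \<and> (\<forall>y\<in>set ?Lu. d c y \<le> R + \<rho>)"
              using Lu by (auto simp: ball_def)
          next
            show "card {c. c < n \<and> (vs < n \<longrightarrow> d vs c \<le> al)} * (4 + 5 * length ?Lu) \<le> (4 + 5 * n) * K + 4 * n"
            proof -
              have "card {c. c < n \<and> (vs < n \<longrightarrow> d vs c \<le> al)} = card (ball al vs)" using True by (simp add: ball_def)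
              then have "card {c. c < n \<and> (vs < n \<longrightarrow> d vs c \<le> al)} * (4 + 5 * length ?Lu) \<le> K * (4 + 5 * n)"
                using vs(3)[OF True] K Lu(2) by (intro mult_mono) auto
              then show ?thesis by (simp add: mult.commute)
            qed
          qed (use e2 o2 2(1) b Lu Rn True vs in auto)
        next
          case F: False
          let ?P = "\<lambda>u. u \<in> S \<and> (\<exists>v\<in>?U. d u v \<le> al)"
          let ?L = "filter ?P [0..<n]"
          have L: "set ?L = {u\<in>S. \<exists>v\<in>?U. d u v \<le> al}" using S by auto
          have lL: "length ?L \<le> card S"
            using distinct_card[of ?L] card_mono[OF S_fin, of "set ?L"] by fastforce
          have lL2: "length ?L \<le> n" using length_filter_upt by blast
          show ?thesis
          proof (rule fin[of _ ?L "R + al" vs])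
            assume "good 0 xs"
            from good_0[OF this s(3)] obtain c where c: "c < n" "\<forall>v<n. ?f v \<longrightarrow> d c v \<le> R" by blast
            then show "\<exists>c<n. (vs < n \<longrightarrow> d vs c \<le> al) \<and> (\<forall>y\<in>set ?L. d c y \<le> R + al)"
              using F last_large_complete[OF c] by auto
          next
            fix c assume c: "c < n" "\<forall>y\<in>set ?L. d c y \<le> R + al"
            have "\<forall>s\<in>S. (\<exists>v<n. ?f v \<and> d s v \<le> al) \<longrightarrow> d c s \<le> R + al"
              using c(2) unfolding L by blast
            from last_large_sound[OF k2 c(1) this vs(4)[OF F]]
            show "\<forall>v<n. ?f v \<longrightarrow> d c v \<le> R + \<rho>" by blast
          next
            have cn: "card {c. c < n \<and> (vs < n \<longrightarrow> d vs c \<le> al)} = n" using F by simp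
            have "n * (4 + 5 * length ?L) \<le> n * (4 + 5 * K)"
              by (intro mult_left_mono) (use lL K(1) in linarith, simp)
            also have "\<dots> \<le> (4 + 5 * n) * K + 4 * n" by (simp add: algebra_simps)
            finally show "card {c. c < n \<and> (vs < n \<longrightarrow> d vs c \<le> al)} * (4 + 5 * length ?L) \<le> (4 + 5 * n) * K + 4 * n"
              unfolding cn .
          qed (use e2 o2 2(1) b L lL2 Rn F vs S in auto)
        qed
      qed auto
      then show ?thesis using False by simp
    qed
  qed auto
qed


lemma radE_facts:
  assumes "j < k"
  shows "in_range w (2 * int j)" "in_range w (2 * int j * int al)" "int \<rho> + 2 * int j * int al = int (\<rho> + 2 * j * al)"
    "int \<rho> - 2 * int j * int al = int (\<rho> - 2 * j * al)" "\<rho> + 2 * j * al \<le> 8 * n"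
proof -
  note a = al_j[OF assms]
  show "in_range w (2 * int j)" using assms k_lim by (simp add: in_range_def)
  have "2 * j * al \<le> 8 * n" using a al_le by linarith
  from in_range_le(1)[OF this] show "in_range w (2 * int j * int al)" by simp
  show "int \<rho> + 2 * int j * int al = int (\<rho> + 2 * j * al)" by simp
  show "int \<rho> - 2 * int j * int al = int (\<rho> - 2 * j * al)" using a by (simp add: of_nat_diff)
  show "\<rho> + 2 * j * al \<le> 8 * n" using a al_le by simp
qed

text \<open>The value \<open>n\<close> stands for the absence of a pivot; then only \<open>S\<close>
  supplies candidates.\<close>

lemma wp_find_pivot:
  assumes s: "env s" "xs_regs s xs" "Suc (length xs) < k"
  shows "wp w (find_pivot (length xs)) (\<lambda>T s'. T \<le> 4 + 4 * n \<and>
     (\<exists>v\<le>n. reg s' (31 + 2 * length xs) = int v \<and> (v < n \<longrightarrow> pivot xs v) \<and> ((\<exists>u<n. pivot xs u) \<longrightarrow> v < n))) s"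
proof -
  define j where "j = length xs"
  define r where "r = \<rho> + 2 * j * al"
  have jk: "j < k" "j < k - 1" using s j_def by auto
  note F = radE_facts[OF jk(1)]
  let ?s = "setr (31 + 2 * j) (int n) (setr 21 (int r) s)"
  let ?loop = "For 8 0 (IfC (Bin Mul (farE j) (Bin Less (Get (11 + j) (Var 8)) (Var 5))) (Asg (31 + 2 * j) (Var 8)) NOP)"
  have *: "wp w ?loop
    (\<lambda>T s'. T \<le> 2 + 4 * n \<and>
      (\<exists>v\<le>n. reg s' (31 + 2 * j) = int v \<and> (v < n \<longrightarrow> pivot xs v) \<and> ((\<exists>u<n. pivot xs u) \<longrightarrow> v < n))) ?s"
  proof (rule wp_For_le[where I = "\<lambda>i s'. \<exists>v\<le>n. reg s' (31 + 2 * j) = int v \<and> (v < n \<longrightarrow> pivot xs v) \<and> ((\<exists>u<i. pivot xs u) \<longrightarrow> v < n)"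
      and \<tau> = "\<lambda>_. 2" and m = n and X = "{8,31 + 2 * j}" and A = "{}"], goal_cases)
    case (1 i \<sigma>)
    note f = 1(5)
    have e: "env \<sigma>" using env_agree[OF _ f] s by simp
    have "xs_regs ?s xs" using s(2) by (simp add: xs_regs_def j_def)
    then have x: "xs_regs \<sigma> xs" by (rule xs_regs_agree[OF _ f]) (auto simp: j_def)
    have 21: "reg \<sigma> 21 = int r" using agree_reg[OF f] by simp
    note E = farE_ev[OF env_dmat[OF e] x 1(2,1) 21, folded j_def]
    have c: "arr \<sigma> (11 + j) (int i) = int (card (ball (\<rho> - 2 * j * al) i))" "reg \<sigma> 5 = int t"
      using e 1(1) jk(2) by (auto simp: env_def)
    have p: "pivot xs i \<longleftrightarrow> far xs r i \<and> card (ball (\<rho> - 2 * j * al) i) < t"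
      by (simp add: pivot_def r_def j_def)
    obtain v where v: "v \<le> n" "reg \<sigma> (31 + 2 * j) = int v" "v < n \<longrightarrow> pivot xs v" "(\<exists>u<i. pivot xs u) \<longrightarrow> v < n"
      using 1(4) by blast
    show ?case
    proof (cases "pivot xs i")
      case True
      then have "\<exists>v\<le>n. i = v \<and> (v < n \<longrightarrow> pivot xs v) \<and> ((\<exists>u<Suc i. pivot xs u) \<longrightarrow> v < n)"
        using 1(1) by auto
      then show ?thesis
        using E F(5) c p True 1(1,2) card_ball_le[of "\<rho> - 2 * j * al" i] t_le by (auto simp: r_def)
    next
      case False
      then have "\<exists>v\<le>n. reg \<sigma> (31 + 2 * j) = int v \<and> (v < n \<longrightarrow> pivot xs v) \<and> ((\<exists>u<Suc i. pivot xs u) \<longrightarrow> v < n)"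
        using v by (auto simp: less_Suc_eq)
      moreover have "(of_bool (far xs r i) :: int) * of_bool (card (ball (\<rho> - 2 * j * al) i) < t) = 0"
        using False p by auto
      ultimately show ?thesis
        using E F(5) c 1(1,2) card_ball_le[of "\<rho> - 2 * j * al" i] t_le by (simp add: r_def)
    qed
  qed (use s n_le in \<open>auto simp: env_def dmat_def\<close>)
  have r: "reg s 4 = int \<rho>" "reg s 0 = int n" "reg s 3 = int al" using s by (auto simp: env_def dmat_def)
  have ir: "in_range w (int r)" unfolding r_def by (rule in_range_le(1)[OF F(5)])
  have "wp w ?loop
    (\<lambda>T s'. 1 + (1 + T) \<le> 4 + 4 * n \<and>
      (\<exists>v\<le>n. reg s' (31 + 2 * j) = int v \<and> (v < n \<longrightarrow> pivot xs v) \<and> ((\<exists>u<n. pivot xs u) \<longrightarrow> v < n))) ?s"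
    by (rule wp_conseq[OF *]) auto
  moreover have "int \<rho> + 2 * int j * int al = int r" using F(3) r_def by simp
  ultimately show ?thesis
    unfolding find_pivot_def j_def[symmetric] wp_simps(4) wp_simps(2)
    using r F(1,2) ir al_le by (simp del: of_nat_add of_nat_mult)
qed

lemma wp_candidate:
  assumes s: "env s" "j < k" "reg s (30 + 2 * j) = int x" "x < n" "reg s (31 + 2 * j) = int v" "v \<le> n"
  shows "wp w (candidate j) (\<lambda>T s'. T \<le> 4 \<and>
    reg s' 23 = of_bool (x \<in> S \<or> (v < n \<and> d v x \<le> \<rho> - 2 * j * al))) s"
proof -
  note F = radE_facts[OF s(2)]
  have r: "reg s 4 = int \<rho>" "reg s 0 = int n" "reg s 3 = int al" "arr s 6 (int x) = of_bool (x \<in> S)"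
    "v < n \<Longrightarrow> arr s 2 (int v * int n + int x) = int (d v x)"
    using s by (auto simp: env_def dmat_def flags_def)
  define rr where "rr = \<rho> - 2 * j * al"
  have "rr \<le> 8 * n" unfolding rr_def using al_le by simp
  note i = in_range_le(1)[OF this] F(4)[folded rr_def]
  show ?thesis
  proof (cases "v < n")
    case True
    show ?thesis
      unfolding candidate_def rr_def[symmetric]
      using True s(3-6) r F(1,2) i al_le in_range_d[of v x] by auto
  next
    case False
    then show ?thesis unfolding candidate_def using s(3-6) r by simp
  qed
qed

text \<open>The flag is never reset, so the branches accumulate their results and one good branch is
  enough. The bound \<open>K\<close> covers \<open>S\<close> together with the ball of a
  pivot.\<close>

lemma wp_level:
  assumes s: "env s" "xs_regs s xs" "length xs + i + 1 = k" "reg s 6 = of_bool out"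
    and K: "card S + t \<le> K" "k = 1 \<Longrightarrow> n \<le> K"
  shows "wp w (level k i (length xs)) (\<lambda>T s'. T \<le> level_time n K i \<and>
    (\<exists>out'. reg s' 6 = of_bool out' \<and> (out \<longrightarrow> out') \<and> (good i xs \<longrightarrow> out') \<and>
      (out' \<longrightarrow> out \<or> (\<exists>ys. length ys = k \<and> covers ys)))) s"
  using s
proof (induction i arbitrary: s xs out)
  case 0
  then show ?case using wp_leaf[of s xs out K] K by simp
next
  case (Suc i)
  note s = Suc.prems
  define j where "j = length xs"
  have jk: "Suc j < k" using s(3) j_def by simp
  have xs: "set xs \<subseteq> {..<n}" using s by (simp add: xs_regs_def)
  let ?C = "\<exists>ys. length ys = k \<and> covers ys"
  show ?case unfolding level.simps wp_simps(4)
  proof (rule wp_conseq_agree[OF wp_find_pivot[OF s(1,2) jk[unfolded j_def]], where X = "{8,21,31 + 2 * length xs}" and A = "{}"], goal_cases)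
    case (1 T1 \<sigma>)
    note f = 1(2)
    have e: "env \<sigma>" using env_agree[OF s(1) f] by simp
    have x: "xs_regs \<sigma> xs" using xs_regs_agree[OF s(2) f] by simp
    have o: "reg \<sigma> 6 = of_bool out" using agree_reg[OF f] s(4) by simp
    from 1(1) obtain v where v: "v \<le> n" "reg \<sigma> (31 + 2 * j) = int v" "v < n \<longrightarrow> pivot xs v"
      "(\<exists>u<n. pivot xs u) \<longrightarrow> v < n" and T1: "T1 \<le> 4 + 4 * n" unfolding j_def by blast
    let ?cand = "\<lambda>x. x \<in> S \<or> (v < n \<and> d v x \<le> \<rho> - 2 * j * al)"
    let ?I = "\<lambda>m s'. \<exists>out'. reg s' 6 = of_bool out' \<and> (out \<longrightarrow> out') \<and>
      (\<forall>x<m. ?cand x \<longrightarrow> good i (xs @ [x]) \<longrightarrow> out') \<and> (out' \<longrightarrow> out \<or> ?C)"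
    \<comment> \<open>Register \<open>31 + 2 * j\<close> is left out on purpose: the pivot has to
      survive the deeper levels, which use the registers from \<open>32 + 2 * j\<close> on.\<close>
    let ?X = "{6, 7, 8, 12, 18, 19, 20, 21, 22, 23} \<union> (insert (30 + 2 * j) {32 + 2 * j..})"
    have card_cand: "card {x. x < n \<and> ?cand x} \<le> K"
    proof (cases "v < n")
      case True
      have "{x. x < n \<and> ?cand x} \<subseteq> S \<union> ball (\<rho> - 2 * j * al) v" by (auto simp: ball_def)
      then have "card {x. x < n \<and> ?cand x} \<le> card (S \<union> ball (\<rho> - 2 * j * al) v)"
        using S_fin by (intro card_mono) auto
      also have "\<dots> \<le> card S + card (ball (\<rho> - 2 * j * al) v)" by (rule card_Un_le)
      also have "\<dots> \<le> K" using v(3) True K(1) by (simp add: pivot_def j_def)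
      finally show ?thesis .
    next
      case False
      then have "card {x. x < n \<and> ?cand x} \<le> card S" using S_fin by (intro card_mono) auto
      then show ?thesis using K(1) by simp
    qed
    have mrl: "mod_regs (level k i (Suc j)) \<subseteq> ?X" using mod_regs_level[of k i "Suc j"] by auto
    show ?case unfolding j_def[symmetric]
    proof (rule wp_For_le[where I = ?I and \<tau> = "\<lambda>x. 6 + (if ?cand x then level_time n K i else 0)" and m = n and X = ?X and A = "{8,9}"], goal_cases)
      case (1 x \<sigma>1)
      note g = 1(5)
      have e1: "env \<sigma>1" using env_agree[OF e g] by simp
      have x1: "xs_regs \<sigma>1 xs" by (rule xs_regs_agree[OF x g]) (auto simp: j_def)
      have v1: "reg \<sigma>1 (31 + 2 * j) = int v" using agree_reg[OF g, of "31 + 2 * j"] v(2) by simp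
      from 1(4) obtain o1 where o1: "reg \<sigma>1 6 = of_bool o1" "out \<longrightarrow> o1"
        "\<forall>y<x. ?cand y \<longrightarrow> good i (xs @ [y]) \<longrightarrow> o1" "o1 \<longrightarrow> out \<or> ?C" by blast
      show ?case unfolding wp_simps(4)
      proof (rule wp_conseq_agree[OF wp_candidate[OF e1 _ 1(2,1) v1 v(1)], where X = "{23}" and A = "{}"], goal_cases)
        case (2 T2 \<sigma>2)
        note h = 2(2)
        have e2: "env \<sigma>2" using env_agree[OF e1 h] by simp
        have o2: "reg \<sigma>2 6 = of_bool o1" using agree_reg[OF h] o1 by simp
        show ?case
        proof (cases "?cand x")
          case False
          then have "?I (Suc x) \<sigma>2" using o1 o2 by (intro exI[of _ o1]) (auto simp: less_Suc_eq)
          then show ?thesis using 2(1) False by simp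
        next
          case True
          \<comment> \<open>The loop counter of this level is itself the register of the new
            center.\<close>
          have "reg \<sigma>2 (30 + 2 * l) = int ((xs @ [x]) ! l)" if "l < Suc (length xs)" for l
          proof (cases "l = length xs")
            case True
            then show ?thesis using agree_reg[OF h, of "30 + 2 * l"] 1(2) by (simp add: j_def)
          next
            case False
            then show ?thesis using agree_reg[OF h, of "30 + 2 * l"] x1 that by (simp add: xs_regs_def nth_append)
          qed
          then have x2: "xs_regs \<sigma>2 (xs @ [x])" using xs 1(1) by (simp add: xs_regs_def)
          have "wp w (level k i (Suc j)) (\<lambda>T s'. T \<le> level_time n K i \<and>
            (\<exists>out'. reg s' 6 = of_bool out' \<and> (o1 \<longrightarrow> out') \<and> (good i (xs @ [x]) \<longrightarrow> out') \<and>
            (out' \<longrightarrow> o1 \<or> ?C))) \<sigma>2"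
            using Suc.IH[OF e2 x2 _ o2] s(3) by (simp add: j_def)
          then have "wp w (level k i (Suc j)) (\<lambda>T3 s'. T2 + Suc T3 \<le> 6 + level_time n K i \<and> ?I (Suc x) s') \<sigma>2"
          proof (rule wp_conseq, goal_cases)
            case c: (1 T3 s')
            then obtain o3 where o3: "reg s' 6 = of_bool o3" "o1 \<longrightarrow> o3" "good i (xs @ [x]) \<longrightarrow> o3" "o3 \<longrightarrow> o1 \<or> ?C"
              by blast
            then have "?I (Suc x) s'" using o1 by (intro exI[of _ o3]) (auto simp: less_Suc_eq)
            then show ?case using c(1) 2(1) by simp
          qed
          then show ?thesis using True 2(1) by simp
        qed
      qed (use jk in auto)
    next
      case (2 T \<sigma>1)
      have "(\<Sum>x<n. 6 + (if ?cand x then level_time n K i else 0) + 2) = n * 8 + card {x. x < n \<and> ?cand x} * level_time n K i"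
        using sum_if_card[of 6 ?cand "level_time n K i" n] by simp
      also have "\<dots> \<le> n * 8 + K * level_time n K i" using card_cand by simp
      finally have T: "T1 + T \<le> level_time n K (Suc i)" using 2(4) T1 by simp
      from 2(1) obtain o1 where o1: "reg \<sigma>1 6 = of_bool o1" "out \<longrightarrow> o1"
        "\<forall>y<n. ?cand y \<longrightarrow> good i (xs @ [y]) \<longrightarrow> o1" "o1 \<longrightarrow> out \<or> ?C" by blast
      have "o1" if "good (Suc i) xs"
      proof -
        have "length xs + i + 2 = k" using s(3) by simp
        from good_step[OF that this xs] have "\<exists>y<n. ?cand y \<and> good i (xs @ [y])"
        proof (elim disjE conjE, goal_cases)
          case 1
          then show ?case using S by auto
        next
          case 2
          then have "v < n" "pivot xs v" using v by auto
          with 2 obtain y where "y \<in> ball (\<rho> - 2 * length xs * al) v" "good i (xs @ [y])" by blast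
          then show ?case using \<open>v < n\<close> by (auto simp: ball_def j_def)
        qed
        then show ?thesis using o1(3) by blast
      qed
      then show ?case using T o1 by (intro conjI exI[of _ o1]) auto
    next
      case 3
      then show ?case using o by (intro exI[of _ out]) auto
    qed (use e n_le mrl mod_arrs_level mod_regs_level[of k i "Suc j"] in \<open>auto simp: env_def dmat_def\<close>)
  qed auto
qed

end

section \<open>All-pairs distances by breadth-first search\<close>

definition arc :: "nat \<Rightarrow> nat \<Rightarrow> cmd" where
  "arc x y = Sq (Wr 4 (Bin Add (Bin Mul (Var x) (Var 16)) (Get 3 (Var x))) (Var y))
     (Wr 3 (Var x) (Bin Add (Get 3 (Var x)) (Lit 1)))"

definition adj_lists :: cmd where
  "adj_lists = For 12 1 (Sq (Asg 17 (Get 0 (Var 12))) (Sq (Asg 18 (Get 1 (Var 12)))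
     (Sq (arc 17 18) (arc 18 17))))"

text \<open>The distance \<open>4 * n\<close> doubles as the mark of an unvisited vertex.\<close>

definition visit :: cmd where
  "visit = Sq (Asg 18 (Get 4 (Bin Add (Bin Mul (Var 17) (Var 16)) (Var 12))))
     (IfC (Bin Less (dist_at 7 18) (Bin Mul (Lit 4) (Var 0))) NOP
       (Sq (Wr 2 (Bin Add (Bin Mul (Var 7) (Var 0)) (Var 18)) (Var 9))
       (Sq (Wr 5 (Var 14) (Var 18)) (inc 14))))"

definition bfs_body :: cmd where
  "bfs_body = Sq (Asg 17 (Get 5 (Var 13))) (Sq (inc 13) (Sq (Asg 15 (Get 3 (Var 17)))
     (Sq (Asg 9 (Bin Add (dist_at 7 17) (Lit 1))) (For 12 15 visit))))"

definition bfs :: cmd where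
  "bfs = Sq (For 8 0 (Wr 2 (Bin Add (Bin Mul (Var 7) (Var 0)) (Var 8)) (Bin Mul (Lit 4) (Var 0))))
     (Sq (Wr 2 (Bin Add (Bin Mul (Var 7) (Var 0)) (Var 7)) (Lit 0))
     (Sq (Wr 5 (Lit 0) (Var 7)) (Sq (Asg 13 (Lit 0)) (Sq (Asg 14 (Lit 1))
     (Wh (Bin Less (Var 13) (Var 14)) bfs_body)))))"

definition apsp :: cmd where
  "apsp = For 7 0 bfs"

lemma bfs_frag_simps [simp]:
  "mod_regs (arc x y) = {}" "mod_arrs (arc x y) = {3, 4}"
  "mod_regs adj_lists = {12, 17, 18}" "mod_arrs adj_lists = {3, 4}"
  "mod_regs visit = {14, 18}" "mod_arrs visit = {2, 5}"
  "mod_regs bfs_body = {9, 12, 13, 14, 15, 17, 18}" "mod_arrs bfs_body = {2, 5}"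
  "mod_regs bfs = {8, 9, 12, 13, 14, 15, 17, 18}" "mod_arrs bfs = {2, 5}"
  "mod_regs apsp = {7, 8, 9, 12, 13, 14, 15, 17, 18}" "mod_arrs apsp = {2, 5}"
  by (auto simp: arc_def adj_lists_def visit_def bfs_body_def bfs_def apsp_def)

section \<open>Adjacency lists and the invariant of breadth-first search\<close>

fun nbrs :: "(nat \<times> nat) list \<Rightarrow> nat \<Rightarrow> nat list" where
  "nbrs [] u = []"
| "nbrs ((a, b) # es) u = (if a = u then [b] else []) @ (if b = u then [a] else []) @ nbrs es u"

lemma nbrs_snoc: "nbrs (es @ [(a, b)]) u = nbrs es u @ (if a = u then [b] else []) @ (if b = u then [a] else [])"
  by (induction es u rule: nbrs.induct) auto

lemma length_nbrs: "length (nbrs es u) \<le> 2 * length es"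
  by (induction es u rule: nbrs.induct) auto

lemma set_nbrs: "v \<in> set (nbrs es u) \<longleftrightarrow> {u, v} \<in> set (map (\<lambda>(u, v). {u, v}) es)"
  by (induction es u rule: nbrs.induct) (auto simp: doubleton_eq_iff)

lemma sum_length_nbrs: "(\<Sum>u<n. length (nbrs es u)) \<le> 2 * length es"
proof (induction es)
  case (Cons e es)
  obtain a b where e: "e = (a, b)" by (cases e)
  have "(\<Sum>u<n. length (nbrs (e # es) u)) =
     (\<Sum>u<n. if a = u then 1 else 0) + (\<Sum>u<n. if b = u then 1 else 0) + (\<Sum>u<n. length (nbrs es u))"
    unfolding e sum.distrib[symmetric] by (rule sum.cong) auto
  also have "\<dots> \<le> 1 + 1 + 2 * length es"
    using Cons by (intro add_mono) (auto simp: sum.delta)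
  finally show ?case by simp
qed simp

text \<open>The list \<open>q\<close> includes the vertices already processed. The last conjunct
  bounds each distance by the position in the queue, hence by \<open>n\<close>, which keeps it apart
  from \<open>4 * n\<close>.\<close>

definition bfs_inv :: "nat \<Rightarrow> nat set set \<Rightarrow> nat \<Rightarrow> (nat \<Rightarrow> nat) \<Rightarrow> nat list \<Rightarrow> bool" where
  "bfs_inv n E s D q \<longleftrightarrow> distinct q \<and> set q \<subseteq> {..<n} \<and> s \<in> set q \<and> D s = 0 \<and>
     (\<forall>v<n. v \<notin> set q \<longrightarrow> D v = 4 * n) \<and> (\<forall>v\<in>set q. (s, v) \<in> adj E ^^ D v) \<and>
     sorted (map D q) \<and> (\<forall>i<length q. D (q ! i) \<le> i)"

definition bfs_done :: "nat set set \<Rightarrow> (nat \<Rightarrow> nat) \<Rightarrow> nat list \<Rightarrow> nat \<Rightarrow> bool" where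
  "bfs_done E D q h \<longleftrightarrow> (\<forall>i<h. \<forall>v. (q ! i, v) \<in> adj E \<longrightarrow> v \<in> set q \<and> D v \<le> Suc (D (q ! i)))"

text \<open>Once all vertices are processed, \<open>D\<close> grows by at most 1 along each edge, so
  it is at most the length of any walk from \<open>s\<close>. The invariant provides a walk of
  length \<open>D v\<close>, and the bounds meet.\<close>

lemma bfs_finish:
  assumes "bfs_inv n E s D q" "bfs_done E D q (length q)" "v < n"
  shows "D v = gdist_nat n E s v"
proof -
  have w: "u \<in> set q \<and> D u \<le> l" if "(s, u) \<in> adj E ^^ l" for u l
    using that
  proof (induction l arbitrary: u)
    case 0
    then show ?case using assms(1) by (auto simp: bfs_inv_def)
  next
    case (Suc l)
    then obtain y where y: "(s, y) \<in> adj E ^^ l" "(y, u) \<in> adj E" by auto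
    from Suc.IH[OF y(1)] obtain i where "i < length q" "q ! i = y" "D y \<le> l" by (auto simp: in_set_conv_nth)
    then show ?case using assms(2) y(2) by (force simp: bfs_done_def)
  qed
  show ?thesis
  proof (cases "v \<in> set q")
    case True
    then have "(s, v) \<in> adj E ^^ D v" using assms(1) by (simp add: bfs_inv_def)
    moreover from this have "(LEAST l. (s, v) \<in> adj E ^^ l) = D v" using w by (intro Least_equality) auto
    ultimately show ?thesis by (auto simp: gdist_nat_def)
  next
    case False
    then show ?thesis using w[of v] assms by (auto simp: gdist_nat_def bfs_inv_def)
  qed
qed

lemma bfs_start:
  assumes "s < n" shows "bfs_inv n E s ((\<lambda>_. 4 * n)(s := 0)) [s]"
  using assms by (auto simp: bfs_inv_def)

text \<open>The last two premises keep the queue sorted and keep the distance of the new vertex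
  below its position, which is \<open>length q\<close>.\<close>

lemma bfs_add:
  assumes "bfs_inv n E s D q" "u \<in> set q" "(u, v) \<in> adj E" "v < n" "v \<notin> set q"
    "\<forall>x\<in>set q. D x \<le> Suc (D u)" "Suc (D u) \<le> length q"
  shows "bfs_inv n E s (D(v := Suc (D u))) (q @ [v])"
proof -
  have "map (D(v := Suc (D u))) q = map D q" using assms(5) by auto
  then have "sorted (map (D(v := Suc (D u))) (q @ [v]))" using assms by (auto simp: sorted_append bfs_inv_def)
  moreover have "(s, v) \<in> adj E ^^ Suc (D u)" using assms by (auto simp: bfs_inv_def)
  moreover have "v \<noteq> s" using assms by (auto simp: bfs_inv_def)
  moreover have "\<forall>i<length (q @ [v]). (D(v := Suc (D u))) ((q @ [v]) ! i) \<le> i"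
    using assms by (auto simp: bfs_inv_def nth_append less_Suc_eq)
  ultimately show ?thesis using assms unfolding bfs_inv_def by auto
qed

lemma bfs_add_done:
  assumes "bfs_done E D q h" "h \<le> length q" "v \<notin> set q"
  shows "bfs_done E (D(v := x)) (q @ [v]) h"
  unfolding bfs_done_def
proof (intro allI impI)
  fix i y assume i: "i < h" "((q @ [v]) ! i, y) \<in> adj E"
  then have "q ! i \<in> set q" "(q @ [v]) ! i = q ! i" using assms by (auto simp: nth_append)
  then show "y \<in> set (q @ [v]) \<and> (D(v := x)) y \<le> Suc ((D(v := x)) ((q @ [v]) ! i))"
    using assms i unfolding bfs_done_def by auto
qed


lemma bfs_bounds:
  assumes "bfs_inv n E s D q"
  shows "length q \<le> n" "v \<in> set q \<Longrightarrow> D v < n" "v < n \<Longrightarrow> D v \<le> 4 * n"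
    "v < n \<Longrightarrow> D v < 4 * n \<longleftrightarrow> v \<in> set q"
proof -
  show 1: "length q \<le> n"
    using assms distinct_card[of q] card_mono[of "{..<n}" "set q"] by (auto simp: bfs_inv_def)
  show 2: "D v < n" if v: "v \<in> set q" for v
  proof -
    obtain i where "i < length q" "q ! i = v" using v by (auto simp: in_set_conv_nth)
    then have "D v \<le> i" using assms by (auto simp: bfs_inv_def)
    then show ?thesis using 1 \<open>i < length q\<close> by simp
  qed
  show "v < n \<Longrightarrow> D v \<le> 4 * n" using 2[of v] assms by (cases "v \<in> set q") (auto simp: bfs_inv_def)
  show "v < n \<Longrightarrow> D v < 4 * n \<longleftrightarrow> v \<in> set q" using 2[of v] assms by (cases "v \<in> set q") (auto simp: bfs_inv_def)
qed

lemma idx_eq: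
  assumes "i < M" "i' < M"
  shows "int u * int M + int i = int u' * int M + int i' \<longleftrightarrow> u = u' \<and> i = i'"
proof
  assume "int u * int M + int i = int u' * int M + int i'"
  then have "int (u * M + i) = int (u' * M + i')" by simp
  then have *: "u * M + i = u' * M + i'" by (simp only: of_nat_eq_iff)
  have "(u * M + i) div M = u" "(u' * M + i') div M = u'" using assms by auto
  with * show "u = u' \<and> i = i'" by auto
qed simp

definition adjrep :: "nat \<Rightarrow> nat \<Rightarrow> (nat \<Rightarrow> nat list) \<Rightarrow> state \<Rightarrow> bool" where
  "adjrep n M nb s \<longleftrightarrow> reg s 0 = int n \<and> reg s 16 = int M \<and> (\<forall>u<n. arr s 3 (int u) = int (length (nb u)) \<and>
     (\<forall>i<length (nb u). arr s 4 (int u * int M + int i) = int (nb u ! i)))"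

lemma adjrep_agree: "adjrep n M nb s \<Longrightarrow> agree X A s s' \<Longrightarrow> 0 \<notin> X \<Longrightarrow> 16 \<notin> X \<Longrightarrow> 3 \<notin> A \<Longrightarrow> 4 \<notin> A \<Longrightarrow> adjrep n M nb s'"
  by (simp add: adjrep_def agree_def)

lemma adjrep_setr [simp]: "x \<noteq> 0 \<Longrightarrow> x \<noteq> 16 \<Longrightarrow> adjrep n M nb (setr x v s) \<longleftrightarrow> adjrep n M nb s"
  by (simp add: adjrep_def)

context machine begin

lemma in_range_uM:
  assumes "u \<le> n" "i \<le> M" "M \<le> 2 * n * n"
  shows "in_range w (int u * int M + int i)" "in_range w (int u * int M)" "in_range w (int i)" "in_range w (int i + 1)"
proof -
  have "int M \<le> int (2 * n * n)" using assms(3) by (simp only: of_nat_le_iff)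
  then have M: "int M \<le> 2 * (int n * int n)" by simp
  have sq: "int n * int n \<le> (int n + 1) * (int n + 1)" by (intro mult_mono) auto
  have M': "int M \<le> 2 * ((int n + 1) * (int n + 1))" using M sq by linarith
  have uM: "int u * int M \<le> (int n + 1) * (2 * ((int n + 1) * (int n + 1)))"
    using assms(1) M' by (intro mult_mono) auto
  have P: "(int n + 1) * (int n + 1) \<le> (int n + 1) * (int n + 1) * (int n + 1)"
    by (rule mult_Suc_n_ge) simp
  define Z where "Z = (int n + 1) * (int n + 1) * (int n + 1)"
  have "int M \<le> 2 * Z" unfolding Z_def using M' P by linarith
  moreover have "int u * int M \<le> 2 * Z" using uM by (simp add: Z_def algebra_simps)
  moreover have "1 \<le> Z" using one_le_power[of "int n + 1" 3] by (simp add: Z_def power3_eq_cube)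
  ultimately have b: "int u * int M \<le> 2 * Z" "int M \<le> 2 * Z" "int i \<le> int M" "1 \<le> Z"
    using assms(2) by auto
  have z: "64 * (int n + 1) * (int n + 1) * (int n + 1) = 64 * Z" by (simp add: Z_def mult.assoc)
  have nn: "0 \<le> int u * int M" by simp
  show "in_range w (int u * int M + int i)" "in_range w (int u * int M)" "in_range w (int i)" "in_range w (int i + 1)"
    by (rule in_range_cube; use b z nn in linarith)+
qed

lemma wp_arc:
  assumes s: "adjrep n M nb s" "reg s x = int u" "reg s y = int v" "u < n" "v < n" "length (nb u) < M"
    "M \<le> 2 * n * n" "\<forall>u<n. length (nb u) \<le> M"
  shows "wp w (arc x y) (\<lambda>T s'. T = 2 \<and> adjrep n M (nb(u := nb u @ [v])) s') s"
proof -
  let ?l = "length (nb u)"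
  let ?s = "seta 3 (int u) (int ?l + 1) (seta 4 (int u * int M + int ?l) (int v) s)"
  have r: "arr s 3 (int u) = int ?l" "reg s 16 = int M" "reg s 0 = int n" using s by (auto simp: adjrep_def)
  note b = in_range_uM[of u ?l M] in_range_uM(3)[of u M M]
  have "adjrep n M (nb(u := nb u @ [v])) ?s"
    unfolding adjrep_def
  proof (intro conjI allI impI)
    fix a i assume a: "a < n" "i < length ((nb(u := nb u @ [v])) a)"
    have "i < M" using a s(6,8) by (auto split: if_splits)
    then have "int a * int M + int i = int u * int M + int ?l \<longleftrightarrow> a = u \<and> i = ?l"
      using idx_eq s(6) by blast
    then show "arr ?s 4 (int a * int M + int i) = int ((nb(u := nb u @ [v])) a ! i)"
      using a s(1) by (auto simp: adjrep_def nth_append less_Suc_eq split: if_splits)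
  qed (use s in \<open>auto simp: adjrep_def\<close>)
  then show ?thesis unfolding arc_def using s b r by simp
qed

lemma wp_adj_lists:
  assumes s: "reg s 0 = int n" "reg s 1 = int (length es)" "reg s 16 = int (2 * length es)" "length es \<le> n * n"
    "\<forall>i<length es. arr s 0 (int i) = int (fst (es ! i)) \<and> arr s 1 (int i) = int (snd (es ! i))"
    "\<forall>(a, b)\<in>set es. a < n \<and> b < n \<and> a \<noteq> b" "\<forall>u<n. arr s 3 (int u) = 0"
  shows "wp w adj_lists (\<lambda>T s'. T \<le> 2 + 8 * length es \<and> adjrep n (2 * length es) (nbrs es) s') s"
  unfolding adj_lists_def
proof (rule wp_For_le[where I = "\<lambda>i. adjrep n (2 * length es) (nbrs (take i es))"
        and \<tau> = "\<lambda>_. 6" and m = "length es" and X = "{12,17,18}" and A = "{3,4}"], goal_cases)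
  case (1 i \<sigma>)
  note f = 1(5)
  let ?M = "2 * length es" and ?nb = "nbrs (take i es)"
  obtain a b where ab: "es ! i = (a, b)" by fastforce
  then have abn: "a < n" "b < n" "a \<noteq> b" using s(6) 1(1) nth_mem by fastforce+
  have r: "arr \<sigma> 0 (int i) = int a" "arr \<sigma> 1 (int i) = int b" "reg \<sigma> 12 = int i"
    using agree_arr[OF f] s(5) 1 ab by auto
  have len: "length (?nb u) \<le> 2 * i" for u using length_nbrs[of "take i es" u] 1(1) by simp
  have M: "?M \<le> 2 * n * n" using s(4) by simp
  let ?s = "setr 18 (int b) (setr 17 (int a) \<sigma>)"
  let ?nb1 = "?nb(a := ?nb a @ [b])"
  have nb2: "?nb1(b := ?nb1 b @ [a]) = nbrs (take (Suc i) es)"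
    using 1(1) abn ab by (auto simp: take_Suc_conv_app_nth nbrs_snoc)
  have l1: "\<forall>u<n. length (?nb u) \<le> ?M" using len 1(1) by (meson less_imp_le_nat mult_le_mono2 order_trans)
  have l2: "length (?nb a) < ?M" "length (?nb1 b) < ?M" using len[of a] len[of b] 1(1) abn by auto
  have l3: "\<forall>u<n. length (?nb1 u) \<le> ?M" using len 1(1) l1 l2 by auto
  have "wp w (arc 17 18) (\<lambda>T1 s1. wp w (arc 18 17) (\<lambda>T2 s2. T1 + T2 = 4 \<and> adjrep n ?M (nbrs (take (Suc i) es)) s2) s1) ?s"
  proof (rule wp_conseq_agree[OF wp_arc[of ?M ?nb ?s 17 a 18 b], where X = "{}" and A = "{3,4}"], goal_cases)
    case (9 T1 s1)
    have r1: "reg s1 18 = int b" "reg s1 17 = int a" using agree_reg[OF 9(2)] by auto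
    show ?case
      by (rule wp_conseq[OF wp_arc[of ?M ?nb1 s1 18 b 17 a]])
        (use 9 r1 abn l2 l3 M nb2 in auto)
  qed (use 1 abn l1 l2 M in auto)
  then have "wp w (arc 17 18) (\<lambda>T1 s1. wp w (arc 18 17) (\<lambda>T2 s2. 1 + (1 + (T1 + T2)) \<le> 6 \<and>
     adjrep n ?M (nbrs (take (Suc i) es)) (setr 12 (int (Suc i)) s2)) s1) ?s"
    by (rule wp_conseq) (auto elim!: wp_conseq)
  moreover have "in_range w (int i)" using in_range_uM(3)[of 0 i ?M] 1(1) M by simp
  ultimately show ?case using r abn by simp
next
  case 9
  have "n * n \<le> 8 * (n + 1) * (n + 1)" by (intro mult_mono) auto
  then show ?case using s(4) by linarith
qed (use s in \<open>auto simp: adjrep_def\<close>)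


definition mat :: "state \<Rightarrow> (nat \<Rightarrow> nat \<Rightarrow> nat) \<Rightarrow> bool" where
  "mat s DM \<longleftrightarrow> (\<forall>u<n. \<forall>v<n. arr s 2 (int u * int n + int v) = int (DM u v))"

definition qrep :: "state \<Rightarrow> nat list \<Rightarrow> bool" where
  "qrep s q \<longleftrightarrow> reg s 14 = int (length q) \<and> (\<forall>i<length q. arr s 5 (int i) = int (q ! i))"

lemma mat_setr [simp]: "mat (setr x v s) DM \<longleftrightarrow> mat s DM"
  by (simp add: mat_def)

lemma qrep_setr [simp]: "x \<noteq> 14 \<Longrightarrow> qrep (setr x v s) q \<longleftrightarrow> qrep s q"
  by (simp add: qrep_def)

lemma qrep_seta [simp]: "qrep (seta 2 i v s) q \<longleftrightarrow> qrep s q"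
  by (simp add: qrep_def)

lemma mat_seta5 [simp]: "mat (seta 5 i v s) DM \<longleftrightarrow> mat s DM"
  by (simp add: mat_def)

lemma mat_upd:
  assumes "mat s DM" "a < n" "v < n"
  shows "mat (seta 2 (int a * int n + int v) (int x) s) (DM(a := (DM a)(v := x)))"
  unfolding mat_def
proof (intro allI impI)
  fix u y assume "u < n" "y < n"
  then have "int u * int n + int y = int a * int n + int v \<longleftrightarrow> u = a \<and> y = v"
    using idx_eq assms(3) by blast
  then show "arr (seta 2 (int a * int n + int v) (int x) s) 2 (int u * int n + int y) =
      int ((DM(a := (DM a)(v := x))) u y)"
    using assms \<open>u < n\<close> \<open>y < n\<close> by (auto simp: mat_def)
qed

lemma qrep_append:
  assumes "qrep s q"
  shows "qrep (setr 14 (reg s 14 + 1) (seta 5 (reg s 14) (int x) s)) (q @ [x])"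
  using assms by (auto simp: qrep_def nth_append less_Suc_eq)

end

section \<open>Correctness and cost of the breadth-first searches\<close>

locale graph_machine = machine w n for w n +
  fixes E :: "nat set set" and M :: nat and nb :: "nat \<Rightarrow> nat list"
  assumes G: "graph n E" and nbE: "u < n \<Longrightarrow> v \<in> set (nb u) \<longleftrightarrow> (u, v) \<in> adj E"
    and nbM: "u < n \<Longrightarrow> length (nb u) \<le> M" and M_le: "M \<le> 2 * n * n"
    and sum_nb: "(\<Sum>u<n. length (nb u)) \<le> M"
begin

text \<open>Row \<open>a\<close> of the matrix is the current \<open>D\<close>, while the other rows
  of \<open>DM\<close> are carried along. The value \<open>D u\<close> stays fixed because visited
  vertices are not overwritten. Position \<open>h\<close> is done only when the whole list of
  \<open>u\<close> is in the queue.\<close>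

lemma wp_bfs_inner:
  assumes s: "adjrep n M nb \<sigma>" "reg \<sigma> 7 = int a" "a < n" "reg \<sigma> 17 = int u" "reg \<sigma> 15 = int (length (nb u))"
    "reg \<sigma> 9 = int (Suc (DM a u))" "mat \<sigma> DM" "qrep \<sigma> q"
    and inv: "bfs_inv n E a (DM a) q" "bfs_done E (DM a) q h" "h < length q" "q ! h = u"
      "\<forall>x\<in>set q. DM a x \<le> Suc (DM a u)"
  shows "wp w (For 12 15 visit) (\<lambda>T \<sigma>'. T \<le> 2 + 7 * length (nb u) \<and> (\<exists>D q'. mat \<sigma>' (DM(a := D)) \<and> qrep \<sigma>' q' \<and>
     bfs_inv n E a D q' \<and> bfs_done E D q' (Suc h) \<and> (\<exists>r. q' = q @ r) \<and> q' ! h = u \<and> (\<forall>x\<in>set q'. D x \<le> Suc (D u)))) \<sigma>"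
    (is "wp w _ (\<lambda>T \<sigma>'. _ \<and> ?J \<sigma>') \<sigma>")
proof -
  let ?I = "\<lambda>i \<sigma>'. \<exists>D q'. mat \<sigma>' (DM(a := D)) \<and> qrep \<sigma>' q' \<and>
     bfs_inv n E a D q' \<and> bfs_done E D q' h \<and> (\<exists>r. q' = q @ r) \<and> D u = DM a u \<and> (\<forall>x\<in>set q'. D x \<le> Suc (D u)) \<and>
     (\<forall>l<i. nb u ! l \<in> set q')"
  show ?thesis
  proof (rule wp_For_le[where I = ?I
          and \<tau> = "\<lambda>_. 5" and m = "length (nb u)" and X = "{12,14,18}" and A = "{2,5}"], goal_cases)
    case (1 i \<sigma>')
    note f = 1(5)
    from 1(4) obtain D q' r where I: "mat \<sigma>' (DM(a := D))" "qrep \<sigma>' q'"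
       "bfs_inv n E a D q'" "bfs_done E D q' h" "q' = q @ r" "D u = DM a u" "\<forall>x\<in>set q'. D x \<le> Suc (D u)"
       "\<forall>l<i. nb u ! l \<in> set q'" by blast
    have uq: "u \<in> set q'" "u \<in> set q" using inv(3,4) I(5) by auto
    have un: "u < n" using uq I(3) by (auto simp: bfs_inv_def)
    define v where "v = nb u ! i"
    have vu: "(u, v) \<in> adj E" using nbE[OF un] nth_mem[OF 1(1)] v_def by blast
    have vn: "v < n" using graph_adj[OF G vu] by simp
    have ar: "adjrep n M nb \<sigma>'" using adjrep_agree[OF s(1) f] by simp
    have iM: "i < M" using nbM[OF un] 1(1) by simp
    have r: "reg \<sigma>' 7 = int a" "reg \<sigma>' 17 = int u" "reg \<sigma>' 9 = int (Suc (D u))" "reg \<sigma>' 16 = int M" "reg \<sigma>' 0 = int n"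
      "arr \<sigma>' 4 (int u * int M + int i) = int v" "reg \<sigma>' 14 = int (length q')"
      "arr \<sigma>' 2 (int a * int n + int v) = int (D v)"
      using agree_reg[OF f] s ar I(1,2,6) un vn 1(1) by (auto simp: adjrep_def v_def qrep_def mat_def)
    note b = in_range_uM[of u i M] bfs_bounds[OF I(3)]
    have "h < length q'" "q' ! h = u" using inv(3,4) I(5) by (auto simp: nth_append)
    \<comment> \<open>The position bound yields \<open>Suc (D u) \<le> length q'\<close>, as
      \<open>bfs_add\<close> requires.\<close>
    then have h: "D u \<le> h" using I(3) unfolding bfs_inv_def by blast
    have inf: "in_range w (4 * int n)" "in_range w (int M)" using in_range_le(1)[of "4 * n"] in_range_uM(3)[of 0 M M] M_le by auto
    show ?case
    proof (cases "v \<in> set q'")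
      case True
      then have "?I (Suc i) \<sigma>'"
        using I by (intro exI[of _ D] exI[of _ q']) (auto simp: less_Suc_eq v_def)
      moreover have "int (D v) < 4 * int n" using b(8)[OF vn] True by linarith
      ultimately show ?thesis
        unfolding visit_def using r 1(1,2) un vn iM M_le b(1-4) b(7)[OF vn] s(3) inf by simp
    next
      case False
      let ?D = "D(v := Suc (D u))" and ?q = "q' @ [v]"
      let ?s1 = "seta 2 (int a * int n + int v) (int (Suc (D u))) (setr 18 (int v) \<sigma>')"
      let ?s = "setr 14 (reg ?s1 14 + 1) (seta 5 (reg ?s1 14) (int v) ?s1)"
      have lq: "Suc (D u) \<le> length q'" using h inv(3) I(5) by simp
      have uv: "u \<noteq> v" using False uq by auto
      have m: "mat ?s (DM(a := ?D))"
        using mat_upd[of "setr 18 (int v) \<sigma>'" "DM(a := D)" a v "Suc (D u)"] I(1) s(3) vn by simp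
      have q: "qrep ?s ?q" by (rule qrep_append) (use I(2) in simp)
      have "bfs_inv n E a ?D ?q" by (rule bfs_add[OF I(3) uq(1) vu vn False I(7) lq])
      moreover have "bfs_done E ?D ?q h" by (rule bfs_add_done[OF I(4) _ False]) (use inv(3) I(5) in simp)
      ultimately have "?I (Suc i) ?s"
        using I(5-8) m q uv by (intro exI[of _ ?D] exI[of _ ?q]) (auto simp: less_Suc_eq v_def)
      moreover have "int (D v) \<ge> 4 * int n" using b(8)[OF vn] False by linarith
      moreover have "in_range w (int (Suc (D u)))" "length q' \<le> 8 * n" using b(6)[OF uq(1)] b(5) by auto
      ultimately show ?thesis
        unfolding visit_def using r 1(1,2) un vn iM M_le b(1-4) b(7)[OF vn] s(3) inf by simp
    qed
  next
    case (2 T \<sigma>')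
    from 2(1) obtain D q' r where I: "mat \<sigma>' (DM(a := D))" "qrep \<sigma>' q'"
       "bfs_inv n E a D q'" "bfs_done E D q' h" "q' = q @ r" "D u = DM a u" "\<forall>x\<in>set q'. D x \<le> Suc (D u)"
       "\<forall>l<length (nb u). nb u ! l \<in> set q'" by blast
    have u: "q' ! h = u" using inv(3,4) I(5) by (simp add: nth_append)
    have un: "u < n" using inv(1,4) nth_mem[OF inv(3)] by (auto simp: bfs_inv_def)
    have "v \<in> set q'" if "(u, v) \<in> adj E" for v
      using that nbE[OF un] I(8) by (metis in_set_conv_nth)
    then have "bfs_done E D q' (Suc h)" using I(4,7) u by (auto simp: bfs_done_def less_Suc_eq)
    then have "?J \<sigma>'" using I u by blast
    then show ?case using 2(4) by simp
  next
    case 3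
    then show ?case using s(7,8) inv by (intro exI[of _ "DM a"] exI[of _ q]) auto
  next
    case 9
    have "length (nb u) \<le> 2 * n * n" using nbM[of u] M_le inv(1,3,4) nth_mem[of h q]
      by (auto simp: bfs_inv_def)
    also have "\<dots> \<le> 8 * (n + 1) * (n + 1)" by (intro mult_mono) auto
    finally show ?case .
  qed (use s in auto)
qed


text \<open>The queue contains each vertex at most once, so scanning its adjacency list is paid for by its summand.\<close>

definition pot :: "state \<Rightarrow> nat" where
  "pot \<sigma> = (\<Sum>u\<in>{..<n} - (\<lambda>i. nat (arr \<sigma> 5 (int i))) ` {..<nat (reg \<sigma> 13)}. 7 + 7 * length (nb u))"

lemma pot_eq:
  assumes "qrep \<sigma> q" "reg \<sigma> 13 = int h" "h \<le> length q"
  shows "pot \<sigma> = (\<Sum>u\<in>{..<n} - (!) q ` {..<h}. 7 + 7 * length (nb u))"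
proof -
  have "(\<lambda>i. nat (arr \<sigma> 5 (int i))) ` {..<nat (reg \<sigma> 13)} = (!) q ` {..<h}"
    using assms by (intro image_cong) (auto simp: qrep_def)
  then show ?thesis by (simp add: pot_def)
qed

lemma sum_pot_step:
  assumes "distinct q" "set q \<subseteq> {..<n}" "h < length q"
  shows "(\<Sum>u\<in>{..<n} - (!) q ` {..<h}. 7 + 7 * length (nb u)) =
    7 + 7 * length (nb (q ! h)) + (\<Sum>u\<in>{..<n} - (!) q ` {..<Suc h}. 7 + 7 * length (nb u))"
proof -
  have "q ! h \<notin> (!) q ` {..<h}" using assms by (auto simp: nth_eq_iff_index_eq)
  moreover have "q ! h < n" using assms nth_mem by blast
  moreover have "{..<n} - (!) q ` {..<Suc h} = ({..<n} - (!) q ` {..<h}) - {q ! h}"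
    by (auto simp: lessThan_Suc)
  ultimately show ?thesis by (simp add: sum.remove[of _ "q ! h"])
qed

definition bfs_state :: "nat \<Rightarrow> (nat \<Rightarrow> nat \<Rightarrow> nat) \<Rightarrow> state \<Rightarrow> (nat \<Rightarrow> nat) \<Rightarrow> nat list \<Rightarrow> nat \<Rightarrow> bool" where
  "bfs_state a DM \<sigma> D q h \<longleftrightarrow> mat \<sigma> (DM(a := D)) \<and> qrep \<sigma> q \<and> reg \<sigma> 13 = int h \<and> h \<le> length q \<and>
     bfs_inv n E a D q \<and> bfs_done E D q h \<and> (h < length q \<longrightarrow> (\<forall>x\<in>set q. D x \<le> Suc (D (q ! h))))"

lemma wp_bfs_body:
  assumes s: "adjrep n M nb \<sigma>" "reg \<sigma> 7 = int a" "a < n" "bfs_state a DM \<sigma> D q h" "h < length q"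
  shows "wp w bfs_body (\<lambda>T \<sigma>'. (\<exists>D' q'. bfs_state a DM \<sigma>' D' q' (Suc h)) \<and> T + 1 + pot \<sigma>' \<le> pot \<sigma>) \<sigma>"
proof -
  note S = s(4)[unfolded bfs_state_def]
  define u where "u = q ! h"
  have uq: "u \<in> set q" using s(5) by (simp add: u_def)
  note b = bfs_bounds[of n E a D q]
  have inv: "bfs_inv n E a D q" using S by simp
  have un: "u < n" "D u < n" "length q \<le> n" using uq inv b by (auto simp: bfs_inv_def)
  let ?s = "setr 9 (int (D u) + 1) (setr 15 (int (length (nb u))) (setr 13 (int h + 1) (setr 17 (int u) \<sigma>)))"
  have W: "wp w (For 12 15 visit) (\<lambda>T \<sigma>'. T \<le> 2 + 7 * length (nb u) \<and> (\<exists>D' q'. mat \<sigma>' ((DM(a := D))(a := D')) \<and> qrep \<sigma>' q' \<and>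
     bfs_inv n E a D' q' \<and> bfs_done E D' q' (Suc h) \<and> (\<exists>r. q' = q @ r) \<and> q' ! h = u \<and> (\<forall>x\<in>set q'. D' x \<le> Suc (D' u)))) ?s"
    by (rule wp_bfs_inner) (use s S u_def in auto)
  have "wp w (For 12 15 visit) (\<lambda>T \<sigma>'. (\<exists>D' q'. bfs_state a DM \<sigma>' D' q' (Suc h)) \<and> 1 + (1 + (1 + (1 + T))) + 1 + pot \<sigma>' \<le> pot \<sigma>) ?s"
  proof (rule wp_conseq_agree[OF W, where X = "{12,14,18}" and A = "{2,5}"], goal_cases)
    case (1 T \<sigma>')
    then obtain D' q' r where I: "mat \<sigma>' (DM(a := D'))" "qrep \<sigma>' q'"
     "bfs_inv n E a D' q'" "bfs_done E D' q' (Suc h)" "q' = q @ r" "q' ! h = u" "\<forall>x\<in>set q'. D' x \<le> Suc (D' u)"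
      and T: "T \<le> 2 + 7 * length (nb u)" by auto
    have 13: "reg \<sigma>' 13 = int (Suc h)" using agree_reg[OF 1(2), of 13] by simp
    \<comment> \<open>By sortedness the next vertex is at least as far as \<open>u\<close>, so it
      inherits the upper bound for the queue.\<close>
    have "D' x \<le> Suc (D' (q' ! Suc h))" if "Suc h < length q'" "x \<in> set q'" for x
    proof -
      have "D' u \<le> D' (q' ! Suc h)"
        using I(3) that(1) I(6) sorted_nth_mono[of "map D' q'" h "Suc h"] by (auto simp: bfs_inv_def)
      then show ?thesis using I(7) that(2) by (meson Suc_le_mono order_trans)
    qed
    then have st: "bfs_state a DM \<sigma>' D' q' (Suc h)"
      using I 13 s(5) by (auto simp: bfs_state_def)
    have "(!) q ` {..<h} = (!) q' ` {..<h}" using s(5) I(5) by (intro image_cong) (auto simp: nth_append)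
    then have "pot \<sigma> = (\<Sum>u\<in>{..<n} - (!) q' ` {..<h}. 7 + 7 * length (nb u))"
      using pot_eq[of \<sigma> q h] S by simp
    also have "\<dots> = 7 + 7 * length (nb u) + pot \<sigma>'"
      using sum_pot_step[of q' h] pot_eq[OF I(2) 13] I(3,5,6) s(5) by (simp add: bfs_inv_def)
    finally show ?case using st T by auto
  qed auto
  moreover have "arr \<sigma> 5 (int h) = int u" "arr \<sigma> 3 (int u) = int (length (nb u))" "arr \<sigma> 2 (int a * int n + int u) = int (D u)"
    "reg \<sigma> 0 = int n" "reg \<sigma> 13 = int h"
    using S s(1,3,5) un(1) by (auto simp: qrep_def adjrep_def mat_def u_def)
  moreover have "in_range w (int (length (nb u)))" using in_range_uM(3)[of u "length (nb u)" M] nbM M_le un by simp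
  ultimately show ?thesis
    unfolding bfs_body_def using s(2,3,5) un by simp
qed

lemma wp_bfs:
  assumes s: "adjrep n M nb \<sigma>" "reg \<sigma> 7 = int a" "a < n" "mat \<sigma> DM"
  shows "wp w bfs (\<lambda>T \<sigma>'. T \<le> 7 + 10 * n + 7 * M \<and> mat \<sigma>' (DM(a := gdist_nat n E a))) \<sigma>"
proof -
  have i4: "in_range w (4 * int n)" using in_range_le(1)[of "4 * n"] by simp
  have r0: "reg \<sigma> 0 = int n" using s by (simp add: adjrep_def)
  have 1: "wp w (For 8 0 (Wr 2 (Bin Add (Bin Mul (Var 7) (Var 0)) (Var 8)) (Bin Mul (Lit 4) (Var 0))))
    (\<lambda>T \<sigma>'. T \<le> 2 + 3 * n \<and> (\<exists>D. mat \<sigma>' (DM(a := D)) \<and> (\<forall>v<n. D v = 4 * n))) \<sigma>"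
  proof (rule wp_For_le[where I = "\<lambda>i \<sigma>'. \<exists>D. mat \<sigma>' (DM(a := D)) \<and> (\<forall>v<i. D v = 4 * n)"
        and \<tau> = "\<lambda>_. 1" and m = n and X = "{8}" and A = "{2}"], goal_cases)
    case (1 i \<sigma>')
    then obtain D where D: "mat \<sigma>' (DM(a := D))" "\<forall>v<i. D v = 4 * n" by blast
    have r: "reg \<sigma>' 7 = int a" "reg \<sigma>' 0 = int n" using agree_reg[OF 1(5)] s r0 by auto
    have "mat (seta 2 (int a * int n + int i) (4 * int n) \<sigma>') (DM(a := D(i := 4 * n)))"
      using mat_upd[OF D(1) s(3) 1(1), of "4 * n"] by simp
    moreover have "\<forall>v<Suc i. (D(i := 4 * n)) v = 4 * n" using D(2) by (auto simp: less_Suc_eq)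
    ultimately have "\<exists>D. mat (seta 2 (int a * int n + int i) (4 * int n) \<sigma>') (DM(a := D)) \<and> (\<forall>v<Suc i. D v = 4 * n)" by blast
    then show ?case using r 1(1,2) s(3) i4 by simp
  next
    case 3
    then show ?case using s(4) by (intro exI[of _ "DM a"]) auto
  qed (use s r0 n_le in auto)
  have loop: "wp w (Wh (Bin Less (Var 13) (Var 14)) bfs_body)
    (\<lambda>T \<sigma>2. T \<le> 1 + 7 * n + 7 * M \<and> mat \<sigma>2 (DM(a := gdist_nat n E a))) \<sigma>1"
    if "adjrep n M nb \<sigma>1" "reg \<sigma>1 7 = int a" "bfs_state a DM \<sigma>1 D [a] 0" for \<sigma>1 D
  proof (rule wp_Wh[where I = "\<lambda>\<sigma>. \<exists>D q h. bfs_state a DM \<sigma> D q h" and \<Phi> = pot], goal_cases)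
    case 1
    then show ?case using that by blast
  next
    case (2 \<sigma>2)
    then obtain D q h where I: "bfs_state a DM \<sigma>2 D q h" by blast
    then have "length q \<le> n" "h \<le> length q" using bfs_bounds(1) by (auto simp: bfs_state_def)
    then show ?case using I by (simp add: bfs_state_def qrep_def)
  next
    case (3 \<sigma>2)
    then obtain D q h where I: "bfs_state a DM \<sigma>2 D q h" by blast
    have h: "h < length q" using 3(3) I by (auto simp: bfs_state_def qrep_def)
    have ar: "adjrep n M nb \<sigma>2" using adjrep_agree[OF that(1) 3(2)] by simp
    have r7: "reg \<sigma>2 7 = int a" using agree_reg[OF 3(2)] that by simp
    show ?case by (rule wp_conseq[OF wp_bfs_body[OF ar r7 s(3) I h]]) blast
  next
    case (4 T \<sigma>2)
    then obtain D q h where I: "bfs_state a DM \<sigma>2 D q h" by blast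
    have "h = length q" using 4(3) I by (auto simp: bfs_state_def qrep_def split: if_splits)
    then have "D v = gdist_nat n E a v" if "v < n" for v
      using bfs_finish[OF _ _ that] I by (auto simp: bfs_state_def)
    then have m: "mat \<sigma>2 (DM(a := gdist_nat n E a))" using I by (auto simp: bfs_state_def mat_def)
    have "pot \<sigma>1 \<le> (\<Sum>u<n. 7 + 7 * length (nb u))" unfolding pot_def by (rule sum_mono2) auto
    also have "\<dots> = 7 * n + 7 * (\<Sum>u<n. length (nb u))" by (simp add: sum.distrib sum_distrib_left)
    also have "\<dots> \<le> 7 * n + 7 * M" using sum_nb by simp
    finally show ?case using m 4(4) by simp
  qed
  show ?thesis unfolding bfs_def wp_simps(4)
  proof (rule wp_conseq_agree[OF 1, where X = "{8}" and A = "{2}"], goal_cases)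
    case (1 T1 \<sigma>')
    then obtain D where D: "mat \<sigma>' (DM(a := D))" "\<forall>v<n. D v = 4 * n" by blast
    have r: "reg \<sigma>' 7 = int a" "reg \<sigma>' 0 = int n" using agree_reg[OF 1(2)] s r0 by auto
    let ?s1 = "seta 2 (int a * int n + int a) 0 \<sigma>'"
    let ?s = "setr 14 1 (setr 13 0 (seta 5 0 (int a) ?s1))"
    let ?D = "(\<lambda>_. 4 * n)(a := 0)"
    have "mat ?s1 (DM(a := D(a := 0)))" using mat_upd[OF D(1) s(3) s(3), of 0] by simp
    then have "mat ?s (DM(a := ?D))" using D(2) by (auto simp: mat_def)
    moreover have "qrep ?s [a]" by (simp add: qrep_def)
    moreover have "bfs_inv n E a ?D [a]" by (rule bfs_start[OF s(3)])
    ultimately have "bfs_state a DM ?s ?D [a] 0" by (simp add: bfs_state_def bfs_done_def)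
    moreover have "adjrep n M nb ?s" using adjrep_agree[OF s(1) 1(2)] by (simp add: adjrep_def)
    ultimately have "wp w (Wh (Bin Less (Var 13) (Var 14)) bfs_body)
      (\<lambda>T \<sigma>2. T \<le> 1 + 7 * n + 7 * M \<and> mat \<sigma>2 (DM(a := gdist_nat n E a))) ?s"
      using loop[of ?s ?D] r by simp
    then have "wp w (Wh (Bin Less (Var 13) (Var 14)) bfs_body)
      (\<lambda>T \<sigma>2. T1 + (1 + (1 + (1 + (1 + T)))) \<le> 7 + 10 * n + 7 * M \<and> mat \<sigma>2 (DM(a := gdist_nat n E a))) ?s"
      by (rule wp_conseq) (use 1(1) in auto)
    then show ?case using r s(3) by simp
  qed auto
qed

lemma wp_apsp:
  assumes s: "adjrep n M nb \<sigma>" "mat \<sigma> DM"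
  shows "wp w apsp (\<lambda>T \<sigma>'. T \<le> 2 + n * (9 + 10 * n + 7 * M) \<and> mat \<sigma>' (gdist_nat n E)) \<sigma>"
  unfolding apsp_def
proof (rule wp_For_le[where I = "\<lambda>i \<sigma>'. \<exists>DM. mat \<sigma>' DM \<and> (\<forall>a<i. DM a = gdist_nat n E a)"
        and \<tau> = "\<lambda>_. 7 + 10 * n + 7 * M" and m = n and X = "{7,8,9,12,13,14,15,17,18}" and A = "{2,5}"], goal_cases)
  case (1 i \<sigma>')
  then obtain DM where D: "mat \<sigma>' DM" "\<forall>a<i. DM a = gdist_nat n E a" by blast
  have a: "adjrep n M nb \<sigma>'" using adjrep_agree[OF s(1) 1(5)] by simp
  show ?case
  proof (rule wp_conseq[OF wp_bfs[OF a 1(2,1) D(1)]], goal_cases)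
    case (1 T \<sigma>2)
    then show ?case using D(2) by (auto simp: less_Suc_eq intro!: exI[of _ "DM(i := gdist_nat n E i)"])
  qed
next
  case (2 T \<sigma>')
  then have "mat \<sigma>' (gdist_nat n E)" by (auto simp: mat_def)
  then show ?case using 2 by (simp add: algebra_simps)
qed (use s n_le in \<open>auto simp: adjrep_def\<close>)

end

section \<open>The whole algorithm\<close>

primrec sizes :: "nat \<Rightarrow> cmd" where
  "sizes 0 = NOP"
| "sizes (Suc j) = Sq (sizes j) (Sq (Asg 11 (radE j Sub)) (ball_sizes (11 + j)))"

text \<open>Vertex 0 is put into \<open>S\<close> so that there is always a candidate.\<close>

definition prep :: "nat \<Rightarrow> cmd" where
  "prep k = Sq (Wr 6 (Lit 0) (Lit 1)) (Sq (Asg 11 (Var 3)) (Sq (ball_sizes 10) (Sq (sizes k)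
     (Sq (Asg 11 (Var 3)) (Sq (greedy 10) (Sq (Asg 11 (Var 4)) (greedy 11)))))))"

definition ceil_sqrt :: cmd where
  "ceil_sqrt = Sq (Asg 5 (Lit 0)) (Wh (Bin Less (Bin Mul (Var 5) (Var 5)) (Var 0)) (inc 5))"

text \<open>Finite distances are below \<open>n\<close>, so cutting \<open>R\<close> off at
  \<open>n\<close> keeps the covers and makes all radii smaller than \<open>4 * n\<close>.\<close>

definition params :: "nat \<Rightarrow> cmd" where
  "params k = Sq (IfC (Bin Less (Var 0) (Var 2)) (Asg 2 (Var 0)) NOP)
     (Sq (Asg 3 (Bin Div (Var 2) (Lit (2 * int k - 1)))) (Sq (Asg 4 (Bin Sub (Var 2) (Var 3)))
     (Sq (Asg 16 (Bin Add (Var 1) (Var 1))) ceil_sqrt)))"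

definition search_prog :: "nat \<Rightarrow> cmd" where
  "search_prog k = Sq (params k) (Sq adj_lists (Sq apsp (Sq (prep k) (Sq (level k (k - 1) 0)
     (IfC (Var 6) (Asg 0 (Lit 2)) (Asg 0 (Lit 1)))))))"

text \<open>Two trivial inputs are answered by 1 at once: for \<open>n < k\<close> there is no set
  of \<open>k\<close> vertices and the radius is infinite, and a negative \<open>R\<close> is below
  every radius.\<close>

definition main :: "nat \<Rightarrow> cmd" where
  "main k = IfC (Bin Less (Var 0) (Lit (int k))) (Asg 0 (Lit 1))
     (IfC (Bin Less (Var 2) (Lit 0)) (Asg 0 (Lit 1)) (search_prog k))"

lemma mod_regs_sizes: "mod_regs (sizes k) \<subseteq> {7, 8, 9, 11}" and mod_arrs_sizes: "mod_arrs (sizes k) \<subseteq> {11..<11 + k}"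
  by (induction k) auto

lemma main_frag_simps [simp]:
  "mod_regs ceil_sqrt = {5}" "mod_arrs ceil_sqrt = {}"
  "mod_regs (params k) = {2, 3, 4, 5, 16}" "mod_arrs (params k) = {}"
  by (auto simp: ceil_sqrt_def params_def)

lemma mod_regs_prep: "mod_regs (prep k) \<subseteq> {7, 8, 9, 10, 11}" and mod_arrs_prep: "mod_arrs (prep k) \<subseteq> {6, 7, 10} \<union> {11..}"
  using mod_regs_sizes[of k] mod_arrs_sizes[of k] by (auto simp: prep_def)

section \<open>Correctness and cost of the preprocessing\<close>

context dist_machine begin

lemma wp_sizes:
  assumes s: "dmat s" "reg s 3 = int al" "reg s 4 = int \<rho>" "al \<le> n" "\<rho> \<le> n"
    and j: "\<forall>j<i. 2 * j * al \<le> \<rho> \<and> in_range w (2 * int j)"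
  shows "wp w (sizes i) (\<lambda>T s'. T \<le> 1 + i * (3 + n * (6 + 4 * n)) \<and>
     (\<forall>j<i. \<forall>v<n. arr s' (11 + j) (int v) = int (card (ball (\<rho> - 2 * j * al) v)))) s"
  using j
proof (induction i)
  case (Suc i)
  then have IH: "wp w (sizes i) (\<lambda>T s'. T \<le> 1 + i * (3 + n * (6 + 4 * n)) \<and>
     (\<forall>j<i. \<forall>v<n. arr s' (11 + j) (int v) = int (card (ball (\<rho> - 2 * j * al) v)))) s" by simp
  have i: "2 * i * al \<le> \<rho>" "in_range w (2 * int i)" using Suc.prems by auto
  show ?case unfolding sizes.simps wp_simps(4) wp_simps(2)
  proof (rule wp_conseq_agree[OF IH, where X = "{7,8,9,11}" and A = "{11..<11 + i}"], goal_cases)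
    case (1 T \<sigma>)
    note f = 1(2)
    have d: "dmat \<sigma>" using dmat_agree[OF s(1) f] by simp
    have r: "reg \<sigma> 3 = int al" "reg \<sigma> 4 = int \<rho>" using agree_reg[OF f] s by auto
    define rr where "rr = \<rho> - 2 * i * al"
    have rn: "rr \<le> n" using s(5) by (simp add: rr_def)
    have rr: "int \<rho> - 2 * int i * int al = int rr" using i(1) by (simp add: rr_def of_nat_diff)
    have "2 * i * al \<le> 8 * n" using i(1) s(5) by linarith
    from in_range_le(1)[OF this] have ii: "in_range w (2 * int i * int al)" by simp
    have "wp w (ball_sizes (11 + i)) (\<lambda>u s2. T + (1 + u) \<le> 1 + Suc i * (3 + n * (6 + 4 * n)) \<and>
        (\<forall>j<Suc i. \<forall>v<n. arr s2 (11 + j) (int v) = int (card (ball (\<rho> - 2 * j * al) v)))) (setr 11 (int rr) \<sigma>)"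
    proof (rule wp_conseq_agree[OF wp_ball_sizes[of _ rr], where X = "{7,8,9}" and A = "{11 + i}"], goal_cases)
      case (5 T2 s2)
      have "arr s2 (11 + j) = arr \<sigma> (11 + j)" if "j < i" for j using agree_arr[OF 5(2)] that by simp
      then show ?case using 5(1) 1(1) by (auto simp: less_Suc_eq rr_def)
    qed (use d rn in auto)
    then show ?case using r rr i(2) ii s(4,5) rn by simp
  qed (use mod_regs_sizes mod_arrs_sizes in auto)
qed simp

lemma wp_prep:
  assumes s: "dmat s" "reg s 3 = int al" "reg s 4 = int \<rho>" "reg s 5 = int t" "al \<le> n" "\<rho> \<le> n" "t \<le> 8 * n" "k > 0"
    and j: "\<forall>j<k. 2 * j * al \<le> \<rho> \<and> in_range w (2 * int j)" and a6: "\<forall>v<n. arr s 6 (int v) = 0"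
  shows "wp w (prep k) (\<lambda>T s'. T \<le> 20 + 8 * n + (k + 1) * (3 + n * (6 + 4 * n)) + 2 * halvings n * (4 + n * (9 + 8 * n)) \<and>
     (\<forall>v<n. arr s' 10 (int v) = int (card (ball al v))) \<and>
     (\<forall>j<k. \<forall>v<n. arr s' (11 + j) (int v) = int (card (ball (\<rho> - 2 * j * al) v))) \<and>
     (\<exists>S. flags s' 6 S \<and> 0 \<in> S \<and> S \<subseteq> {..<n} \<and> t * card S \<le> t + 4 * n * halvings n \<and>
       (\<forall>v<n. t \<le> card (ball \<rho> v) \<longrightarrow> (\<exists>s\<in>S. d v s \<le> \<rho>)) \<and>
       (\<forall>v<n. t \<le> card (ball al v) \<longrightarrow> (\<exists>s\<in>S. d v s \<le> al)))) s"
proof -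
  let ?b = "2 + n * (6 + 4 * n)" and ?g = "4 + 4 * n + halvings n * (4 + n * (9 + 8 * n))"
  let ?s0 = "setr 11 (int al) (seta 6 0 1 s)"
  have f0: "flags ?s0 6 {0}" using a6 by (auto simp: flags_def)
  have d0: "dmat ?s0" using s(1) by (simp add: dmat_def)
  have S0: "{0} \<subseteq> {..<n}" using n_gt_0 by auto
  have 4: "wp w (greedy 11) (\<lambda>T s'. T \<le> ?g \<and> (\<exists>S'. flags s' 6 S' \<and>
     S \<subseteq> S' \<and> S' \<subseteq> {..<n} \<and> t * card S' \<le> t * card S + 2 * n * halvings n \<and>
     (\<forall>v<n. t \<le> card (ball \<rho> v) \<longrightarrow> (\<exists>s\<in>S'. d v s \<le> \<rho>)))) (setr 11 (int \<rho>) \<sigma>)"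
    if "dmat \<sigma>" "flags \<sigma> 6 S" "S \<subseteq> {..<n}" "reg \<sigma> 5 = int t" "\<forall>v<n. arr \<sigma> 11 (int v) = int (card (ball \<rho> v))" for \<sigma> S
    by (rule wp_greedy) (use that s in auto)
  have 3: "wp w (greedy 10) (\<lambda>T s'. T \<le> ?g \<and> (\<exists>S'. flags s' 6 S' \<and>
     {0} \<subseteq> S' \<and> S' \<subseteq> {..<n} \<and> t * card S' \<le> t * card {0::nat} + 2 * n * halvings n \<and>
     (\<forall>v<n. t \<le> card (ball al v) \<longrightarrow> (\<exists>s\<in>S'. d v s \<le> al)))) (setr 11 (int al) \<sigma>)"
    if "dmat \<sigma>" "flags \<sigma> 6 {0}" "reg \<sigma> 5 = int t" "\<forall>v<n. arr \<sigma> 10 (int v) = int (card (ball al v))" for \<sigma>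
    by (rule wp_greedy) (use that s S0 in auto)
  have 1: "wp w (ball_sizes 10) (\<lambda>t s'. t \<le> ?b \<and> (\<forall>v<n. arr s' 10 (int v) = int (card (ball al v)))) ?s0"
    by (rule wp_ball_sizes) (use d0 s in auto)
  let ?Q = "\<lambda>T s'. T \<le> 20 + 8 * n + (k + 1) * (3 + n * (6 + 4 * n)) + 2 * halvings n * (4 + n * (9 + 8 * n)) \<and>
     (\<forall>v<n. arr s' 10 (int v) = int (card (ball al v))) \<and>
     (\<forall>j<k. \<forall>v<n. arr s' (11 + j) (int v) = int (card (ball (\<rho> - 2 * j * al) v))) \<and>
     (\<exists>S. flags s' 6 S \<and> 0 \<in> S \<and> S \<subseteq> {..<n} \<and> t * card S \<le> t + 4 * n * halvings n \<and>
       (\<forall>v<n. t \<le> card (ball \<rho> v) \<longrightarrow> (\<exists>s\<in>S. d v s \<le> \<rho>)) \<and>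
       (\<forall>v<n. t \<le> card (ball al v) \<longrightarrow> (\<exists>s\<in>S. d v s \<le> al)))"
  have "wp w (ball_sizes 10) (\<lambda>T1. wp w (sizes k) (\<lambda>T2. wp w (Asg 11 (Var 3)) (\<lambda>T3. wp w (greedy 10) (\<lambda>T4.
      wp w (Asg 11 (Var 4)) (\<lambda>T5. wp w (greedy 11) (\<lambda>T6. ?Q (1 + (1 + (T1 + (T2 + (T3 + (T4 + (T5 + T6))))))))))))) ?s0"
  proof (rule wp_conseq_agree[OF 1, where X = "{7,8,9}" and A = "{10}"], goal_cases)
    case (1 T1 s1)
    note g1 = 1(2)
    have d1: "dmat s1" using dmat_agree[OF d0 g1] by simp
    have r1: "reg s1 3 = int al" "reg s1 4 = int \<rho>" "reg s1 5 = int t" using agree_reg[OF g1] s by auto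
    have f1: "flags s1 6 {0}" using flags_agree[OF f0 g1] by simp
    show ?case
    proof (rule wp_conseq_agree[OF wp_sizes[OF d1 r1(1,2) s(5,6) j], where X = "{7,8,9,11}" and A = "{11..<11 + k}"], goal_cases)
      case (1 T2 s2)
      note g2 = 1(2)
      have d2: "dmat s2" using dmat_agree[OF d1 g2] by simp
      have r2: "reg s2 3 = int al" "reg s2 4 = int \<rho>" "reg s2 5 = int t" using agree_reg[OF g2] r1 by auto
      have f2: "flags s2 6 {0}" using flags_agree[OF f1 g2] by simp
      have a2: "\<forall>v<n. arr s2 10 (int v) = int (card (ball al v))"
        using agree_arr[OF g2, of 10] \<open>T1 \<le> ?b \<and> (\<forall>v<n. arr s1 10 (int v) = int (card (ball al v)))\<close> by simp
      have "wp w (greedy 10) (\<lambda>T4. wp w (Asg 11 (Var 4)) (\<lambda>T5. wp w (greedy 11)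
          (\<lambda>T6. ?Q (1 + (1 + (T1 + (T2 + (1 + (T4 + (T5 + T6)))))))))) (setr 11 (int al) s2)"
      proof (rule wp_conseq_agree[OF 3[OF d2 f2 r2(3) a2], where X = "{7,8,9,10}" and A = "{6,7}"], goal_cases)
        case c: (1 T4 s3)
        note g3 = c(2)
        from c(1) obtain S where S: "flags s3 6 S" "{0} \<subseteq> S" "S \<subseteq> {..<n}" "t * card S \<le> t * card {0::nat} + 2 * n * halvings n"
          "\<forall>v<n. t \<le> card (ball al v) \<longrightarrow> (\<exists>s\<in>S. d v s \<le> al)" by blast
        have d3: "dmat s3" using dmat_agree[OF _ g3] d2 by simp
        have r3: "reg s3 3 = int al" "reg s3 4 = int \<rho>" "reg s3 5 = int t" using agree_reg[OF g3] r2 by auto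
        have a3: "arr s3 a = arr s2 a" if "a \<ge> 10" for a using agree_arr[OF g3, of a] that by simp
        \<comment> \<open>Array 11 belongs to \<open>j = 0\<close>, so its radius is
          \<open>\<rho>\<close> itself and it serves the second greedy run.\<close>
        have a11: "\<forall>v<n. arr s3 11 (int v) = int (card (ball \<rho> v))"
          using 1(1) s(8) a3[of 11] by (auto dest: spec[of _ 0])
        have "wp w (greedy 11) (\<lambda>T6. ?Q (1 + (1 + (T1 + (T2 + (1 + (T4 + (1 + T6)))))))) (setr 11 (int \<rho>) s3)"
        proof (rule wp_conseq_agree[OF 4[OF d3 S(1,3) r3(3) a11], where X = "{7,8,9,10}" and A = "{6,7}"], goal_cases)
          case e: (1 T6 s4)
          from e(1) obtain S' where S': "flags s4 6 S'" "S \<subseteq> S'" "S' \<subseteq> {..<n}" "t * card S' \<le> t * card S + 2 * n * halvings n"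
            "\<forall>v<n. t \<le> card (ball \<rho> v) \<longrightarrow> (\<exists>s\<in>S'. d v s \<le> \<rho>)" by blast
          have a4: "arr s4 a = arr s2 a" if "a \<ge> 10" for a using agree_arr[OF e(2), of a] a3 that by simp
          have "\<exists>S. flags s4 6 S \<and> 0 \<in> S \<and> S \<subseteq> {..<n} \<and> t * card S \<le> t + 4 * n * halvings n \<and>
             (\<forall>v<n. t \<le> card (ball \<rho> v) \<longrightarrow> (\<exists>s\<in>S. d v s \<le> \<rho>)) \<and>
             (\<forall>v<n. t \<le> card (ball al v) \<longrightarrow> (\<exists>s\<in>S. d v s \<le> al))"
            using S S' by (intro exI[of _ S']) (auto, blast)
          moreover have "1 + (1 + (T1 + (T2 + (1 + (T4 + (1 + T6)))))) \<le>
            20 + 8 * n + (k + 1) * (3 + n * (6 + 4 * n)) + 2 * halvings n * (4 + n * (9 + 8 * n))"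
            using e(1) c(1) 1(1) \<open>T1 \<le> ?b \<and> (\<forall>v<n. arr s1 10 (int v) = int (card (ball al v)))\<close>
            by (simp add: algebra_simps)
          ultimately show ?case using a4 a2 1(1) by simp
        qed auto
        then show ?case using r3 s(6) by simp
      qed auto
      then show ?case using r2 s(5) by simp
    qed (use mod_regs_sizes mod_arrs_sizes in auto)
  qed auto
  then show ?thesis unfolding prep_def wp_simps(4) using s by simp
qed

end

context machine begin

lemma wp_ceil_sqrt:
  assumes "reg s 0 = int n"
  shows "wp w ceil_sqrt (\<lambda>T s'. T \<le> 2 + 2 * n \<and> (\<exists>t. reg s' 5 = int t \<and> n \<le> t * t \<and> 0 < t \<and> (t - 1) * (t - 1) < n)) s"
proof -
  have i: "in_range w (int t * int t)" if "t \<le> n" for t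
  proof (rule in_range_sq)
    have "int t * int t \<le> (int n + 1) * (int n + 1)" using that by (intro mult_mono) auto
    then show "int t * int t \<le> 64 * (int n + 1) * (int n + 1)"
      unfolding mult.assoc using zero_le_mult_iff[of "int n + 1" "int n + 1"] by linarith
  qed simp
  let ?I = "\<lambda>\<sigma>. \<exists>t. reg \<sigma> 5 = int t \<and> t \<le> n \<and> (t = 0 \<or> (t - 1) * (t - 1) < n)"
  have "wp w (Wh (Bin Less (Bin Mul (Var 5) (Var 5)) (Var 0)) (inc 5))
    (\<lambda>T s'. 1 + T \<le> 2 + 2 * n \<and> (\<exists>t. reg s' 5 = int t \<and> n \<le> t * t \<and> 0 < t \<and> (t - 1) * (t - 1) < n)) (setr 5 0 s)"
  proof (rule wp_Wh[where I = ?I and \<Phi> = "\<lambda>\<sigma>. 2 * (n - nat (reg \<sigma> 5))"], goal_cases)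
    case 1
    then show ?case by simp
  next
    case (2 \<sigma>)
    then show ?case using agree_reg[OF 2(2), of 0] assms i by auto
  next
    case (3 \<sigma>)
    then obtain t where t: "reg \<sigma> 5 = int t" "t \<le> n" by blast
    have "int t * int t < int n" using 3(3) t agree_reg[OF 3(2), of 0] assms by simp
    then have tn: "t * t < n" by (metis of_nat_less_iff of_nat_mult)
    moreover have "t \<le> t * t" by simp
    ultimately have "t < n" by linarith
    moreover have "nat (int t + 1) = Suc t" by simp
    ultimately show ?case using t tn by (auto intro!: exI[of _ "Suc t"])
  next
    case (4 T \<sigma>)
    then obtain t where t: "reg \<sigma> 5 = int t" "t \<le> n" "t = 0 \<or> (t - 1) * (t - 1) < n" by blast
    have "\<not> int t * int t < int n" using 4(3) t agree_reg[OF 4(2), of 0] assms by simp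
    then have "n \<le> t * t" by (metis not_less of_nat_less_iff of_nat_mult)
    moreover from this have "t > 0" using n_gt_0 by (cases t) auto
    ultimately show ?case using t 4(4) by auto
  qed
  then show ?thesis unfolding ceil_sqrt_def by simp
qed

lemma wp_params:
  assumes s: "reg s 0 = int n" "reg s 1 = int m" "reg s 2 = int R0" "in_range w (int R0)" "m \<le> n * n" "2 * int k \<le> 2 ^ w" "k > 0"
  defines "R \<equiv> min R0 n"
  shows "wp w (params k) (\<lambda>T s'. T \<le> 7 + 2 * n \<and> reg s' 2 = int R \<and> reg s' 3 = int (R div (2 * k - 1)) \<and>
     reg s' 4 = int (R - R div (2 * k - 1)) \<and> reg s' 16 = int (2 * m) \<and>
     (\<exists>t. reg s' 5 = int t \<and> n \<le> t * t \<and> 0 < t \<and> (t - 1) * (t - 1) < n)) s"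
proof -
  let ?al = "R div (2 * k - 1)"
  let ?s = "setr 16 (int (2 * m)) (setr 4 (int (R - ?al)) (setr 3 (int ?al) (setr 2 (int R) s)))"
  have k1: "2 * int k - 1 = int (2 * k - 1)" using s(7) by (simp add: of_nat_diff)
  have dv: "int R div (2 * int k - 1) = int ?al" unfolding k1 by (simp add: zdiv_int)
  have al: "?al \<le> R" "R \<le> n" by (rule div_le_dividend) (simp add: R_def)
  have sub: "int R - int ?al = int (R - ?al)" using al by (simp add: of_nat_diff)
  have im: "in_range w (int m)" "in_range w (int m + int m)" using in_range_uM(3)[of 0 m "2 * n * n"] in_range_uM(3)[of 0 "2 * m" "2 * n * n"] s(5) by auto
  have ik: "in_range w (2 * int k - 1)" using s(6,7) by (auto simp: in_range_def)
  have "wp w ceil_sqrt (\<lambda>T s'. T \<le> 2 + 2 * n \<and> (\<exists>t. reg s' 5 = int t \<and> n \<le> t * t \<and> 0 < t \<and> (t - 1) * (t - 1) < n)) ?s"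
    by (rule wp_ceil_sqrt) (use s in auto)
  then have W: "wp w ceil_sqrt (\<lambda>T s'. 2 + (1 + (1 + (1 + T))) \<le> 7 + 2 * n \<and> reg s' 2 = int R \<and> reg s' 3 = int (R div (2 * k - 1)) \<and>
     reg s' 4 = int (R - R div (2 * k - 1)) \<and> reg s' 16 = int (2 * m) \<and>
     (\<exists>t. reg s' 5 = int t \<and> n \<le> t * t \<and> 0 < t \<and> (t - 1) * (t - 1) < n)) ?s"
  proof (rule wp_conseq_agree[where X = "{5}" and A = "{}"], goal_cases)
    case (1 T s')
    then show ?case using agree_reg[OF 1(2)] by simp
  qed auto
  have "?al \<le> 8 * n" "R - ?al \<le> 8 * n" using al by linarith+
  note ial = this[THEN in_range_le(1)]
  have W2: "wp w (Sq (Asg 3 (Bin Div (Var 2) (Lit (2 * int k - 1)))) (Sq (Asg 4 (Bin Sub (Var 2) (Var 3)))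
     (Sq (Asg 16 (Bin Add (Var 1) (Var 1))) ceil_sqrt)))
     (\<lambda>T s'. 2 + T \<le> 7 + 2 * n \<and> reg s' 2 = int R \<and> reg s' 3 = int (R div (2 * k - 1)) \<and>
     reg s' 4 = int (R - R div (2 * k - 1)) \<and> reg s' 16 = int (2 * m) \<and>
     (\<exists>t. reg s' 5 = int t \<and> n \<le> t * t \<and> 0 < t \<and> (t - 1) * (t - 1) < n)) \<sigma>" if "\<sigma> = setr 2 (int R) s" for \<sigma>
    unfolding wp_simps(4) wp_simps(2) ev.simps safe.simps bop_val.simps that setr_simps
    using W s(2) dv sub im ik al ial by simp
  show ?thesis
  proof (cases "n < R0")
    case True
    then have "R = n" by (simp add: R_def)
    then show ?thesis unfolding params_def wp_simps(4)[of _ "IfC _ _ _"] using W2[OF refl] True s(1-4)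
      by (simp del: wp_simps(4))
  next
    case False
    then have R: "R = R0" by (simp add: R_def)
    then have "setr 2 (int R) s = s" using s(3) fun_upd_triv[of "reg s" 2] by (simp add: setr_def)
    then show ?thesis unfolding params_def wp_simps(4)[of _ "IfC _ _ _"] using W2[of s] False s(1-4)
      by (simp del: wp_simps(4))
  qed
qed

end


section \<open>The number of candidates and the answer of the program\<close>

definition cands :: "nat \<Rightarrow> nat \<Rightarrow> nat" where
  "cands k n = 1 + (4 * halvings n + 1) * nat \<lceil>sqrt (real n)\<rceil> + (if k = 1 then n else 0)"

definition ticks :: "nat \<Rightarrow> nat \<Rightarrow> nat \<Rightarrow> nat" where
  "ticks k n m = 20 + 2 * n + 8 * m + n * (9 + 10 * n + 14 * m) +
     (20 + 8 * n + (k + 1) * (3 + n * (6 + 4 * n)) + 2 * halvings n * (4 + n * (9 + 8 * n))) +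
     level_time n (cands k n) (k - 1)"

lemma edge_list_facts:
  assumes "graph n E" "edge_list es E"
  shows "\<forall>(a, b)\<in>set es. a < n \<and> b < n \<and> a \<noteq> b" "length es \<le> n * n" "length es = card E"
    "v \<in> set (nbrs es u) \<longleftrightarrow> (u, v) \<in> adj E"
proof -
  have E: "E = set (map (\<lambda>(u, v). {u, v}) es)" "distinct (map (\<lambda>(u, v). {u, v}) es)"
    using assms(2) by (auto simp: edge_list_def)
  show 1: "\<forall>(a, b)\<in>set es. a < n \<and> b < n \<and> a \<noteq> b"
  proof (clarify)
    fix a b assume "(a, b) \<in> set es"
    then have "{a, b} \<in> E" using E(1) by force
    then obtain u v where "{a, b} = {u, v}" "u < n" "v < n" "u \<noteq> v" using assms(1) by (auto simp: graph_def)
    then show "a < n \<and> b < n \<and> a \<noteq> b" by (auto simp: doubleton_eq_iff)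
  qed
  show "length es = card E" using E distinct_card by fastforce
  have "distinct es" using E(2) by (simp add: distinct_map)
  moreover have "set es \<subseteq> {..<n} \<times> {..<n}" using 1 by auto
  ultimately show "length es \<le> n * n"
    using distinct_card[of es] card_mono[of "{..<n} \<times> {..<n}" "set es"] by (simp add: card_cartesian_product)
  show "v \<in> set (nbrs es u) \<longleftrightarrow> (u, v) \<in> adj E" by (simp add: set_nbrs adj_def E(1))
qed

text \<open>The first premise is the outcome of the two greedy runs. Dividing it by \<open>t\<close>
  and using \<open>n \<le> t * t\<close> gives \<open>c \<le> 1 + 4 * t * halvings n\<close>; the
  last premise bounds \<open>t\<close> by the rounded square root.\<close>

lemma cands_bound:
  assumes "t * c \<le> t + 4 * n * halvings n" "n \<le> t * t" "0 < t" "(t - 1) * (t - 1) < n"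
  shows "c + t \<le> cands k n"
proof -
  have "4 * n * halvings n \<le> 4 * (t * t) * halvings n" using assms(2) by (intro mult_right_mono) auto
  then have "t * c \<le> t + 4 * (t * t) * halvings n" using assms(1) by linarith
  then have "t * c \<le> t * (1 + 4 * t * halvings n)" by (simp add: algebra_simps)
  then have c: "c \<le> 1 + 4 * t * halvings n" using assms(3) by (simp only: mult_le_cancel1)
  have "real (t - 1) * real (t - 1) < real n" using assms(4) by (metis of_nat_less_iff of_nat_mult)
  then have "real (t - 1) < sqrt (real n)" by (intro real_less_rsqrt) (simp add: power2_eq_square)
  then have "int (t - 1) < \<lceil>sqrt (real n)\<rceil>" by (simp add: less_ceiling_iff)
  then have t: "t \<le> nat \<lceil>sqrt (real n)\<rceil>" by linarith
  have "c + t \<le> 1 + (4 * halvings n + 1) * t" using c by (simp add: algebra_simps)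
  also have "\<dots> \<le> 1 + (4 * halvings n + 1) * nat \<lceil>sqrt (real n)\<rceil>" using t by (intro add_left_mono mult_left_mono) auto
  finally show ?thesis by (simp add: cands_def)
qed

lemma input_simps [simp]:
  "reg (input_state n es R) = (\<lambda>_. 0)(0 := int n, 1 := int (length es), 2 := R)"
  "i < length es \<Longrightarrow> arr (input_state n es R) 0 (int i) = int (fst (es ! i))"
  "i < length es \<Longrightarrow> arr (input_state n es R) (Suc 0) (int i) = int (snd (es ! i))"
  "a > 1 \<Longrightarrow> arr (input_state n es R) a = (\<lambda>_. 0)"
  by (auto simp: input_state_def)

lemma k_radius_cover:
  assumes "k_radius k n E \<le> enat R0" "graph n E"
  shows "\<exists>C\<subseteq>{..<n}. card C = k \<and> (\<forall>v<n. \<exists>c\<in>C. gdist_nat n E c v \<le> min R0 n)"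
proof -
  obtain C where C: "C \<subseteq> {..<n}" "card C = k" "\<forall>v<n. \<exists>c\<in>C. \<exists>l\<le>R0. (c, v) \<in> adj E ^^ l"
    using assms(1) unfolding k_radius_le by blast
  have "\<exists>c\<in>C. gdist_nat n E c v \<le> min R0 n" if v: "v < n" for v
  proof -
    obtain c l where c: "c \<in> C" "l \<le> R0" "(c, v) \<in> adj E ^^ l" using C(3) v by blast
    have "gdist_nat n E c v \<le> l" using c(3) by (auto simp: gdist_nat_def intro: Least_le)
    moreover have "gdist_nat n E c v < n" using gdist_nat_less[OF assms(2) _ c(3)] C(1) c(1) by auto
    ultimately show ?thesis using c by (intro bexI[of _ c]) auto
  qed
  then show ?thesis using C by blast
qed

text \<open>Chosen centers may coincide, whereas the \<open>k\<close>-radius ranges over sets of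
  exactly \<open>k\<close> vertices; \<open>k \<le> n\<close> leaves room to fill up.\<close>

lemma cover_k_radius:
  assumes "set ys \<subseteq> {..<n}" "length ys = k" "k \<le> n" "r < 4 * n" "\<forall>v<n. \<exists>x\<in>set ys. gdist_nat n E x v \<le> r"
  shows "k_radius k n E \<le> enat r"
proof -
  have "card (set ys) \<le> k" using assms(2) card_length by blast
  then obtain C where C: "set ys \<subseteq> C" "C \<subseteq> {..<n}" "card C = k"
    using exists_subset_between[of "set ys" k "{..<n}"] assms(1,3) by auto
  have "\<exists>c\<in>C. \<exists>l\<le>r. (c, v) \<in> adj E ^^ l" if "v < n" for v
    using assms(5) that C(1) gdist_nat_le_iff[OF assms(4)] by blast
  then show ?thesis unfolding k_radius_le using C by blast
qed

text \<open>Answer 2 follows from the cover behind the flag, and answer 1 is the contraposition of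
  completeness, started by \<open>good_init\<close>. The 2 in front of \<open>T\<close> is reserved
  for the tests in \<open>main\<close>.\<close>

lemma wp_search_prog:
  assumes mach: "machine w n" and G: "graph n E" "edge_list es E" and kk: "0 < k" "k \<le> n" "2 * int k \<le> 2 ^ w"
    and R0: "in_range w (int R0)"
  defines "R \<equiv> min R0 n"
  defines "al \<equiv> R div (2 * k - 1)"
  shows "wp w (search_prog k) (\<lambda>T s'. 2 + T \<le> ticks k n (length es) \<and>
     ((reg s' 0 = 1 \<and> \<not> k_radius k n E \<le> enat R0) \<or> (reg s' 0 = 2 \<and> k_radius k n E \<le> enat (R + (R - al)))))
     (input_state n es (int R0))"
proof -
  interpret machine w n by (rule mach)
  interpret dist_machine w n "gdist_nat n E"
    using gdist_nat_finite_dist[OF G(1)] gdist_nat_le_4n[OF G(1)] by (simp add: dist_machine_def dist_machine_axioms_def machine_axioms)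
  note EF = edge_list_facts[OF G]
  let ?m = "length es" and ?s = "input_state n es (int R0)"
  interpret graph_machine w n E "2 * ?m" "nbrs es"
  proof
    show "length (nbrs es u) \<le> 2 * ?m" for u by (rule length_nbrs)
    show "(\<Sum>u<n. length (nbrs es u)) \<le> 2 * ?m" by (rule sum_length_nbrs)
  qed (use G EF in auto)
  let ?Q = "\<lambda>T s'. 2 + T \<le> ticks k n ?m \<and>
     ((reg s' 0 = 1 \<and> \<not> k_radius k n E \<le> enat R0) \<or> (reg s' 0 = 2 \<and> k_radius k n E \<le> enat (R + (R - al))))"
  define \<rho> where "\<rho> = R - al"
  have alR: "(2 * k - 1) * al \<le> R" "al \<le> R" "R \<le> n" "R = \<rho> + al"
    unfolding \<rho>_def al_def using div_le_dividend[of R "2 * k - 1"] times_div_less_eq_dividend[of "2 * k - 1" R]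
    by (simp_all only: le_add_diff_inverse2) (simp add: R_def)
  have rn: "\<rho> \<le> n" "al \<le> n" using alR by auto
  have alj: "\<forall>j<k. 2 * j * al \<le> \<rho> \<and> in_range w (2 * int j)"
  proof (intro allI impI conjI)
    fix j assume j: "j < k"
    have "(2 * j + 1) * al \<le> (2 * k - 1) * al" using j by (intro mult_right_mono) auto
    with alR show "2 * j * al \<le> \<rho>" by simp
    show "in_range w (2 * int j)" using j kk(3) by (simp add: in_range_def)
  qed
  have p: "wp w (params k) (\<lambda>T s'. T \<le> 7 + 2 * n \<and> reg s' 2 = int R \<and> reg s' 3 = int al \<and>
     reg s' 4 = int \<rho> \<and> reg s' 16 = int (2 * ?m) \<and>
     (\<exists>t. reg s' 5 = int t \<and> n \<le> t * t \<and> 0 < t \<and> (t - 1) * (t - 1) < n)) ?s"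
    unfolding \<rho>_def al_def R_def by (rule wp_params) (use R0 kk EF(2) in auto)
  show ?thesis unfolding search_prog_def wp_simps(4)
  proof (rule wp_conseq_agree[OF p, where X = "{2,3,4,5,16}" and A = "{}"], goal_cases)
    case (1 T1 s1)
    note f1 = 1(2)
    from 1(1) obtain t where t: "reg s1 5 = int t" "n \<le> t * t" "0 < t" "(t - 1) * (t - 1) < n"
      and r1: "T1 \<le> 7 + 2 * n" "reg s1 2 = int R" "reg s1 3 = int al" "reg s1 4 = int \<rho>" "reg s1 16 = int (2 * ?m)" by blast
    have tn: "t \<le> 8 * n"
    proof (cases "t \<le> 1")
      case False
      then have "t - 1 \<le> (t - 1) * (t - 1)" by simp
      then show ?thesis using t(4) by linarith
    qed (use n_gt_0 in auto)
    have r1': "reg s1 0 = int n" "reg s1 1 = int ?m" "reg s1 6 = 0" using agree_reg[OF f1] by auto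
    have a1: "arr s1 a = arr ?s a" for a using agree_arr[OF f1] by simp
    have A: "wp w adj_lists (\<lambda>T s'. T \<le> 2 + 8 * ?m \<and> adjrep n (2 * ?m) (nbrs es) s') s1"
      by (rule wp_adj_lists) (use r1 r1' a1 EF(1,2) in auto)
    show ?case
    proof (rule wp_conseq_agree[OF A, where X = "{12,17,18}" and A = "{3,4}"], goal_cases)
      case (1 T2 s2)
      note f2 = 1(2)
      have T2: "T2 \<le> 2 + 8 * ?m" and adj2: "adjrep n (2 * ?m) (nbrs es) s2" using 1(1) by auto
      have "mat s2 (\<lambda>_ _. 0)" using agree_arr[OF f2, of 2] a1 by (simp add: mat_def)
      note P = wp_apsp[OF adj2 this]
      show ?case
      proof (rule wp_conseq_agree[OF P, where X = "{7,8,9,12,13,14,15,17,18}" and A = "{2,5}"], goal_cases)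
        case (1 T3 s3)
        note f3 = 1(2)
        have f13: "agree {7,8,9,12,13,14,15,17,18} {2,3,4,5} s1 s3" using f2 f3 by (auto simp: agree_def)
        have r3: "reg s3 0 = int n" "reg s3 2 = int R" "reg s3 3 = int al" "reg s3 4 = int \<rho>" "reg s3 5 = int t" "reg s3 6 = 0"
          using agree_reg[OF f13] r1 r1' t by auto
        have d3: "dmat s3" using 1(1) r3 by (simp add: dmat_def mat_def)
        have z3: "\<forall>v<n. arr s3 6 (int v) = 0" using agree_arr[OF f13, of 6] a1 by simp
        have T3: "T3 \<le> 2 + n * (9 + 10 * n + 14 * ?m)" using 1(1) by simp
        show ?case
        proof (rule wp_conseq_agree[OF wp_prep[OF d3 r3(3-5) rn(2,1) tn kk(1) alj z3], where X = "{7,8,9,10,11}" and A = "{6,7,10} \<union> {11..}"], goal_cases)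
          case (1 T4 s4)
          note f4 = 1(2)
          from 1(1) obtain S where HS: "flags s4 6 S" "0 \<in> S" "S \<subseteq> {..<n}" "t * card S \<le> t + 4 * n * halvings n"
            "\<forall>v<n. t \<le> card (ball \<rho> v) \<longrightarrow> (\<exists>s\<in>S. gdist_nat n E v s \<le> \<rho>)"
            "\<forall>v<n. t \<le> card (ball al v) \<longrightarrow> (\<exists>s\<in>S. gdist_nat n E v s \<le> al)" by blast
          interpret search_machine w n "gdist_nat n E" k R al \<rho> t S
            by unfold_locales (use alR kk HS tn in auto)
          have d4: "dmat s4" by (rule dmat_agree[OF d3 f4]) auto
          have r4: "reg s4 2 = int R" "reg s4 3 = int al" "reg s4 4 = int \<rho>" "reg s4 5 = int t" "reg s4 6 = of_bool False"
            using agree_reg[OF f4] r3 by auto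
          have e4: "env s4" unfolding env_def using d4 r4 HS(1) 1(1) by auto
          have x4: "xs_regs s4 []" by (simp add: xs_regs_def)
          have K: "card S + t \<le> cands k n" by (rule cands_bound[OF HS(4) t(2-4)])
          have "wp w (level k (k - 1) 0) (\<lambda>T s'. T \<le> level_time n (cands k n) (k - 1) \<and>
            (\<exists>out'. reg s' 6 = of_bool out' \<and> (False \<longrightarrow> out') \<and> (good (k - 1) [] \<longrightarrow> out') \<and>
            (out' \<longrightarrow> False \<or> (\<exists>ys. length ys = k \<and> covers ys)))) s4"
            using wp_level[OF e4 x4 _ r4(5) K] kk(1) by (simp add: cands_def)
          then show ?case
          proof (rule wp_conseq, goal_cases)
            case (1 T5 s5)
            then obtain out where o: "reg s5 6 = of_bool out" "good (k - 1) [] \<longrightarrow> out"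
              "out \<longrightarrow> (\<exists>ys. length ys = k \<and> covers ys)" by auto
            have T: "2 + (T1 + (T2 + (T3 + (T4 + (T5 + 2))))) \<le> ticks k n ?m"
              using r1(1) T2 T3 1(1) \<open>T4 \<le> _ \<and> _\<close> unfolding ticks_def by linarith
            show ?case
            proof (cases out)
              case True
              then obtain ys where ys: "length ys = k" "covers ys" using o by blast
              have "\<forall>v<n. \<exists>x\<in>set ys. gdist_nat n E x v \<le> R + \<rho>"
                using ys(2) by (auto simp: covers_def far_def not_less)
              moreover have "R + \<rho> < 4 * n" using alR rn n_gt_0 by linarith
              ultimately have "k_radius k n E \<le> enat (R + \<rho>)"
                using cover_k_radius[OF _ ys(1) kk(2), of "R + \<rho>" E] ys(2) by (simp add: covers_def)
              then have "k_radius k n E \<le> enat (R + (R - al))" by (simp add: \<rho>_def)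
              then show ?thesis using True o(1) T by (simp add: numeral_2_eq_2)
            next
              case False
              have "\<not> k_radius k n E \<le> enat R0"
              proof
                assume "k_radius k n E \<le> enat R0"
                from k_radius_cover[OF this G(1)] obtain C where "C \<subseteq> {..<n}" "card C = k"
                  "\<forall>v<n. \<exists>c\<in>C. gdist_nat n E c v \<le> R" unfolding R_def by blast
                from good_init[OF this] o(2) False show False by blast
              qed
              then show ?thesis using False o(1) T by (simp add: numeral_2_eq_2)
            qed
          qed
        qed (use mod_regs_prep mod_arrs_prep in auto)
      qed auto
    qed auto
  qed auto
qed

lemma wp_main:
  assumes mach: "machine w n" and G: "graph n E" "edge_list es E" and k: "0 < k" "2 * int k \<le> 2 ^ w"
    and R: "in_range w R"
  shows "wp w (main k) (\<lambda>T s'. T \<le> ticks k n (length es) \<and>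
     ((reg s' 0 = 1 \<and> (n < k \<or> R < 0 \<or> \<not> k_radius k n E \<le> enat (nat R))) \<or>
      (reg s' 0 = 2 \<and> 0 \<le> R \<and> k_radius k n E \<le> enat (min (nat R) n + (min (nat R) n - min (nat R) n div (2 * k - 1))))))
     (input_state n es R)"
proof -
  interpret machine w n by (rule mach)
  have t3: "3 \<le> ticks k n (length es)" by (simp add: ticks_def)
  have ik: "in_range w (int k)" unfolding in_range_def using k by (intro conjI) linarith+
  show ?thesis
  proof (cases "n < k \<or> R < 0")
    case True
    then show ?thesis unfolding main_def using R ik t3 by auto
  next
    case False
    then have R0: "int (nat R) = R" and kn: "k \<le> n" by auto
    have "wp w (search_prog k) (\<lambda>T s'. 2 + T \<le> ticks k n (length es) \<and>
     ((reg s' 0 = 1 \<and> \<not> k_radius k n E \<le> enat (nat R)) \<or>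
      (reg s' 0 = 2 \<and> k_radius k n E \<le> enat (min (nat R) n + (min (nat R) n - min (nat R) n div (2 * k - 1))))))
      (input_state n es R)"
      using wp_search_prog[OF mach G k(1) kn k(2), of "nat R"] R R0 by simp
    then have "wp w (search_prog k) (\<lambda>T s'. Suc (Suc T) \<le> ticks k n (length es) \<and>
     ((reg s' 0 = 1 \<and> (n < k \<or> R < 0 \<or> \<not> k_radius k n E \<le> enat (nat R))) \<or>
      (reg s' 0 = 2 \<and> 0 \<le> R \<and> k_radius k n E \<le> enat (min (nat R) n + (min (nat R) n - min (nat R) n div (2 * k - 1))))))
      (input_state n es R)"
      by (rule wp_conseq) (use False in auto)
    then show ?thesis unfolding main_def using False R ik by simp
  qed
qed

lemma vars_below_farE: "30 + 2 * j \<le> d \<Longrightarrow> vars_below d (farE j)"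
  by (induction j) auto

lemma regs_below_level: "40 + 2 * (i + j) \<le> d \<Longrightarrow> regs_below d (level k i j)"
  by (induction i arbitrary: j)
    (auto simp: leaf_def build_step_def build_def branch_def near_U_def final_def check_list_def find_pivot_def candidate_def vars_below_farE)

lemma regs_below_sizes: "40 \<le> d \<Longrightarrow> regs_below d (sizes j)"
  by (induction j) (auto simp: ball_sizes_def)

lemma regs_below_main: "regs_below (40 + 2 * k) (main k)"
  using regs_below_level[of "k - 1" 0 "40 + 2 * k" k] regs_below_sizes[of "40 + 2 * k" k]
  by (simp add: main_def search_prog_def params_def ceil_sqrt_def adj_lists_def arc_def apsp_def bfs_def bfs_body_def
      visit_def prep_def ball_sizes_def greedy_def pass_def count_def remove_def)

section \<open>Asymptotic running time\<close>

lemma halvings_le: "n \<ge> 1 \<Longrightarrow> real (halvings n) \<le> 1 + log 2 (real n)"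
proof (induction n rule: halvings.induct)
  case (1 n)
  show ?case
  proof (cases "n = 1")
    case True
    then show ?thesis by (simp add: halvings.simps)
  next
    case False
    then have n: "n \<ge> 2" using 1 by simp
    then have "real (halvings (n div 2)) \<le> 1 + log 2 (real (n div 2))" using 1 by simp
    also have "log 2 (real (n div 2)) \<le> log 2 (real n / 2)"
      using n by (simp add: div_greater_zero_iff)
    also have "\<dots> = log 2 (real n) - 1" using n by (simp add: log_divide)
    finally show ?thesis using n by (simp add: halvings.simps[of n])
  qed
qed

lemma halvings_le_ln: assumes "n \<ge> 1" shows "real (halvings n) \<le> 2 * (1 + ln (real n))"
proof -
  have "ln 2 \<ge> (1 / 2 :: real)" using ln2_ge_two_thirds by simp
  then have "ln (real n) / ln 2 \<le> ln (real n) / (1 / 2)" using assms by (intro divide_left_mono) auto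
  then show ?thesis using halvings_le[OF assms] by (simp add: log_def)
qed

text \<open>Each level multiplies by \<open>K\<close>, and the leaf contributes
  \<open>n * K\<close>. The linear terms are dominated because \<open>K \<ge> 1\<close>.\<close>

lemma level_time_le:
  assumes "n \<ge> 1" "K \<ge> 1"
  shows "level_time n K i \<le> 200 * (i + 1) * n * K ^ (i + 1)"
proof (induction i)
  case 0
  define X where "X = n * K"
  have "1 \<le> X" "n \<le> X" "K \<le> X" using assms by (auto simp: X_def)
  then have "12 + 60 * n + 30 * X + 30 * K \<le> 200 * X" by linarith
  then show ?case by (simp add: X_def algebra_simps)
next
  case (Suc i)
  define X where "X = n * K ^ (Suc i + 1)"
  have "1 \<le> K ^ (Suc i + 1)" using assms by simp
  then have "n \<le> X" "1 \<le> X" using assms unfolding X_def by (auto simp: Suc_le_eq)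
  have "K * level_time n K i \<le> K * (200 * (i + 1) * n * K ^ (i + 1))" using Suc by (rule mult_left_mono) simp
  also have "\<dots> = 200 * (i + 1) * X" by (simp add: X_def)
  finally have "level_time n K (Suc i) \<le> 6 + 20 * n + 200 * (i + 1) * X" by simp
  also have "\<dots> \<le> 200 * (Suc i + 1) * X" using \<open>n \<le> X\<close> \<open>1 \<le> X\<close> by (simp add: algebra_simps)
  finally show ?case by (simp only: X_def mult.assoc)
qed

lemma cands_le:
  assumes "n \<ge> 1"
  shows "real (cands k n) \<le> 20 * sqrt (real n) * (1 + ln (real n)) + (if k = 1 then real n else 0)"
proof -
  define L where "L = 1 + ln (real n)"
  define x where "x = sqrt (real n)"
  have L: "L \<ge> 1" using assms by (simp add: L_def)
  have x: "x \<ge> 1" using assms by (simp add: x_def)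
  have c: "real (nat \<lceil>x\<rceil>) \<le> 2 * x" using x by linarith
  have "real (halvings n) \<le> 2 * L" using halvings_le_ln[OF assms] by (simp add: L_def)
  then have "(4 * real (halvings n) + 1) * real (nat \<lceil>x\<rceil>) \<le> (9 * L) * (2 * x)"
    using c L x by (intro mult_mono) auto
  moreover have "1 \<le> x * L" using mult_mono[of 1 x 1 L] x L by simp
  moreover have "real (cands k n) = 1 + (4 * real (halvings n) + 1) * real (nat \<lceil>x\<rceil>) + (if k = 1 then real n else 0)"
    by (simp add: cands_def x_def algebra_simps)
  ultimately have "real (cands k n) \<le> 20 * x * L + (if k = 1 then real n else 0)" by (simp add: algebra_simps)
  then show ?thesis by (simp add: x_def L_def)
qed

text \<open>The condition \<open>n \<le> m + 1\<close> makes \<open>n * n\<close> at most the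
  target, which absorbs all quadratic costs. The search costs \<open>n\<close> times the
  \<open>k\<close>-th power of the number of candidates; for \<open>k = 1\<close> this is again of
  order \<open>n * n\<close> up to a logarithm.\<close>

lemma ticks_soft_O:
  assumes "k > 0"
  shows "soft_O (\<lambda>n m. if n \<le> m + 1 then real (A * ticks k n m) else 0)
    (\<lambda>n m. real m * real n + real n powr (real k / 2 + 1))"
proof -
  \<comment> \<open>The three summands stand for the fixed costs, the \<open>k\<close> ball size
    computations and the search. The base 21 is the 20 of \<open>cands_le\<close> plus 1 for the
    extra \<open>n\<close> if \<open>k = 1\<close>.\<close>
  define C :: real where "C = real A * (200 + 20 * (real k + 1) + 200 * real k * 21 ^ k)"
  have "(if n \<le> m + 1 then real (A * ticks k n m) else 0) \<le>
      C * (real m * real n + real n powr (real k / 2 + 1)) * (1 + ln (real n)) ^ (k + 1)"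
    if n: "n \<ge> 1" for n m
  proof -
    define L where "L = 1 + ln (real n)"
    define g where "g = real m * real n + real n powr (real k / 2 + 1)"
    define x where "x = real n"
    have L: "L \<ge> 1" using n by (simp add: L_def)
    have x: "x \<ge> 1" using n by (simp add: x_def)
    have g0: "g \<ge> 0" by (simp add: g_def)
    have C0: "C \<ge> 0" by (simp add: C_def)
    have L1: "1 \<le> L ^ k" "L \<le> L ^ (k + 1)" "1 \<le> L ^ (k + 1)" "L ^ k \<le> L ^ (k + 1)"
      using L one_le_power[OF L, of k] one_le_power[OF L, of "k + 1"] power_increasing[of k "k + 1" L]
        self_le_power[OF L, of "k + 1"] by auto
    show ?thesis
    proof (cases "n \<le> m + 1")
      case False
      then show ?thesis using C0 g0 L by (simp add: g_def L_def)
    next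
      case True
      have p1: "x \<le> x powr (real k / 2 + 1)" using x powr_mono[of 1 "real k / 2 + 1" x] by simp
      have "x * x \<le> (real m + 1) * x" using True x by (intro mult_right_mono) (auto simp: x_def)
      then have nn: "x * x \<le> g" using p1 by (simp add: g_def x_def algebra_simps)
      have xx: "x \<le> x * x" "1 \<le> x * x" using x mult_mono[of 1 x 1 x] by auto
      have "real m * 1 \<le> real m * x" using x by (intro mult_left_mono) auto
      then have m: "real m \<le> g" "x * real m \<le> g" unfolding g_def x_def[symmetric]
        by (auto simp: algebra_simps intro: add_increasing2)
      have K1: "cands k n \<ge> 1" by (simp add: cands_def)
      have level: "real (level_time n (cands k n) (k - 1)) \<le> 200 * real k * 21 ^ k * (g * L ^ k)"
      proof -
        have "level_time n (cands k n) (k - 1) \<le> 200 * k * n * cands k n ^ k"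
          using level_time_le[OF n K1, of "k - 1"] assms by simp
        then have "real (level_time n (cands k n) (k - 1)) \<le> real (200 * k * n * cands k n ^ k)" by (simp only: of_nat_le_iff)
        then have c: "real (level_time n (cands k n) (k - 1)) \<le> 200 * real k * (x * real (cands k n) ^ k)" by (simp add: x_def)
        have "x * real (cands k n) ^ k \<le> 21 ^ k * (g * L ^ k)"
        proof (cases "k = 1")
          case True
          have s: "sqrt x \<le> x" using x by (intro real_le_lsqrt) (auto simp: power2_eq_square)
          have "real (cands k n) \<le> 20 * sqrt x * L + x" using cands_le[OF n, of k] True by (simp add: x_def L_def)
          also have "\<dots> \<le> 20 * (x * L) + x * L"
          proof -
            have "sqrt x * L \<le> x * L" "x * 1 \<le> x * L" using s L x by (auto intro: mult_right_mono mult_left_mono)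
            then show ?thesis unfolding mult.assoc by linarith
          qed
          finally have "x * real (cands k n) \<le> x * (21 * (x * L))"
            using x by (intro mult_left_mono) (auto simp: mult.commute)
          also have "\<dots> = 21 * ((x * x) * L)" by simp
          also have "\<dots> \<le> 21 * (g * L)" using nn L by (intro mult_left_mono mult_right_mono) auto
          finally show ?thesis using True by simp
        next
          case False
          have "real (cands k n) \<le> 20 * sqrt x * L" using cands_le[OF n, of k] False by (simp add: x_def L_def)
          then have "real (cands k n) ^ k \<le> (20 * sqrt x * L) ^ k" by (rule power_mono) simp
          also have "\<dots> = 20 ^ k * (sqrt x ^ k * L ^ k)" by (simp add: power_mult_distrib)
          also have "sqrt x ^ k = x powr (real k / 2)"
            using x by (simp add: powr_half_sqrt[symmetric] powr_powr powr_realpow[symmetric])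
          finally have "x * real (cands k n) ^ k \<le> x * (20 ^ k * (x powr (real k / 2) * L ^ k))"
            using x by (intro mult_left_mono) auto
          also have "\<dots> = 20 ^ k * (x powr (real k / 2 + 1) * L ^ k)" using x by (simp add: powr_add)
          also have "\<dots> \<le> 21 ^ k * (g * L ^ k)"
            using L by (intro mult_mono power_mono) (auto simp: g_def x_def)
          finally show ?thesis .
        qed
        then have "200 * real k * (x * real (cands k n) ^ k) \<le> 200 * real k * (21 ^ k * (g * L ^ k))"
          by (intro mult_left_mono) auto
        with c show ?thesis by (simp only: mult.assoc)
      qed
      define y where "y = g * L ^ (k + 1)"
      have gy: "g \<le> y" using L1 g0 mult_left_mono[of 1 "L ^ (k + 1)" g] by (simp add: y_def)
      have b: "1 \<le> y" "x \<le> y" "real m \<le> y" "x * x \<le> y" "x * real m \<le> y"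
        using gy nn xx m by linarith+
      have halvings: "real (halvings n) \<le> 2 * L" using halvings_le_ln[OF n] by (simp add: L_def)
      have gL: "g * L \<le> y" unfolding y_def using L1 g0 by (intro mult_left_mono) auto
      have "real (halvings n) * (x * x) \<le> (2 * L) * g" using halvings nn L x by (intro mult_mono) auto
      then have l2: "real (halvings n) * (x * x) \<le> 2 * y" using gL by (simp add: algebra_simps)
      have l1: "real (halvings n) \<le> real (halvings n) * (x * x)" "real (halvings n) * x \<le> real (halvings n) * (x * x)"
        using mult_left_mono[OF xx(2), of "real (halvings n)"] mult_left_mono[OF xx(1), of "real (halvings n)"] by auto
      have "200 * real k * 21 ^ k * (g * L ^ k) \<le> 200 * real k * 21 ^ k * y"
        unfolding y_def using L1 g0 by (intro mult_left_mono) auto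
      with level have lev2: "real (level_time n (cands k n) (k - 1)) \<le> 200 * real k * 21 ^ k * y" by linarith
      have kb: "real k * 1 \<le> real k * y" "real k * x \<le> real k * y" "real k * (x * x) \<le> real k * y"
        using b by (intro mult_left_mono; simp)+
      have "real (ticks k n m) = 40 + 10 * x + 8 * real m + (9 * x + 10 * (x * x) + 14 * (x * real m)) +
         (3 + 6 * x + 4 * (x * x)) + (3 * (real k * 1) + 6 * (real k * x) + 4 * (real k * (x * x))) +
         (8 * real (halvings n) + 18 * (real (halvings n) * x) + 16 * (real (halvings n) * (x * x))) + real (level_time n (cands k n) (k - 1))"
        by (simp add: ticks_def x_def algebra_simps)
      also have "\<dots> \<le> 200 * y + 20 * ((real k + 1) * y) + 200 * real k * 21 ^ k * y"
        using b l1 l2 lev2 kb by (simp add: algebra_simps)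
      finally have "real A * real (ticks k n m) \<le> real A * ((200 + 20 * (real k + 1) + 200 * real k * 21 ^ k) * y)"
        by (intro mult_left_mono) (auto simp: algebra_simps)
      then show ?thesis using True by (simp add: C_def y_def g_def L_def mult.assoc)
    qed
  qed
  then show ?thesis unfolding soft_O_def by blast
qed

theorem mainTheorem8:
  fixes k :: nat
  assumes "k > 0"
  shows "\<exists>(P :: com) (T :: nat \<Rightarrow> nat \<Rightarrow> nat) (q :: nat) (c :: real).
    soft_O (\<lambda>n m. real (T n m)) (\<lambda>n m. real m * real n + real n powr (real k / 2 + 1)) \<and>
    c > 0 \<and>
    (\<forall>(w :: nat) (n :: nat) (E :: nat set set) (es :: (nat \<times> nat) list) (R :: int).
       n \<ge> 1 \<and> graph n E \<and> card E + 1 \<ge> n \<and> edge_list es E \<and>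
       (n + 1) ^ q \<le> 2 ^ w \<and> - (2 ^ w) \<le> R \<and> R < 2 ^ w \<longrightarrow>
       halts_within w (T n (card E)) P (input_state n es R) \<and>
       output_prob w (T n (card E)) P (input_state n es R)
         (\<lambda>out.
            (out = 1 \<and> ereal_of_enat (k_radius k n E) > ereal (real_of_int R)) \<or>
            (out = 2 \<and> ereal_of_enat (k_radius k n E)
               \<le> ereal (real_of_int (2 * R - \<lfloor>real_of_int R / (2 * real k - 1)\<rfloor>))))
         \<ge> 1 - 1 / real n powr c)"
proof -
  let ?P = "compile (40 + 2 * k) (main k)"
  \<comment> \<open>\<open>soft_O\<close> also quantifies over \<open>m < n - 1\<close>\<close>
  let ?T = "\<lambda>n m. if n \<le> m + 1 then overhead (main k) * ticks k n m else 0"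
  let ?ok = "\<lambda>n E R out. (out = (1::int) \<and> ereal_of_enat (k_radius k n E) > ereal (real_of_int R)) \<or>
            (out = 2 \<and> ereal_of_enat (k_radius k n E)
               \<le> ereal (real_of_int (2 * R - \<lfloor>real_of_int R / (2 * real k - 1)\<rfloor>)))"
  have "(\<lambda>n m. real (?T n m)) = (\<lambda>n m. if n \<le> m + 1 then real (overhead (main k) * ticks k n m) else 0)"
    by (intro ext) simp
  then have so: "soft_O (\<lambda>n m. real (?T n m)) (\<lambda>n m. real m * real n + real n powr (real k / 2 + 1))"
    using ticks_soft_O[OF assms, of "overhead (main k)"] by simp
  have "halts_within w (?T n (card E)) ?P (input_state n es R) \<and>
      output_prob w (?T n (card E)) ?P (input_state n es R) (?ok n E R) \<ge> 1 - 1 / real n powr 1"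
    if n: "n \<ge> 1" and G: "graph n E" and m: "card E + 1 \<ge> n" and es: "edge_list es E"
      and w: "(n + 1) ^ (k + 10) \<le> 2 ^ w" and R: "- (2 ^ w) \<le> R" "R < 2 ^ w" for w n E es R
  proof -
    \<comment> \<open>The exponent \<open>k + 10\<close> serves two purposes: ten powers give the
      bound of \<open>machine\<close>, as \<open>64 = 2 ^ 6\<close>, and the whole power exceeds
      \<open>2 * k\<close>.\<close>
    have "64 * (n + 1) ^ 4 = 2 ^ 6 * (n + 1) ^ 4" by simp
    also have "\<dots> \<le> (n + 1) ^ 6 * (n + 1) ^ 4" using n by (intro mult_right_mono power_mono) auto
    also have "\<dots> = (n + 1) ^ 10" by (simp flip: power_add)
    also have "\<dots> \<le> (n + 1) ^ (k + 10)" by (rule power_increasing) auto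
    finally have "64 * (n + 1) ^ 4 \<le> 2 ^ w" using w by linarith
    then have "int (64 * (n + 1) ^ 4) \<le> int (2 ^ w)" by (simp only: of_nat_le_iff)
    then have "machine w n" using n by unfold_locales (auto simp: add.commute)
    have "2 * k \<le> 2 ^ Suc k" using less_exp[of k] by simp
    also have "\<dots> \<le> (2::nat) ^ (k + 10)" by (rule power_increasing) auto
    also have "\<dots> \<le> (n + 1) ^ (k + 10)" using n by (intro power_mono) auto
    finally have "2 * k \<le> 2 ^ w" using w by linarith
    then have "int (2 * k) \<le> int (2 ^ w)" by (simp only: of_nat_le_iff)
    then have kw: "2 * int k \<le> 2 ^ w" by simp
    have iR: "in_range w R" using R by (simp add: in_range_def)
    let ?s = "input_state n es R"
    from wp_main[OF \<open>machine w n\<close> G es assms kw iR] obtain t s' where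
      big: "big w (main k) ?s t s'" and t: "t \<le> ticks k n (length es)" and
      out: "(reg s' 0 = 1 \<and> (n < k \<or> R < 0 \<or> \<not> k_radius k n E \<le> enat (nat R))) \<or>
      (reg s' 0 = 2 \<and> 0 \<le> R \<and> k_radius k n E \<le> enat (min (nat R) n + (min (nat R) n - min (nat R) n div (2 * k - 1))))"
      unfolding wp_def by blast
    from compile_correct[OF big regs_below_main] obtain \<sigma> where
      \<sigma>: "exec w ?P ?s (overhead (main k) * t) \<sigma>" "sim (40 + 2 * k) s' \<sigma>" by blast
    have r0: "reg \<sigma> 0 = reg s' 0" using \<sigma>(2) by (simp add: sim_def)
    have "overhead (main k) * t \<le> ?T n (card E)" using t m edge_list_facts(3)[OF G es] by simp
    from exec_mono[OF \<sigma>(1) this] have run: "run w (?T n (card E)) (?P, ?s) = return_pmf (Skip, \<sigma>)"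
      by (simp add: exec_def)
    have "?ok n E R (reg \<sigma> 0)"
      using out
    proof (elim disjE conjE, goal_cases)
      case 1
      \<comment> \<open>The infimum ranges over an empty family.\<close>
      then have "k_radius k n E = \<infinity>"
      proof -
        have "card C \<noteq> k" if "C \<subseteq> {..<n}" for C
          using card_mono[OF finite_lessThan that] 1(2) by simp
        then have "{C. C \<subseteq> {..<n} \<and> card C = k} = {}" by blast
        then show ?thesis unfolding k_radius_def by (simp only: image_empty Inf_empty top_enat_def)
      qed
      then show ?case using 1 r0 by simp
    next
      case 2
      have "ereal (real_of_int R) < 0" using 2 by simp
      also have "0 \<le> ereal_of_enat (k_radius k n E)" by simp
      finally show ?case using 2 r0 by simp
    next
      case 3
      show ?case
      proof (cases "k_radius k n E")
        case (enat r)
        then have "nat R < r" using 3(2) by simp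
        then have "real_of_int R < real r" by linarith
        then show ?thesis using 3 r0 enat by simp
      qed (use 3 r0 in simp)
    next
      case 4
      define R' where "R' = min (nat R) n"
      define K where "K = 2 * k - 1"
      obtain r where r: "k_radius k n E = enat r" "r \<le> R' + (R' - R' div K)"
        using 4(3) unfolding R'_def[symmetric] K_def[symmetric] by (cases "k_radius k n E") auto
      define a where "a = nat R"
      have Ra: "R = int a" using 4(2) by (simp add: a_def)
      have K: "K > 0" "2 * real k - 1 = real K" using assms by (auto simp: K_def of_nat_diff)
      have "\<lfloor>real_of_int R / (2 * real k - 1)\<rfloor> = int (a div K)"
        unfolding K(2) Ra by (simp add: floor_divide_of_nat_eq)
      \<comment> \<open>This undoes the cut-off. Raising the radius from \<open>R'\<close> to
        \<open>a\<close> raises the quotient by at most \<open>a - R'\<close>, but twice the radius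
        by \<open>2 * (a - R')\<close>, so the claimed bound only grows.\<close>
      moreover have "R' + (R' - R' div K) + a div K \<le> 2 * a"
      proof -
        have "a = R' + (a - R')" by (simp add: R'_def a_def)
        then have "a div K = (R' + (a - R')) div K" by simp
        also have "\<dots> \<le> (R' + K * (a - R')) div K" using K(1) by (intro div_le_mono) simp
        also have "\<dots> = R' div K + (a - R')" using K(1) by simp
        finally have "a div K \<le> R' div K + (a - R')" .
        moreover have "R' div K \<le> R'" by simp
        moreover have "R' \<le> a" by (simp add: R'_def a_def)
        ultimately show ?thesis by linarith
      qed
      ultimately have "int r \<le> 2 * R - \<lfloor>real_of_int R / (2 * real k - 1)\<rfloor>" using r(2) Ra by linarith
      then have "real r \<le> real_of_int (2 * R - \<lfloor>real_of_int R / (2 * real k - 1)\<rfloor>)"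
        by (metis of_int_le_iff of_int_of_nat_eq)
      then show ?case using 4 r0 r(1) by simp
    qed
    then have "output_prob w (?T n (card E)) ?P ?s (?ok n E R) = 1"
      unfolding output_prob_def run by (simp add: measure_return_pmf indicator_def)
    then show ?thesis unfolding halts_within_def run by simp
  qed
  \<comment> \<open>The success probability is 1, so the exponent \<open>c\<close> is arbitrary and
    1 is taken.\<close>
  then show ?thesis using so
    by (intro exI[of _ ?P] exI[of _ ?T] exI[of _ "k + 10"] exI[of _ "1::real"] conjI allI impI) simp_all
qed

end
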